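(* Let $\lambda=(\lambda_1,\dots,\lambda_k)\vdash N$ and $\gamma=(\gamma_1,\dots,\gamma_h)\vdash N+t$ be diagrams such that $\gamma$ is obtained from $\lambda$ by adding $t$ boxes in pairwise different columns, and assume $\gamma_1\le n=\dim V$. Write the added boxes as $$(i_1,j_{1,1}),\dots,(i_1,j_{1,s_1}),(i_2,j_{2,1}),\dots,(i_2,j_{2,s_2}),\dots,(i_p,j_{p,1}),\dots,(i_p,j_{p,s_p})$$ with $1\le i_1<i_2<\dots<i_p\le h$, with $j_{r,a+1}=j_{r,a}+1$ for $1\le a<s_r$, and (consequently) $j_{q,a}<j_{r,b}$ for all $a,b$ whenever $q>r$. Let $\Lambda$ be a tableau of shape $\lambda$ on $\{1,\dots,N\}$ with content $(1,\dots,1)$. For $\pi\in\Sigma_{\gamma_{i_1}}$ let $T_{\lambda,\pi,\gamma}$ be the tableau of shape $\lambda$ on $\{1,\dots,n\}$ given by $$T_{\lambda,\pi,\gamma}(i,j)=\begin{cases}\pi(j)&\text{if } i=i_\ell\text{ for some }\ell\text{ and } j>j_{\ell+1,s_{\ell+1}}=\gamma_{i_{\ell+1}},\\ j&\text{otherwise,}\end{cases}$$ with the convention $j_{p+1,s_{p+1}}=0$. Then the element of $\bigotimes^{N+t}V$ $$g_{\lambda\leadsto\gamma}=\sum_{\pi\in\Sigma_{\gamma_{i_1}}}(-1)^\pi\,\mathbb Y_\Lambda(T_{\lambda,\pi,\gamma})\otimes\bigl(e_{\pi(j_{p,1})}\otimes\cdots\otimes e_{\pi(j_{p,s_p})}\otimes\cdots\otimes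 e_{\pi(j_{1,1})}\otimes\cdots\otimes e_{\pi(j_{1,s_1})}\bigr)$$ is the highest weight vector of one of the copies of $L_\gamma V$ that appear in the decomposition of $\mathbb Y_\Lambda(\bigotimes^NV)\otimes(\bigotimes^tV)\subseteq\bigotimes^{N+t}V$ into irreducible $\mathrm{GL}(V)$-modules.
   Context: $\Bbbk$ is a field of characteristic $0$, $V$ is a $\Bbbk$-vector space with basis $e_1,\dots,e_n$, $t\geq 1$. A diagram $\lambda$ is the set of boxes $(i,j)$ with $1\le i\le k$, $1\le j\le\lambda_i$; a tableau of shape $\lambda$ on $\{1,\dots,r\}$ is any map $\lambda\to\{1,\dots,r\}$; its content records how often each number occurs. Schur modules: $L_{(d)}V=\bigwedge^dV$, $L_{(1^d)}V=\mathrm{Sym}^dV$. $\Sigma_N$ acts on $\bigotimes^NV$ by $\sigma(v_1\otimes\dots\otimes v_N)=v_{\sigma^{-1}(1)}\otimes\dots\otimes v_{\sigma^{-1}(N)}$. For a tableau $\Lambda$ of shape $\lambda\vdash N$ with content $(1,\dots,1)$, let $\mathcal C_\Lambda$ (resp. $\mathcal R_\Lambda$) be the subgroup of $\Sigma_N$ of permutations preserving the set of entries of each column (resp. row) of $\Lambda$. The Young symmetrizer is $\mathbb Y_\Lambda:\bigotimes^NV\to\bigotimes^NV$, $\mathbb Y_\Lambda(x)=\sum_{\sigma\in\mathcal C_\Lambda}\sum_{\tau\in\mathcal R_\Lambda}(-1)^\tau\sigma\tau(x)$; one has $\mathbb Y_\Lambda(\bigotimes^NV)\cong L_\lambda V$.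 For a tableau $\Gamma$ of shape $\lambda$ on $\{1,\dots,n\}$, $\mathbb Y_\Lambda(\Gamma)$ denotes the value of $\mathbb Y_\Lambda$ on the pure tensor having $e_{\Gamma(i,j)}$ in tensor position $\Lambda(i,j)$ for all $(i,j)\in\lambda$. The highest weight vector (unique up to scalar) of an irreducible polynomial $\mathrm{GL}(V)$-module is its nonzero vector invariant under the group of unipotent maps with $e_i\mapsto e_i+(\text{linear combination of }e_j,\ j<i)$ for all $i$; for $L_\gamma V$ its weight is the transpose partition of $\gamma$. *)

theory Defs
  imports Complex_Main "HOL-Combinatorics.Permutations" "HOL-Library.Function_Algebras"
begin

section \<open>Tensor powers of a vector space with basis $e_1,\dots,e_n$\<close>

text \<open>
  The space \<open>V\<close> is the whole type \<open>'v\<close>, with scalar multiplication \<open>scale\<close> and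
  ordered basis \<open>e 1, \<dots>, e n\<close>.  The tensor power \<open>V \<otimes> \<dots> \<otimes> V\<close> (\<open>N\<close> factors) is realised
  by coordinates with respect to the basis \<open>e w\<^sub>1 \<otimes> \<dots> \<otimes> e w\<^sub>N\<close> indexed by the words
  \<open>w\<close> of length \<open>N\<close> in the letters \<open>1, \<dots>, n\<close>.  Words are lists, so the letter in
  tensor position \<open>p \<in> {1..N}\<close> is \<open>w ! (p - 1)\<close>.
\<close>

definition ordered_basis :: "('k::field \<Rightarrow> 'v::ab_group_add \<Rightarrow> 'v) \<Rightarrow> nat \<Rightarrow> (nat \<Rightarrow> 'v) \<Rightarrow> bool" where
  "ordered_basis scale n e \<longleftrightarrow>
     inj_on e {1..n} \<and> \<not> module.dependent scale (e ` {1..n}) \<and>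
     module.span scale (e ` {1..n}) = UNIV"

definition coord :: "('k::field \<Rightarrow> 'v::ab_group_add \<Rightarrow> 'v) \<Rightarrow> nat \<Rightarrow> (nat \<Rightarrow> 'v) \<Rightarrow> 'v \<Rightarrow> nat \<Rightarrow> 'k" where
  "coord scale n e v i = module.representation scale (e ` {1..n}) v (e i)"

type_synonym 'k tensor = "nat list \<Rightarrow> 'k"

definition tscale :: "'k::field \<Rightarrow> 'k tensor \<Rightarrow> 'k tensor" where
  "tscale c x = (\<lambda>w. c * x w)"

definition words :: "nat \<Rightarrow> nat \<Rightarrow> nat list set" where
  "words n N = {w. set w \<subseteq> {1..n} \<and> length w = N}"

definition tensor_power :: "nat \<Rightarrow> nat \<Rightarrow> 'k::field tensor set" where
  "tensor_power n N = {x. \<forall>w. w \<notin> words n N \<longrightarrow> x w = 0}"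

definition basis_tensor :: "nat list \<Rightarrow> 'k::field tensor" where
  "basis_tensor w = (\<lambda>u. if u = w then 1 else 0)"

text \<open>The pure tensor \<open>v\<^sub>1 \<otimes> \<dots> \<otimes> v\<^sub>N\<close>, expanded multilinearly.\<close>

definition pure_tensor ::
  "('k::field \<Rightarrow> 'v::ab_group_add \<Rightarrow> 'v) \<Rightarrow> nat \<Rightarrow> (nat \<Rightarrow> 'v) \<Rightarrow> 'v list \<Rightarrow> 'k tensor" where
  "pure_tensor scale n e vs =
     (\<lambda>w. if w \<in> words n (length vs) then \<Prod>p<length vs. coord scale n e (vs ! p) (w ! p) else 0)"

text \<open>The concatenation product \<open>(V \<otimes> \<dots> \<otimes> V) \<times> (V \<otimes> \<dots> \<otimes> V) \<rightarrow> V \<otimes> \<dots> \<otimes> V\<close>, whose first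
  argument has degree \<open>N\<close>.\<close>

definition tensor_prod :: "nat \<Rightarrow> 'k::field tensor \<Rightarrow> 'k tensor \<Rightarrow> 'k tensor" where
  "tensor_prod N x y = (\<lambda>w. x (take N w) * y (drop N w))"

definition tensor_prod_space :: "nat \<Rightarrow> 'k::field tensor set \<Rightarrow> 'k tensor set \<Rightarrow> 'k tensor set" where
  "tensor_prod_space N A B = module.span tscale {tensor_prod N x y | x y. x \<in> A \<and> y \<in> B}"

text \<open>The linear extension to degree \<open>N\<close> of a map given on basis tensors.\<close>

definition lin_ext :: "nat \<Rightarrow> nat \<Rightarrow> (nat list \<Rightarrow> 'k::field tensor) \<Rightarrow> 'k tensor \<Rightarrow> 'k tensor" where
  "lin_ext n N F x = (\<Sum>w\<in>words n N. tscale (x w) (F w))"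

text \<open>The action of an endomorphism \<open>g\<close> of \<open>V\<close>:
  \<open>e w\<^sub>1 \<otimes> \<dots> \<otimes> e w\<^sub>N \<mapsto> g (e w\<^sub>1) \<otimes> \<dots> \<otimes> g (e w\<^sub>N)\<close>.\<close>

definition tensor_act ::
  "('k::field \<Rightarrow> 'v::ab_group_add \<Rightarrow> 'v) \<Rightarrow> nat \<Rightarrow> (nat \<Rightarrow> 'v) \<Rightarrow> nat \<Rightarrow> ('v \<Rightarrow> 'v) \<Rightarrow> 'k tensor \<Rightarrow> 'k tensor" where
  "tensor_act scale n e N g = lin_ext n N (\<lambda>w. pure_tensor scale n e (map (\<lambda>i. g (e i)) w))"

text \<open>The action of the symmetric group on \<open>{1..N}\<close>: the letter in position \<open>p\<close> of the image
  is the letter in position \<open>\<sigma>\<^sup>-\<^sup>1(p)\<close> of the argument.\<close>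

definition place_act :: "nat \<Rightarrow> nat \<Rightarrow> (nat \<Rightarrow> nat) \<Rightarrow> 'k::field tensor \<Rightarrow> 'k tensor" where
  "place_act n N \<sigma> =
     lin_ext n N (\<lambda>w. basis_tensor (map (\<lambda>p. w ! (inv \<sigma> p - 1)) [1..<Suc N]))"

subsection \<open>Compatibility with pure tensors\<close>

lemma vector_space_tscale: "vector_space (tscale :: 'k::field \<Rightarrow> 'k tensor \<Rightarrow> 'k tensor)"
  by unfold_locales (auto simp: tscale_def fun_eq_iff algebra_simps)

lemma finite_words: "finite (words n N)"
  unfolding words_def by (rule finite_lists_length_eq) simp

lemma lin_ext_apply: "lin_ext n N F x u = (\<Sum>w\<in>words n N. x w * F w u)"
proof -
  have "(\<Sum>w\<in>A. tscale (x w) (F w)) u = (\<Sum>w\<in>A. x w * F w u)" for A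
    by (induction A rule: infinite_finite_induct) (auto simp: tscale_def)
  then show ?thesis by (simp add: lin_ext_def)
qed

lemma lin_ext_basis_tensor: "w \<in> words n N \<Longrightarrow> lin_ext n N F (basis_tensor w) = F w"
  by (rule ext) (simp add: lin_ext_apply basis_tensor_def finite_words
      if_distrib[of "\<lambda>c. c * _"] sum.delta cong: if_cong)

lemma coord_basis:
  assumes "vector_space scale" "ordered_basis scale n e" "i \<in> {1..n}" "j \<in> {1..n}"
  shows "coord scale n e (e i) j = (if i = j then 1 else 0)"
proof -
  interpret vector_space scale by fact
  show ?thesis
    using assms(2-4) by (auto simp: coord_def ordered_basis_def representation_basis inj_on_eq_iff)
qed

lemma pure_tensor_basis:
  assumes "vector_space scale" "ordered_basis scale n e" "w \<in> words n N"
  shows "pure_tensor scale n e (map e w) = basis_tensor w"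
proof
  fix u
  show "pure_tensor scale n e (map e w) u = basis_tensor w u"
  proof (cases "u \<in> words n N")
    case True
    have "(\<Prod>p<N. coord scale n e (e (w ! p)) (u ! p)) = (\<Prod>p<N. if w ! p = u ! p then 1 else 0)"
    proof (rule prod.cong)
      fix p assume "p \<in> {..<N}"
      then have "w ! p \<in> set w" "u ! p \<in> set u"
        using assms(3) True by (auto simp: words_def)
      then show "coord scale n e (e (w ! p)) (u ! p) = (if w ! p = u ! p then 1 else 0)"
        using assms True by (intro coord_basis) (auto simp: words_def)
    qed simp
    also have "\<dots> = (if u = w then 1 else 0)"
    proof (cases "u = w")
      case False
      then obtain q where "q < N" "w ! q \<noteq> u ! q"
        using assms(3) True by (metis (mono_tags, lifting) words_def mem_Collect_eq nth_equalityI)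
      then show ?thesis using False by (auto intro!: prod_zero)
    qed simp
    finally have "(\<Prod>p<N. coord scale n e (e (w ! p)) (u ! p)) = basis_tensor w u"
      by (simp add: basis_tensor_def)
    moreover have "length w = N" using assms(3) by (simp add: words_def)
    then have "pure_tensor scale n e (map e w) u = (\<Prod>p<N. coord scale n e (e (w ! p)) (u ! p))"
      using True by (auto simp: pure_tensor_def intro!: prod.cong)
    ultimately show ?thesis by simp
  next
    case False
    then show ?thesis
      using assms(3) by (auto simp: pure_tensor_def basis_tensor_def words_def)
  qed
qed

lemma tensor_prod_basis_tensor:
  "length w = N \<Longrightarrow> tensor_prod N (basis_tensor w) (basis_tensor w') = basis_tensor (w @ w')"
  by (auto simp: tensor_prod_def basis_tensor_def fun_eq_iff) (metis append_take_drop_id)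

lemma sum_words_prod:
  fixes f :: "nat \<Rightarrow> nat \<Rightarrow> 'k::field"
  shows "(\<Sum>w\<in>words n N. \<Prod>p<N. f p (w ! p)) = (\<Prod>p<N. \<Sum>i=1..n. f p i)"
proof -
  have "(\<Prod>p<N. \<Sum>i=1..n. f p i) = (\<Sum>h\<in>PiE {..<N} (\<lambda>_. {1..n}). \<Prod>p<N. f p (h p))"
    by (rule prod_sum_PiE) auto
  also have "\<dots> = (\<Sum>w\<in>words n N. \<Prod>p<N. f p (w ! p))"
  proof (rule sum.reindex_bij_witness
          [where i = "\<lambda>w. \<lambda>p\<in>{..<N}. w ! p" and j = "\<lambda>h. map h [0..<N]"])
    show "(\<lambda>p\<in>{..<N}. map h [0..<N] ! p) = h" if "h \<in> PiE {..<N} (\<lambda>_. {1..n})" for h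
      using that by (auto simp: PiE_iff extensional_def fun_eq_iff)
    show "map h [0..<N] \<in> words n N" if "h \<in> PiE {..<N} (\<lambda>_. {1..n})" for h
      using that by (auto simp: PiE_iff words_def)
    show "map (\<lambda>p\<in>{..<N}. w ! p) [0..<N] = w" if "w \<in> words n N" for w
      using that by (auto simp: words_def intro!: nth_equalityI)
    show "(\<lambda>p\<in>{..<N}. w ! p) \<in> PiE {..<N} (\<lambda>_. {1..n})" if "w \<in> words n N" for w
      using that by (auto simp: words_def PiE_iff subset_iff simp del: atLeastAtMost_iff intro: nth_mem)
  qed simp
  finally show ?thesis by simp
qed

lemma coord_linear:
  assumes V: "vector_space scale" "ordered_basis scale n e"
    and g: "Vector_Spaces.linear scale scale g"
  shows "coord scale n e (g v) j = (\<Sum>i=1..n. coord scale n e v i * coord scale n e (g (e i)) j)"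
proof -
  interpret vector_space scale by fact
  interpret g: Vector_Spaces.linear scale scale g by fact
  let ?B = "e ` {1..n}"
  have B: "inj_on e {1..n}" "\<not> dependent ?B" "span ?B = UNIV"
    using V(2) by (auto simp: ordered_basis_def)
  have "v = (\<Sum>b\<in>?B. scale (representation ?B v b) b)"
    using B sum_representation_eq[of ?B v ?B] by auto
  also have "\<dots> = (\<Sum>i=1..n. scale (coord scale n e v i) (e i))"
    using B by (simp add: sum.reindex coord_def)
  finally have "g v = g (\<Sum>i=1..n. scale (coord scale n e v i) (e i))"
    by (rule arg_cong)
  also have "\<dots> = (\<Sum>i=1..n. scale (coord scale n e v i) (g (e i)))"
    by (simp only: g.sum g.scale)
  finally have "g v = (\<Sum>i=1..n. scale (coord scale n e v i) (g (e i)))" .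
  then show ?thesis
    using B by (simp add: coord_def representation_sum representation_scale)
qed

lemma tensor_act_pure_tensor:
  assumes V: "vector_space scale" "ordered_basis scale n e"
    and g: "Vector_Spaces.linear scale scale g"
  shows "tensor_act scale n e (length vs) g (pure_tensor scale n e vs) = pure_tensor scale n e (map g vs)"
proof
  fix u
  let ?N = "length vs" and ?c = "coord scale n e"
  show "tensor_act scale n e ?N g (pure_tensor scale n e vs) u = pure_tensor scale n e (map g vs) u"
  proof (cases "u \<in> words n ?N")
    case True
    have "tensor_act scale n e ?N g (pure_tensor scale n e vs) u
        = (\<Sum>w\<in>words n ?N. \<Prod>p<?N. ?c (vs ! p) (w ! p) * ?c (g (e (w ! p))) (u ! p))"
      unfolding tensor_act_def lin_ext_apply
    proof (rule sum.cong)
      fix w assume "w \<in> words n ?N"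
      then show "pure_tensor scale n e vs w * pure_tensor scale n e (map (\<lambda>i. g (e i)) w) u
          = (\<Prod>p<?N. ?c (vs ! p) (w ! p) * ?c (g (e (w ! p))) (u ! p))"
        using True by (simp add: pure_tensor_def prod.distrib words_def)
    qed simp
    also have "\<dots> = (\<Prod>p<?N. \<Sum>i=1..n. ?c (vs ! p) i * ?c (g (e i)) (u ! p))"
      by (rule sum_words_prod)
    also have "\<dots> = (\<Prod>p<?N. ?c (g (vs ! p)) (u ! p))"
      by (rule prod.cong[OF refl], rule coord_linear[OF V g, symmetric])
    finally show ?thesis using True by (simp add: pure_tensor_def)
  next
    case False
    have "pure_tensor scale n e (map (\<lambda>i. g (e i)) w) u = 0" if "w \<in> words n ?N" for w
    proof -
      have "length w = ?N" using that by (simp add: words_def)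
      then show ?thesis using False by (simp add: pure_tensor_def)
    qed
    then show ?thesis
      using False by (simp add: tensor_act_def lin_ext_apply pure_tensor_def)
  qed
qed

lemma place_word:
  assumes "\<sigma> permutes {1..N}" "u \<in> words n N"
  shows "map (\<lambda>p. u ! (\<sigma> p - 1)) [1..<Suc N] \<in> words n N"
proof -
  have "u ! (\<sigma> p - 1) \<in> {1..n}" if "p \<in> {1..N}" for p
  proof -
    have "\<sigma> p \<in> {1..N}" using that permutes_in_image[OF assms(1)] by blast
    then have "\<sigma> p - 1 < length u" using assms(2) by (auto simp: words_def)
    then have "u ! (\<sigma> p - 1) \<in> set u" by (rule nth_mem)
    then show ?thesis using assms(2) unfolding words_def by blast
  qed
  then show ?thesis by (auto simp: words_def simp del: upt_Suc)
qed

lemma place_word_inverse: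
  assumes "\<sigma> permutes {1..N}" "length u = N"
  shows "map (\<lambda>p. map (\<lambda>p. u ! (\<sigma> p - 1)) [1..<Suc N] ! (inv \<sigma> p - 1)) [1..<Suc N] = u"
    (is "map ?f _ = u")
proof (rule nth_equalityI)
  fix q assume "q < length (map ?f [1..<Suc N])"
  then have q: "q < N" by (simp del: upt_Suc)
  have r: "inv \<sigma> (Suc q) \<in> {1..N}"
    using q permutes_in_image[OF permutes_inv[OF assms(1)], of "Suc q"] by simp
  have "map ?f [1..<Suc N] ! q = ?f (Suc q)"
    using q by (subst nth_map) (simp_all del: upt_Suc)
  also have "\<dots> = u ! (\<sigma> (inv \<sigma> (Suc q)) - 1)"
    using r by (cases "inv \<sigma> (Suc q)") (simp_all del: upt_Suc)
  also have "\<dots> = u ! q"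
    by (simp add: permutes_inverses[OF assms(1)])
  finally show "map ?f [1..<Suc N] ! q = u ! q" .
qed (use assms in \<open>simp del: upt_Suc\<close>)

lemma place_act_apply:
  assumes "\<sigma> permutes {1..N}" "u \<in> words n N"
  shows "place_act n N \<sigma> x u = x (map (\<lambda>p. u ! (\<sigma> p - 1)) [1..<Suc N])"
proof -
  let ?w = "map (\<lambda>p. u ! (\<sigma> p - 1)) [1..<Suc N]"
  have w: "?w \<in> words n N" by (rule place_word[OF assms])
  have eq: "u = map (\<lambda>p. w ! (inv \<sigma> p - 1)) [1..<Suc N] \<longleftrightarrow> w = ?w" if "w \<in> words n N" for w
  proof
    assume "w = ?w"
    then show "u = map (\<lambda>p. w ! (inv \<sigma> p - 1)) [1..<Suc N]"
      using place_word_inverse[OF assms(1), of u] assms(2) by (simp only: words_def mem_Collect_eq)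
  next
    assume u: "u = map (\<lambda>p. w ! (inv \<sigma> p - 1)) [1..<Suc N]"
    show "w = ?w"
      unfolding u using place_word_inverse[OF permutes_inv[OF assms(1)], of w] that
      by (simp only: permutes_inv_inv[OF assms(1)] words_def mem_Collect_eq)
  qed
  have "place_act n N \<sigma> x u = (\<Sum>w\<in>words n N. if w = ?w then x w else 0)"
    unfolding place_act_def lin_ext_apply basis_tensor_def
  proof (rule sum.cong)
    fix w assume "w \<in> words n N"
    then show "x w * (if u = map (\<lambda>p. w ! (inv \<sigma> p - 1)) [1..<Suc N] then 1 else 0)
        = (if w = ?w then x w else 0)"
      by (simp only: eq if_True if_False mult_1_right mult_zero_right split: if_split) simp
  qed simp
  then show ?thesis using w by (simp add: finite_words del: upt_Suc)
qed

lemma place_act_pure_tensor: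
  fixes scale :: "'k::field \<Rightarrow> 'v::ab_group_add \<Rightarrow> 'v"
  assumes "\<sigma> permutes {1..N}" "length vs = N"
  shows "place_act n N \<sigma> (pure_tensor scale n e vs)
    = pure_tensor scale n e (map (\<lambda>p. vs ! (inv \<sigma> p - 1)) [1..<Suc N])"
proof
  fix u
  let ?c = "coord scale n e"
  show "place_act n N \<sigma> (pure_tensor scale n e vs) u
    = pure_tensor scale n e (map (\<lambda>p. vs ! (inv \<sigma> p - 1)) [1..<Suc N]) u"
  proof (cases "u \<in> words n N")
    case True
    have s: "\<sigma> p \<in> {1..N} \<and> inv \<sigma> p \<in> {1..N}" if "p \<in> {1..N}" for p
      using that permutes_in_image[OF assms(1)] permutes_in_image[OF permutes_inv[OF assms(1)]] by blast
    have w: "map (\<lambda>p. u ! (\<sigma> p - 1)) [1..<Suc N] \<in> words n N"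
      by (rule place_word[OF assms(1) True])
    have "place_act n N \<sigma> (pure_tensor scale n e vs) u
        = (\<Prod>p<N. ?c (vs ! p) (u ! (\<sigma> (Suc p) - 1)))"
      using w by (simp add: place_act_apply[OF assms(1) True] pure_tensor_def assms(2) del: upt_Suc)
    also have "\<dots> = (\<Prod>p\<in>{1..N}. ?c (vs ! (p - 1)) (u ! (\<sigma> p - 1)))"
      by (rule prod.reindex_bij_witness[where i = "\<lambda>p. p - 1" and j = Suc]) auto
    also have "\<dots> = (\<Prod>p\<in>{1..N}. ?c (vs ! (inv \<sigma> p - 1)) (u ! (p - 1)))"
      by (rule prod.reindex_bij_witness[where i = "inv \<sigma>" and j = \<sigma>])
         (use s in \<open>simp_all only: permutes_inverses[OF assms(1)]\<close>)
    also have "\<dots> = (\<Prod>p<N. ?c (vs ! (inv \<sigma> (Suc p) - 1)) (u ! p))"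
      by (rule prod.reindex_bij_witness[where j = "\<lambda>p. p - 1" and i = Suc]) auto
    finally show ?thesis
      using True by (simp add: pure_tensor_def del: upt_Suc)
  next
    case False
    have "map (\<lambda>p. w ! (inv \<sigma> p - 1)) [1..<Suc N] \<noteq> u" if "w \<in> words n N" for w
      using place_word[OF permutes_inv[OF assms(1)] that] False by auto
    then have "basis_tensor (map (\<lambda>p. w ! (inv \<sigma> p - 1)) [1..<Suc N]) u = (0::'k)" if "w \<in> words n N" for w
      using that by (auto simp: basis_tensor_def simp del: upt_Suc)
    then have "place_act n N \<sigma> (pure_tensor scale n e vs) u = 0"
      unfolding place_act_def lin_ext_apply by (intro sum.neutral ballI) (simp only: mult_zero_right)
    then show ?thesis
      using False by (simp add: pure_tensor_def del: upt_Suc)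
  qed
qed

section \<open>Subrepresentations of tensor powers\<close>

definition GL :: "('k::field \<Rightarrow> 'v::ab_group_add \<Rightarrow> 'v) \<Rightarrow> ('v \<Rightarrow> 'v) set" where
  "GL scale = {g. Vector_Spaces.linear scale scale g \<and> bij g}"

definition unipotent_group ::
  "('k::field \<Rightarrow> 'v::ab_group_add \<Rightarrow> 'v) \<Rightarrow> nat \<Rightarrow> (nat \<Rightarrow> 'v) \<Rightarrow> ('v \<Rightarrow> 'v) set" where
  "unipotent_group scale n e =
     {g. Vector_Spaces.linear scale scale g \<and>
         (\<forall>i\<in>{1..n}. g (e i) - e i \<in> module.span scale (e ` {1..<i}))}"

definition GL_submodule ::
  "('k::field \<Rightarrow> 'v::ab_group_add \<Rightarrow> 'v) \<Rightarrow> nat \<Rightarrow> (nat \<Rightarrow> 'v) \<Rightarrow> nat \<Rightarrow> 'k tensor set \<Rightarrow> bool" where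
  "GL_submodule scale n e N W \<longleftrightarrow>
     W \<subseteq> tensor_power n N \<and> module.subspace tscale W \<and>
     (\<forall>g\<in>GL scale. \<forall>x\<in>W. tensor_act scale n e N g x \<in> W)"

definition GL_irreducible ::
  "('k::field \<Rightarrow> 'v::ab_group_add \<Rightarrow> 'v) \<Rightarrow> nat \<Rightarrow> (nat \<Rightarrow> 'v) \<Rightarrow> nat \<Rightarrow> 'k tensor set \<Rightarrow> bool" where
  "GL_irreducible scale n e N W \<longleftrightarrow>
     GL_submodule scale n e N W \<and> W \<noteq> {0} \<and>
     (\<forall>W'. GL_submodule scale n e N W' \<and> W' \<subseteq> W \<longrightarrow> W' = {0} \<or> W' = W)"

definition GL_isomorphic ::
  "('k::field \<Rightarrow> 'v::ab_group_add \<Rightarrow> 'v) \<Rightarrow> nat \<Rightarrow> (nat \<Rightarrow> 'v) \<Rightarrow> nat \<Rightarrow>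
   'k tensor set \<Rightarrow> 'k tensor set \<Rightarrow> bool" where
  "GL_isomorphic scale n e N W W' \<longleftrightarrow>
     (\<exists>\<phi>. bij_betw \<phi> W W' \<and>
        (\<forall>x\<in>W. \<forall>y\<in>W. \<phi> (x + y) = \<phi> x + \<phi> y) \<and>
        (\<forall>c. \<forall>x\<in>W. \<phi> (tscale c x) = tscale c (\<phi> x)) \<and>
        (\<forall>g\<in>GL scale. \<forall>x\<in>W. \<phi> (tensor_act scale n e N g x) = tensor_act scale n e N g (\<phi> x)))"

text \<open>\<open>M\<close> is the internal direct sum of the finitely many irreducible submodules in \<open>\<D>\<close>.\<close>

definition irreducible_decomposition ::
  "('k::field \<Rightarrow> 'v::ab_group_add \<Rightarrow> 'v) \<Rightarrow> nat \<Rightarrow> (nat \<Rightarrow> 'v) \<Rightarrow> nat \<Rightarrow>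
   'k tensor set \<Rightarrow> 'k tensor set set \<Rightarrow> bool" where
  "irreducible_decomposition scale n e N M \<D> \<longleftrightarrow>
     finite \<D> \<and> (\<forall>W\<in>\<D>. GL_irreducible scale n e N W) \<and>
     M = module.span tscale (\<Union>\<D>) \<and>
     (\<forall>f. (\<forall>W\<in>\<D>. f W \<in> W) \<and> (\<Sum>W\<in>\<D>. f W) = 0 \<longrightarrow> (\<forall>W\<in>\<D>. f W = 0))"

definition highest_weight_vector ::
  "('k::field \<Rightarrow> 'v::ab_group_add \<Rightarrow> 'v) \<Rightarrow> nat \<Rightarrow> (nat \<Rightarrow> 'v) \<Rightarrow> nat \<Rightarrow>
   'k tensor set \<Rightarrow> 'k tensor \<Rightarrow> bool" where
  "highest_weight_vector scale n e N W x \<longleftrightarrow>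
     x \<in> W \<and> x \<noteq> 0 \<and> (\<forall>u\<in>unipotent_group scale n e. tensor_act scale n e N u x = x)"

section \<open>Diagrams, tableaux and Young symmetrizers\<close>

definition is_partition :: "nat list \<Rightarrow> nat \<Rightarrow> bool" where
  "is_partition la N \<longleftrightarrow> sorted_wrt (\<ge>) la \<and> (\<forall>r\<in>set la. 0 < r) \<and> sum_list la = N"

definition part :: "nat list \<Rightarrow> nat \<Rightarrow> nat" where
  "part la i = (if 1 \<le> i \<and> i \<le> length la then la ! (i - 1) else 0)"

definition diagram :: "nat list \<Rightarrow> (nat \<times> nat) set" where
  "diagram la = {(i, j). 1 \<le> i \<and> i \<le> length la \<and> 1 \<le> j \<and> j \<le> part la i}"

definition is_tableau :: "nat list \<Rightarrow> nat \<Rightarrow> (nat \<times> nat \<Rightarrow> nat) \<Rightarrow> bool" where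
  "is_tableau la r T \<longleftrightarrow> T ` diagram la \<subseteq> {1..r}"

definition content :: "nat list \<Rightarrow> (nat \<times> nat \<Rightarrow> nat) \<Rightarrow> nat \<Rightarrow> nat" where
  "content la T c = card {b \<in> diagram la. T b = c}"

definition column_group :: "nat list \<Rightarrow> nat \<Rightarrow> (nat \<times> nat \<Rightarrow> nat) \<Rightarrow> (nat \<Rightarrow> nat) set" where
  "column_group la N L =
     {\<sigma>. \<sigma> permutes {1..N} \<and>
         (\<forall>j. \<sigma> ` {L (i, j) | i. (i, j) \<in> diagram la} = {L (i, j) | i. (i, j) \<in> diagram la})}"

definition row_group :: "nat list \<Rightarrow> nat \<Rightarrow> (nat \<times> nat \<Rightarrow> nat) \<Rightarrow> (nat \<Rightarrow> nat) set" where
  "row_group la N L =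
     {\<tau>. \<tau> permutes {1..N} \<and>
         (\<forall>i. \<tau> ` {L (i, j) | j. (i, j) \<in> diagram la} = {L (i, j) | j. (i, j) \<in> diagram la})}"

definition young_symmetrizer ::
  "nat \<Rightarrow> nat list \<Rightarrow> nat \<Rightarrow> (nat \<times> nat \<Rightarrow> nat) \<Rightarrow> 'k::field tensor \<Rightarrow> 'k tensor" where
  "young_symmetrizer n la N L x =
     (\<Sum>\<sigma>\<in>column_group la N L. \<Sum>\<tau>\<in>row_group la N L.
        tscale (of_int (sign \<tau>)) (place_act n N \<sigma> (place_act n N \<tau> x)))"

lemma content_1_iff_bij_betw:
  assumes "is_tableau la N L"
  shows "(\<forall>c\<in>{1..N}. content la L c = 1) \<longleftrightarrow> bij_betw L (diagram la) {1..N}"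
proof
  assume *: "\<forall>c\<in>{1..N}. content la L c = 1"
  have "\<exists>!b. b \<in> diagram la \<and> L b = c" if "c \<in> {1..N}" for c
  proof -
    obtain b where "{b \<in> diagram la. L b = c} = {b}"
      using * \<open>c \<in> {1..N}\<close> by (metis content_def card_1_singletonE)
    then have "b' \<in> diagram la \<and> L b' = c \<longleftrightarrow> b' = b" for b' by blast
    then show ?thesis by simp
  qed
  then show "bij_betw L (diagram la) {1..N}"
    using assms unfolding is_tableau_def bij_betw_def inj_on_def by blast
next
  assume *: "bij_betw L (diagram la) {1..N}"
  show "\<forall>c\<in>{1..N}. content la L c = 1"
  proof
    fix c assume "c \<in> {1..N}"
    then have "c \<in> L ` diagram la" using * by (simp add: bij_betw_def)
    then obtain b where "b \<in> diagram la" "L b = c" by blast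
    then have "{b \<in> diagram la. L b = c} = {b}" using * by (auto simp: bij_betw_def inj_on_def)
    then show "content la L c = 1" by (simp add: content_def)
  qed
qed

text \<open>The pure tensor with \<open>e (G (i, j))\<close> in tensor position \<open>L (i, j)\<close>.\<close>

definition tableau_tensor ::
  "nat list \<Rightarrow> nat \<Rightarrow> (nat \<times> nat \<Rightarrow> nat) \<Rightarrow> (nat \<times> nat \<Rightarrow> nat) \<Rightarrow> 'k::field tensor" where
  "tableau_tensor la N L G =
     basis_tensor (map (\<lambda>p. G (inv_into (diagram la) L p)) [1..<Suc N])"

text \<open>
  The Schur module of \<open>\<gamma>\<close>, as the image of the Young symmetrizer of the tableau that numbers
  the boxes row by row.  Since rows are antisymmetrised first and columns are
  symmetrised afterwards, this is the image of the composite map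
  \<open>\<Lambda>\<^bsup>\<gamma>\<^sub>1\<^esup> V \<otimes> \<dots> \<otimes> \<Lambda>\<^bsup>\<gamma>\<^sub>h\<^esup> V \<rightarrow> V \<otimes> \<dots> \<otimes> V \<rightarrow> Sym\<^bsup>\<gamma>'\<^sub>1\<^esup> V \<otimes> Sym\<^bsup>\<gamma>'\<^sub>2\<^esup> V \<otimes> \<dots>\<close>
  (\<open>\<gamma>'\<close> the transpose), with exterior and symmetric powers embedded in tensor powers; in
  particular one row gives exterior and one column gives symmetric powers.
\<close>

definition row_tableau :: "nat list \<Rightarrow> nat \<times> nat \<Rightarrow> nat" where
  "row_tableau la = (\<lambda>(i, j). (\<Sum>r=1..<i. part la r) + j)"

definition schur_module :: "nat \<Rightarrow> nat list \<Rightarrow> 'k::field tensor set" where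
  "schur_module n ga =
     young_symmetrizer n ga (sum_list ga) (row_tableau ga) ` tensor_power n (sum_list ga)"

section \<open>The vectors \<open>g\<^bsub>\<lambda>\<leadsto>\<gamma>\<^esub>\<close>\<close>

text \<open>
  The boxes added to the diagram are \<open>(i r, j r a)\<close> with \<open>1 \<le> r \<le> p\<close> and \<open>1 \<le> a \<le> s r\<close>.
\<close>

definition shift_tableau ::
  "nat \<Rightarrow> (nat \<Rightarrow> nat) \<Rightarrow> (nat \<Rightarrow> nat) \<Rightarrow> (nat \<Rightarrow> nat \<Rightarrow> nat) \<Rightarrow> (nat \<Rightarrow> nat) \<Rightarrow> nat \<times> nat \<Rightarrow> nat" where
  "shift_tableau p i s j \<pi> =
     (\<lambda>(i', j').
        if \<exists>l\<in>{1..p}. i' = i l \<and> j' > (if l = p then 0 else j (l + 1) (s (l + 1)))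
        then \<pi> j' else j')"

text \<open>The columns of the added boxes, rows from bottom to top, each row from left to right.\<close>

definition added_columns :: "nat \<Rightarrow> (nat \<Rightarrow> nat) \<Rightarrow> (nat \<Rightarrow> nat \<Rightarrow> nat) \<Rightarrow> nat list" where
  "added_columns p s j = concat (map (\<lambda>r. map (j r) [1..<Suc (s r)]) (rev [1..<Suc p]))"

definition g_vector ::
  "nat \<Rightarrow> nat list \<Rightarrow> nat \<Rightarrow> (nat \<times> nat \<Rightarrow> nat) \<Rightarrow> nat list \<Rightarrow>
   nat \<Rightarrow> (nat \<Rightarrow> nat) \<Rightarrow> (nat \<Rightarrow> nat) \<Rightarrow> (nat \<Rightarrow> nat \<Rightarrow> nat) \<Rightarrow> 'k::field tensor" where
  "g_vector n la N L ga p i s j =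
     (\<Sum>\<pi> | \<pi> permutes {1..part ga (i 1)}.
        tscale (of_int (sign \<pi>))
          (tensor_prod N
             (young_symmetrizer n la N L (tableau_tensor la N L (shift_tableau p i s j \<pi>)))
             (basis_tensor (map \<pi> (added_columns p s j)))))"

end

theory Submission
  imports Defs "HOL-Computational_Algebra.Polynomial"
begin

text \<open>
  Let \<open>G\<close> be the symmetric group on the \<open>N + t\<close> tensor positions.  The \<open>G\<close>-equivariant
  endomorphisms of the tensor power are spanned by the image of \<open>GL(V)\<close> (by Kronecker
  substitution), so \<open>GL(V)\<close>-submodules are the subspaces stable under all of them.
  By Maschke's theorem a vector whose \<open>G\<close>-orbit spans an irreducible \<open>G\<close>-module generates an
  irreducible \<open>GL(V)\<close>-module; this makes the image of every element of the group algebra of \<open>G\<close>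
  completely reducible.

  Let \<open>v\<close> be the tensor product of the wedges \<open>e 1 \<and> \<dots> \<and> e \<gamma>\<^sub>i\<close> over the rows of \<open>\<gamma>\<close>, and let \<open>h\<close> be
  its symmetrization along the columns.  Von Neumann's property of \<open>a b\<close> (\<open>b\<close> the row
  antisymmetrizer, \<open>a\<close> the column symmetrizer) shows that the Schur module is irreducible, and James'
  submodule argument recovers \<open>v\<close> from \<open>h\<close> by an element of the group algebra.  The vector \<open>v\<close> is
  unipotent-invariant by a triangularity argument.

  The boxes whose entries are permuted by \<open>\<pi>\<close> meet each of the columns \<open>1, \<dots>, \<gamma>\<^sub>i\<^sub>1\<close> exactly once.
  Regarding them as one row and the rest of row \<open>i\<^sub>l\<close> as row \<open>i\<^sub>l\<^sub>+\<^sub>1\<close> rearranges \<open>\<gamma>\<close> inside its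
  columns, so up to a nonzero factor the vector of the theorem is a group algebra element applied to
  \<open>v\<close>, hence to \<open>h\<close>.  It is nonzero by its coefficient at the word of column indices, and the group
  algebra element, commuting with \<open>GL(V)\<close>, embeds the Schur module.
\<close>

text \<open>Recovering \<open>v\<close> from \<open>h\<close> is needed because \<open>v\<close> in
  general lies outside the Schur module. The vector of the theorem is a group algebra element
  applied to \<open>v\<close>; only an element that starts from \<open>h\<close> carries the whole
  Schur module onto a submodule containing that vector. By Schur's lemma such an element is
  injective there as soon as its value at \<open>h\<close> is nonzero, so the only quantitative
  check is nonvanishing.

  The alternating sum over \<pi> ranges over boxes spread across several rows, so it is not a row
  antisymmetrizer of \<gamma>. After the rearrangement of \<gamma> it is one for a single row, and
  the row antisymmetrizer of \<Lambda> supplies the permutations of the other rows.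

  Averaging is available only over the finite group. Irreducibility is therefore phrased with maps:
  every nonzero vector reaches every other one by an equivariant map. This form passes directly to
  images.

  Characteristic 0 enters in three ways: averages divide by a factorial, polynomial arguments need
  infinitely many scalars, and coefficients that count permutations must not vanish.\<close>

hide_const (open) Polynomial.content

section \<open>Linear endomorphisms of a vector space\<close>

context vector_space
begin

lemma linear_add: "Vector_Spaces.linear scale scale f \<Longrightarrow> f (x + y) = f x + f y"
  by (simp add: Vector_Spaces.linear_iff)

lemma linear_scale: "Vector_Spaces.linear scale scale f \<Longrightarrow> f (scale c x) = scale c (f x)"
  by (simp add: Vector_Spaces.linear_iff)

lemma linear_zero: "Vector_Spaces.linear scale scale f \<Longrightarrow> f 0 = 0"
  using linear_add[of f 0 0] by simp

lemma linear_diff: "Vector_Spaces.linear scale scale f \<Longrightarrow> f (x - y) = f x - f y"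
  using linear_add[of f "x - y" y] by (simp add: algebra_simps)

lemma linear_sum: "Vector_Spaces.linear scale scale f \<Longrightarrow> f (sum g A) = (\<Sum>a\<in>A. f (g a))"
  by (induction A rule: infinite_finite_induct) (simp_all add: linear_add linear_zero)

lemma linearI:
  assumes "\<And>x y. f (x + y) = f x + f y" "\<And>c x. f (scale c x) = scale c (f x)"
  shows "Vector_Spaces.linear scale scale f"
  using assms vector_space_axioms by (simp add: Vector_Spaces.linear_iff)

lemma linear_vector_space: "Vector_Spaces.linear scale scale (\<lambda>x. x)"
  by (rule linearI) auto

lemma linear_span_image:
  assumes f: "Vector_Spaces.linear scale scale f" and "subspace U" "f ` S \<subseteq> U" "x \<in> span S"
  shows "f x \<in> U"
proof -
  have "span S \<subseteq> {x. f x \<in> U}"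
    by (rule span_minimal)
      (use assms in \<open>auto simp: subspace_def linear_add linear_scale linear_zero\<close>)
  then show ?thesis using assms by blast
qed

lemma subspace_linear_image:
  assumes f: "Vector_Spaces.linear scale scale f" and U: "subspace U"
  shows "subspace (f ` U)"
  unfolding subspace_def
proof (intro conjI ballI allI)
  show "0 \<in> f ` U" using U f by (metis imageI linear_zero subspace_0)
  show "x + y \<in> f ` U" if "x \<in> f ` U" "y \<in> f ` U" for x y
    using that U by (auto simp: linear_add[OF f, symmetric] subspace_add)
  show "scale c x \<in> f ` U" if "x \<in> f ` U" for c x
    using that U by (auto simp: linear_scale[OF f, symmetric] subspace_scale)
qed

text \<open>A basis of \<open>U\<close> extends to one of \<open>V\<close>. The finite set
  \<open>B\<close> is explicit because the type of all tensors is infinite-dimensional.\<close>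

lemma dim_psubset_finite:
  assumes "finite B" "V \<subseteq> span B" "subspace U" "U \<subset> V"
  shows "dim U < dim V"
proof -
  obtain C where C: "C \<subseteq> U" "independent C" "U \<subseteq> span C" "card C = dim U"
    by (rule basis_exists)
  obtain D where D: "C \<subseteq> D" "D \<subseteq> V" "independent D" "V \<subseteq> span D"
    using C assms by (metis maximal_independent_subset_extend psubset_imp_subset subset_trans)
  have "finite D" using independent_span_bound[OF assms(1) D(3)] D(2) assms(2) by blast
  have "C \<noteq> D"
    using C D assms by (metis psubset_eq span_minimal subset_trans subset_antisym)
  then have "card C < card D" using \<open>finite D\<close> D by (meson psubsetI psubset_card_mono)
  then show ?thesis using C basis_card_eq_dim[OF D(2,4,3)] by simp
qed

end

section \<open>Linear representations of a symmetric group\<close>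

text \<open>The action laws are asked on \<open>T\<close> only: \<open>place_act\<close> sets every
  coordinate outside the words of the given length to zero, so on the whole type even the identity
  permutation acts as a projection. \<open>B\<close> bounds dimensions.\<close>

locale symmetric_rep = vector_space scale
  for scale :: "'k::field_char_0 \<Rightarrow> 'a::ab_group_add \<Rightarrow> 'a" (infixr \<open>*s\<close> 75) +
  fixes T :: "'a set" and B :: "'a set" and X :: "'b set" and act :: "('b \<Rightarrow> 'b) \<Rightarrow> 'a \<Rightarrow> 'a"
  assumes subspace_T: "subspace T"
    and finite_B: "finite B" and T_span: "T \<subseteq> span B"
    and finite_X: "finite X"
    and act_linear: "g permutes X \<Longrightarrow> Vector_Spaces.linear scale scale (act g)"
    and act_into: "g permutes X \<Longrightarrow> x \<in> T \<Longrightarrow> act g x \<in> T"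
    and act_id: "x \<in> T \<Longrightarrow> act id x = x"
    and act_comp: "g permutes X \<Longrightarrow> \<tau> permutes X \<Longrightarrow> x \<in> T \<Longrightarrow> act (g \<circ> \<tau>) x = act g (act \<tau> x)"
begin

definition equivariant :: "('a \<Rightarrow> 'a) \<Rightarrow> bool" where
  "equivariant f \<longleftrightarrow> Vector_Spaces.linear scale scale f \<and> f ` T \<subseteq> T \<and>
     (\<forall>g x. g permutes X \<longrightarrow> x \<in> T \<longrightarrow> f (act g x) = act g (f x))"

definition invariant :: "'a set \<Rightarrow> bool" where
  "invariant U \<longleftrightarrow> subspace U \<and> U \<subseteq> T \<and> (\<forall>g x. g permutes X \<longrightarrow> x \<in> U \<longrightarrow> act g x \<in> U)"

definition stable :: "'a set \<Rightarrow> bool" where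
  "stable W \<longleftrightarrow> subspace W \<and> W \<subseteq> T \<and> (\<forall>f x. equivariant f \<longrightarrow> x \<in> W \<longrightarrow> f x \<in> W)"

text \<open>Irreducibility over the commutant of the group, in cyclic form: every nonzero vector
  generates all of \<open>W\<close>.\<close>

definition simple :: "'a set \<Rightarrow> bool" where
  "simple W \<longleftrightarrow> stable W \<and> W \<noteq> {0} \<and>
     (\<forall>x\<in>W. \<forall>y\<in>W. x \<noteq> 0 \<longrightarrow> (\<exists>f. equivariant f \<and> f x = y))"

inductive_set galg :: "('a \<Rightarrow> 'a) set" where
  act: "g permutes X \<Longrightarrow> act g \<in> galg"
| zero: "(\<lambda>x. 0) \<in> galg"
| add: "r \<in> galg \<Longrightarrow> s \<in> galg \<Longrightarrow> (\<lambda>x. r x + s x) \<in> galg"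
| scale: "r \<in> galg \<Longrightarrow> (\<lambda>x. c *s r x) \<in> galg"

section \<open>Equivariant maps and the group algebra\<close>

lemma equivariantD:
  assumes "equivariant f"
  shows "Vector_Spaces.linear scale scale f" "x \<in> T \<Longrightarrow> f x \<in> T"
    "g permutes X \<Longrightarrow> x \<in> T \<Longrightarrow> f (act g x) = act g (f x)"
  using assms by (auto simp: equivariant_def)

lemma simpleD:
  "simple W \<Longrightarrow> x \<in> W \<Longrightarrow> y \<in> W \<Longrightarrow> x \<noteq> 0 \<Longrightarrow> \<exists>f. equivariant f \<and> f x = y"
  by (simp add: simple_def)

lemma equivariant_zero: "equivariant (\<lambda>x. 0)"
  using subspace_T by (auto simp: equivariant_def subspace_0 act_linear linear_zero intro!: linearI)

lemma equivariant_id: "equivariant (\<lambda>x. x)"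
  by (auto simp: equivariant_def intro!: linearI)

lemma equivariant_add: "equivariant f \<Longrightarrow> equivariant g \<Longrightarrow> equivariant (\<lambda>x. f x + g x)"
  using subspace_T
  by (auto simp: equivariant_def linear_add act_linear linear_scale image_subset_iff scale_right_distrib
      subspace_add intro!: linearI)

lemma equivariant_scale: "equivariant f \<Longrightarrow> equivariant (\<lambda>x. c *s f x)"
  using subspace_T
  by (auto simp: equivariant_def linear_add act_linear linear_scale image_subset_iff scale_right_distrib
      subspace_scale scale_left_commute intro!: linearI)

lemma equivariant_comp: "equivariant f \<Longrightarrow> equivariant g \<Longrightarrow> equivariant (\<lambda>x. f (g x))"
  by (auto simp: equivariant_def linear_add linear_scale image_subset_iff intro!: linearI)

lemma galg_linear: "r \<in> galg \<Longrightarrow> Vector_Spaces.linear scale scale r"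
  by (induction rule: galg.induct)
    (auto simp: act_linear linear_add linear_scale scale_right_distrib scale_left_commute
      intro!: linearI)

lemma galg_invariant:
  "r \<in> galg \<Longrightarrow> invariant U \<Longrightarrow> x \<in> U \<Longrightarrow> r x \<in> U"
  by (induction rule: galg.induct)
    (auto simp: invariant_def subspace_0 subspace_add subspace_scale)

lemma invariant_T: "invariant T"
  by (simp add: invariant_def subspace_T act_into)

lemma galg_into: "r \<in> galg \<Longrightarrow> x \<in> T \<Longrightarrow> r x \<in> T"
  using galg_invariant[OF _ invariant_T] .

lemma galg_equivariant:
  "r \<in> galg \<Longrightarrow> equivariant f \<Longrightarrow> x \<in> T \<Longrightarrow> f (r x) = r (f x)"
  by (induction rule: galg.induct)
    (auto simp: equivariant_def linear_zero linear_add linear_scale)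

lemma galg_sum:
  "(\<And>a. a \<in> A \<Longrightarrow> r a \<in> galg) \<Longrightarrow> (\<lambda>x. \<Sum>a\<in>A. r a x) \<in> galg"
  by (induction A rule: infinite_finite_induct) (auto intro: galg.intros)

text \<open>Composites agree with elements of the group algebra only on \<open>T\<close>, where \<open>act\<close> is an action.\<close>

lemma galg_act_comp:
  "s \<in> galg \<Longrightarrow> g permutes X \<Longrightarrow> \<exists>t\<in>galg. \<forall>x\<in>T. act g (s x) = t x"
proof (induction rule: galg.induct)
  case (act \<tau>)
  then show ?case
    by (intro bexI[of _ "act (g \<circ> \<tau>)"]) (auto simp: act_comp permutes_compose intro: galg.act)
next
  case zero
  then show ?case by (auto simp: act_linear linear_zero intro: galg.zero)
next
  case (add r s)
  then obtain t u where "t \<in> galg" "u \<in> galg"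
    "\<forall>x\<in>T. act g (r x) = t x" "\<forall>x\<in>T. act g (s x) = u x" by blast
  then show ?case using add.prems
    by (intro bexI[of _ "\<lambda>x. t x + u x"]) (auto simp: act_linear linear_add intro: galg.add)
next
  case (scale r c)
  then obtain t where "t \<in> galg" "\<forall>x\<in>T. act g (r x) = t x" by blast
  then show ?case using scale.prems
    by (intro bexI[of _ "\<lambda>x. c *s t x"]) (auto simp: act_linear linear_scale intro: galg.scale)
qed

lemma galg_comp:
  "r \<in> galg \<Longrightarrow> s \<in> galg \<Longrightarrow> \<exists>t\<in>galg. \<forall>x\<in>T. r (s x) = t x"
proof (induction rule: galg.induct)
  case (act g)
  then show ?case by (rule galg_act_comp[rotated])
next
  case zero
  then show ?case by (auto intro: galg.zero)
next
  case (add r r')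
  then obtain t u where "t \<in> galg" "u \<in> galg"
    "\<forall>x\<in>T. r (s x) = t x" "\<forall>x\<in>T. r' (s x) = u x" by blast
  then show ?case by (intro bexI[of _ "\<lambda>x. t x + u x"]) (auto intro: galg.add)
next
  case (scale r c)
  then obtain t where "t \<in> galg" "\<forall>x\<in>T. r (s x) = t x" by blast
  then show ?case by (intro bexI[of _ "\<lambda>x. c *s t x"]) (auto intro: galg.scale)
qed

definition orbit_space :: "'a \<Rightarrow> 'a set" where
  "orbit_space x = {r x | r. r \<in> galg}"

lemma orbit_spaceI: "r \<in> galg \<Longrightarrow> r x \<in> orbit_space x"
  by (auto simp: orbit_space_def)

lemma mem_orbit_space: "x \<in> T \<Longrightarrow> x \<in> orbit_space x"
  using orbit_spaceI[OF galg.act[OF permutes_id], of x] by (simp add: act_id)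

lemma invariant_orbit_space:
  assumes "x \<in> T"
  shows "invariant (orbit_space x)"
  unfolding invariant_def subspace_def
proof (intro conjI ballI allI impI)
  show "0 \<in> orbit_space x" using orbit_spaceI[OF galg.zero, of x] by simp
  show "y + z \<in> orbit_space x" if "y \<in> orbit_space x" "z \<in> orbit_space x" for y z
    using that galg.add by (fastforce simp: orbit_space_def)
  show "c *s y \<in> orbit_space x" if "y \<in> orbit_space x" for c y
    using that galg.scale by (fastforce simp: orbit_space_def)
  show "orbit_space x \<subseteq> T" using assms by (auto simp: orbit_space_def galg_into)
  show "act g y \<in> orbit_space x" if "g permutes X" "y \<in> orbit_space x" for g y
    using that galg_act_comp assms by (fastforce simp: orbit_space_def)
qed

section \<open>Averaging and Maschke's theorem\<close>

lemma act_inv: "g permutes X \<Longrightarrow> x \<in> T \<Longrightarrow> act (inv g) (act g x) = x"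
  using act_comp[of "inv g" g x] by (simp add: permutes_inv permutes_inv_o act_id)

definition average :: "('a \<Rightarrow> 'a) \<Rightarrow> 'a \<Rightarrow> 'a" where
  "average f x = inverse (of_nat (fact (card X))) *s (\<Sum>g | g permutes X. act (inv g) (f (act g x)))"

text \<open>Averaging changes nothing at a vector where the map already behaves equivariantly; this
  is how prescribed values survive it.\<close>

lemma average_const:
  assumes "\<And>g. g permutes X \<Longrightarrow> act (inv g) (f (act g x)) = y"
  shows "average f x = y"
proof -
  have "(\<Sum>g | g permutes X. act (inv g) (f (act g x))) = (\<Sum>g | g permutes X. y)"
    by (rule sum.cong) (auto simp: assms)
  also have "\<dots> = of_nat (fact (card X)) *s y"
    by (simp add: sum_constant_scale card_permutations[OF refl finite_X])
  finally show ?thesis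
    unfolding average_def by simp
qed

lemma equivariant_average:
  assumes f: "Vector_Spaces.linear scale scale f" "f ` T \<subseteq> T"
  shows "equivariant (average f)"
  unfolding equivariant_def
proof (intro conjI allI impI subsetI)
  note lin = linear_add[OF act_linear] linear_scale[OF act_linear] linear_add[OF f(1)] linear_scale[OF f(1)]
  show "Vector_Spaces.linear scale scale (average f)"
    by (rule linearI)
      (auto simp: average_def lin permutes_inv sum.distrib scale_right_distrib scale_sum_right
        scale_left_commute intro!: sum.cong)
  show "y \<in> T" if "y \<in> average f ` T" for y
    using that f(2) subspace_T
    by (auto simp: average_def image_subset_iff permutes_inv act_into intro!: subspace_scale subspace_sum)
  fix \<tau> x assume \<tau>: "\<tau> permutes X" and x: "x \<in> T"
  have f_into: "f y \<in> T" if "y \<in> T" for y using f(2) that by blast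
  have "(\<Sum>g | g permutes X. act (inv g) (f (act g (act \<tau> x))))
      = (\<Sum>g | g permutes X. act \<tau> (act (inv (g \<circ> \<tau>)) (f (act (g \<circ> \<tau>) x))))"
  proof (rule sum.cong)
    fix g assume "g \<in> {g. g permutes X}"
    then have g: "g permutes X" by simp
    have "inv g = \<tau> \<circ> inv (g \<circ> \<tau>)"
      using g \<tau> by (simp add: o_inv_distrib permutes_bij permutes_inv_o o_assoc)
    then show "act (inv g) (f (act g (act \<tau> x))) = act \<tau> (act (inv (g \<circ> \<tau>)) (f (act (g \<circ> \<tau>) x)))"
      using g \<tau> x by (simp add: act_comp[symmetric] f_into act_into permutes_compose permutes_inv)
  qed simp
  also have "\<dots> = (\<Sum>g | g permutes X. act \<tau> (act (inv g) (f (act g x))))"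
    using sum_permutations_compose_right[OF \<tau>, of "\<lambda>g. act \<tau> (act (inv g) (f (act g x)))"] by simp
  finally show "average f (act \<tau> x) = act \<tau> (average f x)"
    by (simp add: average_def linear_scale[OF act_linear[OF \<tau>]] linear_sum[OF act_linear[OF \<tau>]])
qed

lemma maschke:
  assumes U: "invariant U"
  obtains q where "equivariant q" "\<And>x. x \<in> T \<Longrightarrow> q x \<in> U" "\<And>x. x \<in> U \<Longrightarrow> q x = x"
proof -
  interpret vector_space_pair scale scale by unfold_locales
  have U': "subspace U" "U \<subseteq> T" "\<And>g x. g permutes X \<Longrightarrow> x \<in> U \<Longrightarrow> act g x \<in> U"
    using U by (auto simp: invariant_def)
  obtain p where p: "p ` UNIV \<subseteq> U" "Vector_Spaces.linear scale scale p" "\<forall>v\<in>U. p v = v"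
    using linear_exists_left_inverse_on[OF linear_vector_space U'(1)] by auto
  show thesis
  proof (rule that)
    show "equivariant (average p)"
      using p U' by (intro equivariant_average) auto
    show "average p x \<in> U" if "x \<in> T" for x
      unfolding average_def using p(1) that
      by (intro subspace_scale[OF U'(1)] subspace_sum[OF U'(1)] U'(3)) (auto simp: permutes_inv)
    show "average p x = x" if "x \<in> U" for x
      using p U' that by (intro average_const) (auto simp: act_inv)
  qed
qed

text \<open>Sending each \<open>act g x\<close> to \<open>act g y\<close> is well defined on the
  span of the orbit because every linear relation among the translates of \<open>x\<close> holds for
  those of \<open>y\<close>. A linear extension, projected to \<open>T\<close> and averaged, is the
  required map. Inclusions of annihilators in the group algebra become equivariant maps in this way
  throughout.\<close>

lemma equivariant_extend:
  assumes x: "x \<in> T" and y: "y \<in> T"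
    and *: "\<And>r. r \<in> galg \<Longrightarrow> r x = 0 \<Longrightarrow> r y = 0"
  obtains f where "equivariant f" "f x = y"
proof -
  interpret vector_space_pair scale scale by unfold_locales
  let ?O = "(\<lambda>g. act g x) ` {g. g permutes X}"
  obtain C where C: "C \<subseteq> ?O" "independent C" "?O \<subseteq> span C" by (rule maximal_independent_subset)
  have "\<forall>b\<in>C. \<exists>g. g permutes X \<and> act g x = b" using C(1) by auto
  then obtain k where k: "\<And>b. b \<in> C \<Longrightarrow> k b permutes X \<and> act (k b) x = b" by metis
  obtain h where h: "Vector_Spaces.linear scale scale h" "\<forall>b\<in>C. h b = act (k b) y"
    using linear_independent_extend[OF C(2), of "\<lambda>b. act (k b) y"] by blast
  have "finite ?O" by (simp add: finite_permutations finite_X)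
  then have "finite C" using C(1) finite_subset by blast
  have hact: "h (act g x) = act g y" if g: "g permutes X" for g
  proof -
    have "act g x \<in> span C" using C(3) g by blast
    then obtain u where u: "act g x = (\<Sum>b\<in>C. u b *s b)"
      using span_finite[OF \<open>finite C\<close>] by auto
    \<comment> \<open>The expansion of \<open>act g x\<close> in the basis \<open>C\<close> of orbit
      vectors, read as a group algebra element that annihilates \<open>x\<close>.\<close>
    have "(\<lambda>z. act g z + (-1) *s (\<Sum>b\<in>C. u b *s act (k b) z)) \<in> galg" (is "?r \<in> _")
      using g k by (intro galg.intros galg_sum) auto
    moreover have "?r x = 0" using u k by (simp cong: sum.cong)
    ultimately have "?r y = 0" by (rule *)
    then have "act g y = (\<Sum>b\<in>C. u b *s act (k b) y)" by simp
    then show ?thesis using h k by (simp add: u linear_sum linear_scale cong: sum.cong)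
  qed
  obtain p where p: "p ` UNIV \<subseteq> T" "Vector_Spaces.linear scale scale p" "\<forall>v\<in>T. p v = v"
    using linear_exists_left_inverse_on[OF linear_vector_space subspace_T] by auto
  let ?h = "\<lambda>z. p (h z)"
  have "equivariant (average ?h)"
    using p h by (intro equivariant_average linearI) (auto simp: linear_add linear_scale)
  moreover have "average ?h x = y"
    using p y by (intro average_const) (auto simp: hact act_inv act_into)
  ultimately show thesis by (rule that)
qed

section \<open>Irreducible invariant subspaces\<close>

definition irreducible :: "'a set \<Rightarrow> bool" where
  "irreducible U \<longleftrightarrow> invariant U \<and> U \<noteq> {0} \<and> (\<forall>U'. invariant U' \<and> U' \<subseteq> U \<longrightarrow> U' = {0} \<or> U' = U)"

lemma irreducible_exists:
  assumes "invariant K" "K \<noteq> {0}"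
  shows "\<exists>U\<subseteq>K. irreducible U"
  using assms
proof (induction "dim K" arbitrary: K rule: less_induct)
  case less
  show ?case
  proof (cases "irreducible K")
    case False
    then obtain U where U: "invariant U" "U \<subset> K" "U \<noteq> {0}"
      using less.prems by (auto simp: irreducible_def)
    have "dim U < dim K"
      using U less.prems T_span by (intro dim_psubset_finite[OF finite_B]) (auto simp: invariant_def)
    then show ?thesis using less.hyps U by (meson psubset_imp_subset subset_trans)
  qed blast
qed

text \<open>The span of all irreducible subspaces is invariant, so a Maschke projection onto it has
  an invariant kernel; a nonzero kernel would contain one more irreducible subspace.\<close>

lemma span_irreducible: "T \<subseteq> span (\<Union>(Collect irreducible))"
proof -
  let ?S = "span (\<Union>(Collect irreducible))"
  have sub: "\<Union>(Collect irreducible) \<subseteq> T" by (auto simp: irreducible_def invariant_def)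
  have inv: "act g x \<in> ?S" if "g permutes X" "x \<in> ?S" for g x
    using that by (intro linear_span_image[OF act_linear subspace_span _ that(2)])
      (auto simp: irreducible_def invariant_def intro!: span_base)
  have "invariant ?S"
    using span_minimal[OF sub subspace_T] inv by (simp add: invariant_def)
  then obtain q where q: "equivariant q" "\<And>x. x \<in> T \<Longrightarrow> q x \<in> ?S" "\<And>x. x \<in> ?S \<Longrightarrow> q x = x"
    by (rule maschke) blast
  let ?K = "{x \<in> T. q x = 0}"
  have "invariant ?K"
    using q(1) subspace_T
    by (auto simp: invariant_def subspace_def act_into linear_add linear_scale linear_zero
        equivariant_def act_linear)
  have "?K = {0}"
  proof (rule ccontr)
    assume "?K \<noteq> {0}"
    then obtain U where U: "U \<subseteq> ?K" "irreducible U" using \<open>invariant ?K\<close> irreducible_exists by blast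
    then have "U \<subseteq> ?S" by (auto intro: span_base)
    then have "U \<subseteq> {0}" using U(1) q(3) by fastforce
    then show False using U(2) subspace_0 by (force simp: irreducible_def invariant_def)
  qed
  show ?thesis
  proof
    fix x assume x: "x \<in> T"
    then have "x - q x \<in> ?K"
      using q subspace_T by (auto simp: equivariant_def subspace_diff linear_diff image_subset_iff)
    then have "x = q x" using \<open>?K = {0}\<close> by auto
    then show "x \<in> ?S" using q(2)[OF x] by simp
  qed
qed

section \<open>Subspaces stable under all equivariant maps\<close>

definition equivariant_span :: "'a \<Rightarrow> 'a set" where
  "equivariant_span x = {f x | f. equivariant f}"

lemma equivariant_spanI: "equivariant f \<Longrightarrow> f x \<in> equivariant_span x"
  by (auto simp: equivariant_span_def)

lemma mem_equivariant_span: "x \<in> equivariant_span x"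
  using equivariant_spanI[OF equivariant_id] .

lemma stable_equivariant_span:
  assumes "x \<in> T"
  shows "stable (equivariant_span x)"
  unfolding stable_def subspace_def
proof (intro conjI ballI allI impI)
  show "0 \<in> equivariant_span x" using equivariant_spanI[OF equivariant_zero, of x] by simp
  show "y + z \<in> equivariant_span x" if "y \<in> equivariant_span x" "z \<in> equivariant_span x" for y z
    using that equivariant_add by (fastforce simp: equivariant_span_def)
  show "c *s y \<in> equivariant_span x" if "y \<in> equivariant_span x" for c y
    using that equivariant_scale by (fastforce simp: equivariant_span_def)
  show "equivariant_span x \<subseteq> T" using assms by (auto simp: equivariant_span_def equivariant_def)
  show "f y \<in> equivariant_span x" if "equivariant f" "y \<in> equivariant_span x" for f y
    using that equivariant_comp by (fastforce simp: equivariant_span_def)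
qed

text \<open>An equivariant \<open>f\<close> with \<open>f x \<noteq> 0\<close> is injective on
  \<open>U\<close>, since its kernel there is invariant. So whatever annihilates \<open>f x\<close>
  annihilates \<open>x\<close>, and \<open>equivariant_extend\<close> leads back from
  \<open>f x\<close> to \<open>x\<close>.\<close>

lemma simple_equivariant_span:
  assumes U: "irreducible U" and x: "x \<in> U" "x \<noteq> 0"
  shows "simple (equivariant_span x)"
proof -
  have inv: "invariant U" using U by (simp add: irreducible_def)
  then have U': "subspace U" "U \<subseteq> T" "x \<in> T" using x by (auto simp: invariant_def)
  have "\<exists>f. equivariant f \<and> f y = z"
    if y: "y \<in> equivariant_span x" "y \<noteq> 0" and z: "z \<in> equivariant_span x" for y z
  proof -
    obtain f where f: "equivariant f" "y = f x" using y by (auto simp: equivariant_span_def)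
    obtain g where g: "equivariant g" "z = g x" using z by (auto simp: equivariant_span_def)
    let ?K = "{u \<in> U. f u = 0}"
    have "invariant ?K"
      using inv f(1) act_linear
      by (auto simp: invariant_def subspace_def linear_add linear_scale linear_zero equivariant_def subset_iff)
    moreover have "x \<notin> ?K" using y(2) f(2) by simp
    ultimately have "?K = {0}" using U x(1) by (auto simp: irreducible_def)
    have "r x = 0" if r: "r \<in> galg" "r y = 0" for r
    proof -
      have "f (r x) = 0" using galg_equivariant[OF r(1) f(1) U'(3)] r(2) f(2) by simp
      then show ?thesis using galg_invariant[OF r(1) inv x(1)] \<open>?K = {0}\<close> by auto
    qed
    moreover have "y \<in> T" using f U'(3) by (auto simp: equivariant_def)
    ultimately obtain h where "equivariant h" "h y = x"
      using equivariant_extend U'(3) by metis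
    then show ?thesis using equivariant_comp[OF g(1)] g(2) by blast
  qed
  moreover have "equivariant_span x \<noteq> {0}" using mem_equivariant_span x(2) by blast
  ultimately show ?thesis using stable_equivariant_span[OF U'(3)] by (auto simp: simple_def)
qed

text \<open>\<open>T\<close> is spanned by vectors \<open>u\<close> of irreducible subspaces, and
  \<open>y u\<close> stays in the subspace of \<open>u\<close>, so it generates a simple space. That
  space remains in the image of \<open>y\<close> because \<open>y\<close> commutes with equivariant
  maps.\<close>

lemma image_span_simple:
  assumes y: "y \<in> galg"
  shows "y ` T \<subseteq> span (\<Union>{W. simple W \<and> W \<subseteq> y ` T})" (is "_ \<subseteq> span ?S")
proof
  fix m assume "m \<in> y ` T"
  then obtain x where x: "x \<in> T" "m = y x" by blast
  have "y u \<in> span ?S" if U: "irreducible U" "u \<in> U" for U u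
  proof (cases "y u = 0")
    case False
    have inv: "invariant U" using U by (simp add: irreducible_def)
    then have u: "u \<in> T" using U by (auto simp: invariant_def)
    have yu: "y u \<in> U" using y inv U by (simp add: galg_invariant)
    have "simple (equivariant_span (y u))"
      using simple_equivariant_span[OF U(1) yu False] .
    moreover have "equivariant_span (y u) \<subseteq> y ` T"
    proof
      fix z assume "z \<in> equivariant_span (y u)"
      then obtain f where f: "equivariant f" "z = f (y u)" by (auto simp: equivariant_span_def)
      then have "z = y (f u)" using galg_equivariant[OF y f(1) u] by simp
      then show "z \<in> y ` T" using equivariantD(2)[OF f(1) u] by blast
    qed
    ultimately show ?thesis
      using mem_equivariant_span by (blast intro: span_base)
  qed (simp add: span_zero)
  then show "m \<in> span ?S"
    using linear_span_image[OF galg_linear[OF y] subspace_span _ subsetD[OF span_irreducible x(1)]]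
    unfolding x(2) by blast
qed

text \<open>Greedily adjoin simple subspaces as long as they are not contained in the current span.\<close>

lemma direct_decomposition:
  assumes M: "M \<subseteq> T" "subspace M" "M \<subseteq> span (\<Union>{W. simple W \<and> W \<subseteq> M})"
    and W0: "simple W0" "W0 \<subseteq> M"
  obtains D where "finite D" "W0 \<in> D" "\<forall>W\<in>D. simple W" "M = span (\<Union>D)"
    "\<forall>f. (\<forall>W\<in>D. f W \<in> W) \<and> (\<Sum>W\<in>D. f W) = 0 \<longrightarrow> (\<forall>W\<in>D. f W = 0)"
proof -
  let ?good = "\<lambda>D. finite D \<and> W0 \<in> D \<and> (\<forall>W\<in>D. simple W \<and> W \<subseteq> M) \<and>
    (\<forall>f. (\<forall>W\<in>D. f W \<in> W) \<and> (\<Sum>W\<in>D. f W) = 0 \<longrightarrow> (\<forall>W\<in>D. f W = 0))"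
  obtain Q where Q: "Q \<subseteq> \<Union>{W. simple W \<and> W \<subseteq> M}" "independent Q"
    "\<Union>{W. simple W \<and> W \<subseteq> M} \<subseteq> span Q" by (rule maximal_independent_subset)
  have "Q \<subseteq> span B" using Q(1) M(1) T_span by blast
  then have "finite Q" using independent_span_bound[OF finite_B Q(2)] by blast
  have MQ: "M \<subseteq> span Q"
    using M(3) span_minimal[OF Q(3) subspace_span] by blast
  have "\<exists>D. ?good D \<and> F \<subseteq> span (\<Union>D)" if "finite F" "F \<subseteq> Q" for F
    using that
  proof (induction F rule: finite_induct)
    case empty
    have "?good {W0}" using W0 by auto
    then show ?case by blast
  next
    case (insert x F)
    then obtain D where D: "?good D" "F \<subseteq> span (\<Union>D)" by auto
    obtain W where W: "simple W" "W \<subseteq> M" "x \<in> W" using insert.prems Q(1) by blast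
    have stable: "f z \<in> span (\<Union>D)" if "equivariant f" "z \<in> span (\<Union>D)" for f z
    proof (rule linear_span_image[OF equivariantD(1)[OF that(1)] subspace_span _ that(2)])
      show "f ` \<Union>D \<subseteq> span (\<Union>D)"
        using D(1) that(1) by (auto simp: simple_def stable_def intro!: span_base)
    qed
    show ?case
    proof (cases "x \<in> span (\<Union>D)")
      case True
      then show ?thesis using D by blast
    next
      case False
      \<comment> \<open>A nonzero common vector would reach \<open>x\<close> by an equivariant map,
        but the span of \<open>D\<close> is stable and misses \<open>x\<close>.\<close>
      have inter: "z = 0" if z: "z \<in> W" "z \<in> span (\<Union>D)" for z
      proof (rule ccontr)
        assume "z \<noteq> 0"
        then obtain f where "equivariant f" "f z = x" using simpleD[OF W(1) z(1) W(3)] by blast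
        then show False using stable z False by blast
      qed
      have "W \<notin> D" using False W(3) by (auto intro: span_base)
      have "?good (insert W D)"
      proof (intro conjI allI impI)
        fix f assume f: "(\<forall>W\<in>insert W D. f W \<in> W) \<and> (\<Sum>W\<in>insert W D. f W) = 0"
        then have eq: "f W + (\<Sum>W\<in>D. f W) = 0" using D(1) \<open>W \<notin> D\<close> by simp
        have "(\<Sum>W\<in>D. f W) \<in> span (\<Union>D)" using f by (intro span_sum span_base) auto
        then have "f W \<in> span (\<Union>D)"
          using eq by (metis add_eq_0_iff2 span_neg)
        then have "f W = 0" using inter f by blast
        then show "\<forall>W\<in>insert W D. f W = 0" using D(1) f eq by auto
      qed (use D W in auto)
      moreover have "span (\<Union>D) \<subseteq> span (\<Union>(insert W D))" by (intro span_mono) auto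
      moreover have "x \<in> span (\<Union>(insert W D))" using W by (auto intro: span_base)
      ultimately show ?thesis using D(2) by (intro exI[of _ "insert W D"]) auto
    qed
  qed
  from this[OF \<open>finite Q\<close> subset_refl]
  obtain D where "?good D \<and> Q \<subseteq> span (\<Union>D)" ..
  then have D: "?good D" "Q \<subseteq> span (\<Union>D)" by (rule conjunct1, rule conjunct2)
  have "M = span (\<Union>D)"
  proof
    show "M \<subseteq> span (\<Union>D)" using MQ span_minimal[OF D(2) subspace_span] by blast
    show "span (\<Union>D) \<subseteq> M" using D(1) M(2) by (intro span_minimal) auto
  qed
  then show thesis using D(1) by (intro that[of D]) auto
qed

lemma stable_image:
  assumes "y \<in> galg" "stable W"
  shows "stable (y ` W)"
proof -
  have W: "subspace W" "W \<subseteq> T" using assms by (auto simp: stable_def)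
  have "y ` W \<subseteq> T" using W galg_into assms by blast
  moreover have "f (y x) \<in> y ` W" if "equivariant f" "x \<in> W" for f x
    using that assms(2) W galg_equivariant[OF assms(1) that(1), of x]
    by (auto simp: stable_def)
  ultimately show ?thesis
    using subspace_linear_image[OF galg_linear[OF assms(1)] W(1)] by (auto simp: stable_def)
qed

lemma stable_T: "stable T"
  by (auto simp: stable_def subspace_T equivariant_def)

text \<open>Schur's lemma: a nonzero kernel vector in \<open>W\<close> would reach every vector of
  \<open>W\<close>, and \<open>y\<close> would vanish on all of them.\<close>

lemma simple_image:
  assumes y: "y \<in> galg" and W: "simple W" and ne: "y ` W \<noteq> {0}"
  shows "simple (y ` W)" "inj_on y W"
proof -
  have W': "subspace W" "W \<subseteq> T" "stable W" using W by (auto simp: simple_def stable_def)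
  have "0 \<in> W" using W' by (simp add: subspace_0)
  moreover have "y 0 = 0" using y by (simp add: galg_linear linear_zero)
  ultimately obtain w where w: "w \<in> W" "y w \<noteq> 0" using ne by force
  have ker: "x = 0" if "x \<in> W" "y x = 0" for x
  proof (rule ccontr)
    assume "x \<noteq> 0"
    then have "\<exists>f. equivariant f \<and> f x = w" using simpleD[OF W that(1) w(1)] by blast
    then obtain f where f: "equivariant f" "f x = w" by blast
    then have "y w = f (y x)"
      using galg_equivariant[OF y f(1), of x] that(1) W'(2) by auto
    then show False using that w f by (simp add: equivariantD(1) linear_zero)
  qed
  show "inj_on y W"
  proof (rule inj_onI)
    fix x x' assume "x \<in> W" "x' \<in> W" "y x = y x'"
    then show "x = x'"
      using ker[of "x - x'"] W' y by (simp add: linear_diff galg_linear subspace_diff)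
  qed
  have "\<exists>f. equivariant f \<and> f (y u) = y v" if "u \<in> W" "v \<in> W" "y u \<noteq> 0" for u v
  proof -
    have "u \<noteq> 0" using that \<open>y 0 = 0\<close> by metis
    then have "\<exists>f. equivariant f \<and> f u = v" using simpleD[OF W that(1,2)] by blast
    then obtain f where f: "equivariant f" "f u = v" by blast
    then show ?thesis using galg_equivariant[OF y f(1)] that(1) W'(2) by fastforce
  qed
  then show "simple (y ` W)"
    using stable_image[OF y W'(3)] ne by (auto simp: simple_def)
qed

text \<open>The hypothesis on \<open>a\<close> and \<open>b\<close> is von Neumann's property of a quasi-idempotent \<open>a b\<close>.\<close>

lemma simple_young:
  assumes a: "a \<in> galg" and b: "b \<in> galg"
    and vN: "\<And>g. g permutes X \<Longrightarrow> \<exists>c. \<forall>x\<in>T. a (act g (b x)) = c *s a (b x)"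
    and ne: "h \<in> T" "a (b h) \<noteq> 0"
  shows "simple ((\<lambda>x. a (b x)) ` T)"
proof -
  note into = galg_into[OF a] galg_into[OF b]
  note lin = galg_linear[OF a] galg_linear[OF b]
  have vN': "\<exists>c. \<forall>x\<in>T. a (r (b x)) = c *s a (b x)" if "r \<in> galg" for r
    using that
  proof (induction rule: galg.induct)
    case zero
    show ?case using lin by (intro exI[of _ 0]) (simp add: linear_zero)
  next
    case (add r s)
    then obtain c d where "\<forall>x\<in>T. a (r (b x)) = c *s a (b x)" "\<forall>x\<in>T. a (s (b x)) = d *s a (b x)"
      by blast
    then show ?case using lin by (intro exI[of _ "c + d"]) (simp add: linear_add scale_left_distrib)
  next
    case (scale r d)
    then obtain c where "\<forall>x\<in>T. a (r (b x)) = c *s a (b x)" by blast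
    then show ?case using lin by (intro exI[of _ "d * c"]) (simp add: linear_scale)
  qed (rule vN)
  have "\<exists>f. equivariant f \<and> f (a (b x)) = a (b y)"
    if x: "x \<in> T" "a (b x) \<noteq> 0" and y: "y \<in> T" for x y
  proof -
    have "r (a (b y)) = 0" if r: "r \<in> galg" "r (a (b x)) = 0" for r
    proof -
      define z where "z = r (a (b y))"
      have z: "z \<in> T" "a (b y) \<in> T" using r y into by (auto simp: z_def galg_into)
      \<comment> \<open>On \<open>T\<close>, the map \<open>a s r a b\<close> is a scalar
        \<open>c\<close> times \<open>a b\<close>. Evaluated at \<open>x\<close> it vanishes because
        \<open>r (a (b x)) = 0\<close>, and \<open>a (b x) \<noteq> 0\<close> then gives
        \<open>c = 0\<close>; evaluated at \<open>y\<close> this is the claim.\<close>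
      have az: "a (s z) = 0" if s: "s \<in> galg" for s
      proof -
        obtain sr where sr: "sr \<in> galg" "\<forall>x\<in>T. s (r x) = sr x"
          using galg_comp[OF s r(1)] by blast
        obtain sra where sra: "sra \<in> galg" "\<forall>x\<in>T. sr (a x) = sra x"
          using galg_comp[OF sr(1) a] by blast
        obtain c where c: "\<forall>x\<in>T. a (sra (b x)) = c *s a (b x)"
          using vN'[OF sra(1)] by blast
        have sraE: "s (r (a (b u))) = sra (b u)" if "u \<in> T" for u
          using sr sra that into by simp
        have "c *s a (b x) = a (s 0)"
          using c x(1) sraE[OF x(1)] r(2) by simp
        also have "\<dots> = 0" using lin s by (simp add: linear_zero galg_linear)
        finally have "c = 0" using x(2) by simp
        then show ?thesis using c y sraE[OF y] by (simp add: z_def)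
      qed
      \<comment> \<open>With this projection, \<open>z = q z = r (a (q (b y)))\<close>. Here
        \<open>q (b y)\<close> lies in the orbit space of \<open>z\<close>, which \<open>a\<close>
        kills by \<open>az\<close>; hence \<open>z = 0\<close>.\<close>
      obtain q where q: "equivariant q" "\<And>x. x \<in> T \<Longrightarrow> q x \<in> orbit_space z"
        "\<And>x. x \<in> orbit_space z \<Longrightarrow> q x = x"
        by (rule maschke[OF invariant_orbit_space[OF z(1)]]) blast
      have "q (a (b y)) = a (q (b y))"
        using q(1) a into y by (simp add: galg_equivariant)
      also have "q (b y) \<in> orbit_space z" using q y into by simp
      then have "a (q (b y)) = 0" using az by (auto simp: orbit_space_def)
      finally have "q z = 0"
        using galg_equivariant[OF r(1) q(1) z(2)] r(1)
        by (simp add: z_def galg_linear linear_zero)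
      then show ?thesis using q(3)[OF mem_orbit_space[OF z(1)]] by (simp add: z_def)
    qed
    then show ?thesis using equivariant_extend[of "a (b x)" "a (b y)"] x y into by metis
  qed
  moreover obtain ab where ab: "ab \<in> galg" "\<forall>x\<in>T. a (b x) = ab x"
    using galg_comp[OF a b] by blast
  then have "stable ((\<lambda>x. a (b x)) ` T)"
    using stable_image[OF ab(1) stable_T] by (simp cong: image_cong)
  moreover have "(\<lambda>x. a (b x)) ` T \<noteq> {0}" using ne by auto
  ultimately show ?thesis by (auto simp: simple_def)
qed

text \<open>If \<open>b\<close> killed the orbit space of \<open>a (b w)\<close>, an equivariant
  projection \<open>q\<close> onto that space would give \<open>a (b w) = a (b (q w)) = 0\<close>.
  So \<open>b (r (a (b w))) \<noteq> 0\<close> for some \<open>r\<close>, and \<open>james\<close>,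
  extended linearly to the group algebra, makes this value a multiple of \<open>b w\<close>.\<close>

lemma orbit_return:
  assumes a: "a \<in> galg" and b: "b \<in> galg" and w: "w \<in> T"
    and james: "\<And>g. g permutes X \<Longrightarrow> \<exists>c. b (act g w) = c *s b w"
    and ne: "a (b w) \<noteq> 0"
  shows "\<exists>r\<in>galg. r (a (b w)) = b w"
proof -
  note into = galg_into[OF a] galg_into[OF b]
  note lin = galg_linear[OF a] galg_linear[OF b]
  have james': "\<exists>c. b (r w) = c *s b w" if "r \<in> galg" for r
    using that
  proof (induction rule: galg.induct)
    case zero
    show ?case using lin by (intro exI[of _ 0]) (simp add: linear_zero)
  next
    case (add r s)
    then obtain c d where "b (r w) = c *s b w" "b (s w) = d *s b w" by blast
    then show ?case using lin by (intro exI[of _ "c + d"]) (simp add: linear_add scale_left_distrib)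
  next
    case (scale r d)
    then obtain c where "b (r w) = c *s b w" by blast
    then show ?case using lin by (intro exI[of _ "d * c"]) (simp add: linear_scale)
  qed (rule james)
  have "\<exists>r\<in>galg. b (r (a (b w))) \<noteq> 0"
  proof (rule ccontr)
    assume "\<not> ?thesis"
    then have 0: "b u = 0" if "u \<in> orbit_space (a (b w))" for u
      using that by (auto simp: orbit_space_def)
    have h: "a (b w) \<in> T" using w into by simp
    obtain q where q: "equivariant q" "\<And>x. x \<in> T \<Longrightarrow> q x \<in> orbit_space (a (b w))"
      "\<And>x. x \<in> orbit_space (a (b w)) \<Longrightarrow> q x = x"
      by (rule maschke[OF invariant_orbit_space[OF h]]) blast
    have "q (a (b w)) = a (b (q w))"
      using q(1) a b w into by (simp add: galg_equivariant)
    also have "\<dots> = 0" using 0 q(2)[OF w] lin by (simp add: linear_zero)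
    finally show False using q(3)[OF mem_orbit_space[OF h]] ne by simp
  qed
  then obtain r where r: "r \<in> galg" "b (r (a (b w))) \<noteq> 0" by blast
  obtain ra where ra: "ra \<in> galg" "\<forall>x\<in>T. r (a x) = ra x"
    using galg_comp[OF r(1) a] by blast
  obtain rab where rab: "rab \<in> galg" "\<forall>x\<in>T. ra (b x) = rab x"
    using galg_comp[OF ra(1) b] by blast
  have eq: "r (a (b w)) = rab w" using ra rab w into by simp
  obtain c where c: "b (rab w) = c *s b w" using james'[OF rab(1)] by blast
  then have "c \<noteq> 0" using r eq by auto
  obtain br where br: "br \<in> galg" "\<forall>x\<in>T. b (r x) = br x"
    using galg_comp[OF b r(1)] by blast
  have "br (a (b w)) = c *s b w" using br w into eq c by metis
  then have "inverse c *s br (a (b w)) = b w" using \<open>c \<noteq> 0\<close> by simp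
  then show ?thesis using br(1) by (intro bexI[of _ "\<lambda>x. inverse c *s br x"] galg.scale) auto
qed

end

section \<open>Polynomial families and eigenvalues\<close>

text \<open>A linear functional vanishing on \<open>W\<close> but not at \<open>v k\<close> would
  turn the family into a nonzero polynomial with infinitely many zeros.\<close>

lemma (in vector_space) polynomial_coefficients_in_subspace:
  assumes W: "subspace W" and Z: "infinite Z"
    and F: "\<And>z. z \<in> Z \<Longrightarrow> (\<Sum>k\<le>D. scale (z ^ k) (v k)) \<in> W"
    and k: "k \<le> D"
  shows "v k \<in> W"
proof (rule ccontr)
  assume "v k \<notin> W"
  interpret vector_space_pair scale "(*) :: 'a \<Rightarrow> 'a \<Rightarrow> 'a"
    by unfold_locales (auto simp: algebra_simps)
  obtain C where C: "C \<subseteq> W" "independent C" "W \<subseteq> span C" by (rule maximal_independent_subset)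
  have "span C \<subseteq> W" using C W by (simp add: span_minimal)
  then have "v k \<notin> span C" using \<open>v k \<notin> W\<close> by blast
  then have "independent (insert (v k) C)" using C by (simp add: independent_insertI)
  then obtain g where g: "Vector_Spaces.linear scale (*) g"
    "\<forall>x\<in>insert (v k) C. g x = (if x = v k then 1 else 0)"
    using linear_independent_extend[of "insert (v k) C" "\<lambda>x. if x = v k then 1 else 0"] by blast
  interpret g: Vector_Spaces.linear scale "(*)" g by fact
  have "C \<subseteq> {x. g x = 0}" using g(2) \<open>v k \<notin> span C\<close> by (auto intro: span_base)
  moreover have "subspace {x. g x = 0}" by (auto simp: subspace_def g.add g.scale g.zero)
  ultimately have gW: "g x = 0" if "x \<in> W" for x
    using that C span_minimal[of C "{x. g x = 0}"] by blast
  define p where "p = (\<Sum>i\<le>D. monom (g (v i)) i)"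
  have "poly p z = 0" if "z \<in> Z" for z
  proof -
    have "poly p z = g (\<Sum>i\<le>D. scale (z ^ i) (v i))"
      by (simp add: p_def poly_sum poly_monom g.sum g.scale mult.commute)
    then show ?thesis using gW F that by simp
  qed
  then have "Z \<subseteq> {z. poly p z = 0}" by blast
  then have "p = 0" using Z poly_roots_finite finite_subset by blast
  then have "coeff p k = 0" by simp
  moreover have "coeff p k = g (v k)"
    using k by (simp add: p_def coeff_sum)
  ultimately show False using g(2) by simp
qed

lemma (in vector_space) eigenvectors_independent_sum:
  assumes X: "Vector_Spaces.linear scale scale X" and "finite C"
    and "\<And>c. c \<in> C \<Longrightarrow> X (v c) = scale c (v c)" "(\<Sum>c\<in>C. v c) = 0" "c \<in> C"
  shows "v c = 0"
  using assms(2-)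
proof (induction C arbitrary: v c rule: finite_induct)
  case (insert d C)
  \<comment> \<open>Applying \<open>X - d\<close> removes the summand at \<open>d\<close>.\<close>
  have "(\<Sum>c\<in>C. scale (c - d) (v c)) = X (\<Sum>c\<in>insert d C. v c) - scale d (\<Sum>c\<in>insert d C. v c)"
    using insert.hyps by (simp add: insert.prems(1) linear_add[OF X] linear_sum[OF X] scale_sum_right
        algebra_simps sum_subtractf)
  also have "\<dots> = 0" by (simp only: insert.prems(2)) (simp add: linear_zero[OF X])
  finally have *: "(\<Sum>c\<in>C. scale (c - d) (v c)) = 0" .
  have "scale (c - d) (v c) = 0" if "c \<in> C" for c
    by (rule insert.IH[OF _ * that]) (simp add: linear_scale[OF X] insert.prems(1) mult.commute)
  then have 0: "v c = 0" if "c \<in> C" for c using that insert.hyps by fastforce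
  then have "v d = 0" using insert by simp
  then show ?case using 0 insert.prems(3) by blast
qed simp

lemma (in finite_dimensional_vector_space) finite_eigenvalues:
  assumes X: "Vector_Spaces.linear scale scale X"
  shows "finite {c. \<exists>x. x \<noteq> 0 \<and> X x = scale c x}" (is "finite ?E")
proof (rule ccontr)
  assume "infinite ?E"
  then obtain C where C: "C \<subseteq> ?E" "finite C" "card C = Suc dimension"
    using infinite_arbitrarily_large by blast
  then have "\<forall>c\<in>C. \<exists>x. x \<noteq> 0 \<and> X x = scale c x" by blast
  then obtain v where v: "\<And>c. c \<in> C \<Longrightarrow> v c \<noteq> 0 \<and> X (v c) = scale c (v c)" by metis
  have "c = d" if "c \<in> C" "d \<in> C" "v c = v d" for c d
  proof -
    have "scale (c - d) (v c) = 0" using v that by (metis scale_left_diff_distrib right_minus_eq)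
    then show ?thesis using v that by simp
  qed
  then have inj: "inj_on v C" by (auto intro: inj_onI)
  have "independent (v ` C)"
  proof (rule independent_if_scalars_zero)
    fix f x assume f: "(\<Sum>x\<in>v ` C. scale (f x) x) = 0" and "x \<in> v ` C"
    then obtain c where c: "c \<in> C" "x = v c" by blast
    have "(\<Sum>c\<in>C. scale (f (v c)) (v c)) = 0" using f by (simp add: sum.reindex[OF inj])
    then have "scale (f (v c)) (v c) = 0"
      by (rule eigenvectors_independent_sum[where v = "\<lambda>c. scale (f (v c)) (v c)", OF X C(2) _ _ c(1), rotated])
        (simp add: linear_scale[OF X] v scale_left_commute)
    then show "f x = 0" using v c by simp
  qed (use C in simp)
  then have "card (v ` C) \<le> dimension"
    by (metis dim_eq_card_independent dim_subset_UNIV)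
  then show False unfolding card_image[OF inj] C(3) by simp
qed

text \<open>This makes a possibly singular \<open>X\<close> reachable from invertible maps: it is
  the value at \<open>c = 0\<close> of a family that is invertible for all but finitely many
  \<open>c\<close>.\<close>

lemma (in finite_dimensional_vector_space) finite_singular_shifts:
  assumes X: "Vector_Spaces.linear scale scale X"
  shows "finite {c. \<not> bij (\<lambda>v. X v + scale c v)}"
proof (rule finite_subset)
  let ?E = "{c. \<exists>x. x \<noteq> 0 \<and> X x = scale c x}"
  show "finite (uminus ` ?E)" using finite_eigenvalues[OF X] by simp
  show "{c. \<not> bij (\<lambda>v. X v + scale c v)} \<subseteq> uminus ` ?E"
  proof
    fix c assume "c \<in> {c. \<not> bij (\<lambda>v. X v + scale c v)}"
    then have nb: "\<not> bij (\<lambda>v. X v + scale c v)" by simp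
    let ?Y = "\<lambda>v. X v + scale c v"
    have lin: "Vector_Spaces.linear scale scale ?Y"
      by (rule linearI) (auto simp: linear_add[OF X] linear_scale[OF X] scale_right_distrib mult.commute)
    then have "\<not> inj ?Y" using nb linear_inj_imp_surj[OF lin] by (auto simp: bij_def)
    then obtain x y where "x \<noteq> y" "?Y x = ?Y y" by (auto simp: inj_def)
    then have "x - y \<noteq> 0" "X (x - y) = scale (- c) (x - y)"
      by (auto simp: linear_diff[OF X] scale_right_diff_distrib algebra_simps)
    then have "- c \<in> ?E" by blast
    then show "c \<in> uminus ` ?E" by (intro image_eqI[of _ _ "- c"]) simp_all
  qed
qed

lemma base_representation_unique:
  fixes b :: nat
  assumes "\<And>k. k < K \<Longrightarrow> f k < b" "\<And>k. k < K \<Longrightarrow> g k < b"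
    "(\<Sum>k<K. f k * b ^ k) = (\<Sum>k<K. g k * b ^ k)" "k < K"
  shows "f k = g k"
  using assms
proof (induction K arbitrary: f g k)
  case (Suc K)
  have split: "(\<Sum>k<Suc K. h k * b ^ k) = h 0 + b * (\<Sum>k<K. h (Suc k) * b ^ k)" for h :: "nat \<Rightarrow> nat"
    by (simp add: sum.lessThan_Suc_shift sum_distrib_left mult.left_commute del: sum.lessThan_Suc)
  have eq: "f 0 + b * (\<Sum>k<K. f (Suc k) * b ^ k) = g 0 + b * (\<Sum>k<K. g (Suc k) * b ^ k)"
    using Suc.prems(3) unfolding split .
  have lt: "f 0 < b" "g 0 < b" using Suc.prems(1,2) by auto
  have "(f 0 + b * (\<Sum>k<K. f (Suc k) * b ^ k)) mod b = f 0"
    "(g 0 + b * (\<Sum>k<K. g (Suc k) * b ^ k)) mod b = g 0" using lt by simp_all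
  then have 0: "f 0 = g 0" using eq by simp
  then have "(\<Sum>k<K. f (Suc k) * b ^ k) = (\<Sum>k<K. g (Suc k) * b ^ k)"
    using eq lt by simp
  then have "f (Suc j) = g (Suc j)" if "j < K" for j
    using Suc.IH[of "\<lambda>k. f (Suc k)" "\<lambda>k. g (Suc k)" j] Suc.prems(1,2) that by simp
  then show ?case using 0 Suc.prems(4) by (cases k) auto
qed simp

text \<open>In base \<open>card A + 1\<close> the digits of the sum count how often each value is taken.\<close>

lemma power_sum_eq_imp_permutes:
  fixes f g :: "'a \<Rightarrow> nat"
  assumes "finite A" and eq: "(\<Sum>a\<in>A. Suc (card A) ^ f a) = (\<Sum>a\<in>A. Suc (card A) ^ g a)"
  obtains p where "p permutes A" "\<forall>a\<in>A. f a = g (p a)"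
proof -
  define b where "b = Suc (card A)"
  obtain K where "\<forall>a\<in>A. f a < K \<and> g a < K"
    using finite_nat_bounded[of "f ` A \<union> g ` A"] assms(1) by (auto simp: image_subset_iff)
  then have fK: "f ` A \<subseteq> {..<K}" and gK: "g ` A \<subseteq> {..<K}" by auto
  have digits: "(\<Sum>a\<in>A. b ^ h a) = (\<Sum>k<K. card {a \<in> A. h a = k} * b ^ k)"
    if "h ` A \<subseteq> {..<K}" for h
  proof -
    have "(\<Sum>a\<in>A. b ^ h a) = (\<Sum>k<K. \<Sum>a | a \<in> A \<and> h a = k. b ^ h a)"
      by (rule sum.group[symmetric]) (use assms(1) that in auto)
    also have "\<dots> = (\<Sum>k<K. \<Sum>a | a \<in> A \<and> h a = k. b ^ k)"
      by (intro sum.cong) auto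
    finally show ?thesis by simp
  qed
  have lt: "card {a \<in> A. h a = k} < b" for h :: "'a \<Rightarrow> nat" and k
    unfolding b_def less_Suc_eq_le by (rule card_mono) (use assms(1) in auto)
  have cards: "card {a \<in> A. f a = k} = card {a \<in> A. g a = k}" for k
  proof (cases "k < K")
    case True
    have "(\<Sum>k<K. card {a \<in> A. f a = k} * b ^ k) = (\<Sum>k<K. card {a \<in> A. g a = k} * b ^ k)"
      using eq unfolding b_def[symmetric] digits[OF fK] digits[OF gK] .
    then show ?thesis
      by (rule base_representation_unique[where f = "\<lambda>k. card {a \<in> A. f a = k}", OF lt lt _ True])
  next
    case False
    then have "{a \<in> A. f a = k} = {}" "{a \<in> A. g a = k} = {}" using fK gK by auto
    then show ?thesis by (simp only:)
  qed
  have "image_mset f (mset_set A) = image_mset g (mset_set A)"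
  proof (rule multiset_eqI)
    show "count (image_mset f (mset_set A)) k = count (image_mset g (mset_set A)) k" for k
    proof -
      have *: "{x. h x = k \<and> x \<in> A} = {x \<in> A. h x = k}" for h :: "'a \<Rightarrow> nat" by blast
      show ?thesis using cards[of k] assms(1)
        by (simp add: count_image_mset_eq_card_vimage * eq_commute[of k])
    qed
  qed
  then show thesis using image_mset_eq_implies_permutes[OF assms(1)] that by metis
qed

section \<open>The two actions on a tensor power\<close>

declare One_nat_def [simp del]

lemma words_length: "w \<in> words n N \<Longrightarrow> length w = N"
  by (simp add: words_def)

lemma words_nth:
  assumes "w \<in> words n N" "p < N"
  shows "w ! p \<in> {1..n}"
proof -
  have "w ! p \<in> set w" using assms by (simp add: words_def)
  then show ?thesis using assms(1) unfolding words_def by blast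
qed

text \<open>The substitution in coefficients that \<open>place_act\<close> induces: the coefficient
  of the image at \<open>u\<close> is the old one at \<open>permute_word N g u\<close>. Hence
  \<open>g\<close> occurs without an inverse, and words carry a right action.\<close>

definition permute_word :: "nat \<Rightarrow> (nat \<Rightarrow> nat) \<Rightarrow> nat list \<Rightarrow> nat list" where
  "permute_word N g u = map (\<lambda>p. u ! (g p - 1)) [1..<Suc N]"

lemma permute_word_in_words: "g permutes {1..N} \<Longrightarrow> u \<in> words n N \<Longrightarrow> permute_word N g u \<in> words n N"
  unfolding permute_word_def by (rule place_word)

lemma permute_word_nth: "p \<in> {1..N} \<Longrightarrow> permute_word N g u ! (p - 1) = u ! (g p - 1)"
  by (cases p) (simp_all add: permute_word_def plus_1_eq_Suc del: upt_Suc)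

lemma permute_word_eqI:
  assumes "length u = N" "\<And>p. p \<in> {1..N} \<Longrightarrow> u ! (p - 1) = w ! (g p - 1)"
  shows "u = permute_word N g w"
proof (rule nth_equalityI)
  fix q assume "q < length u"
  then show "u ! q = permute_word N g w ! q"
    using assms(1) assms(2)[of "Suc q"] permute_word_nth[of "Suc q" N] by simp
qed (simp add: permute_word_def assms)

lemma permute_word_inv:
  assumes "g permutes {1..N}" "length u = N"
  shows "permute_word N (inv g) (permute_word N g u) = u"
  unfolding permute_word_def using place_word_inverse[OF assms] by simp

lemma place_act_apply':
  assumes "g permutes {1..N}"
  shows "place_act n N g x u = (if u \<in> words n N then x (permute_word N g u) else 0)"
proof (cases "u \<in> words n N")
  case True
  then show ?thesis using place_act_apply[OF assms True] by (simp add: permute_word_def del: upt_Suc)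
next
  case False
  have "permute_word N (inv g) w \<noteq> u" if "w \<in> words n N" for w
    using permute_word_in_words[OF permutes_inv[OF assms] that] False by auto
  then have "basis_tensor (permute_word N (inv g) w) u = (0::'a)" if "w \<in> words n N" for w
    using that by (auto simp: basis_tensor_def)
  then have "place_act n N g x u = 0"
    unfolding place_act_def lin_ext_apply permute_word_def
    by (intro sum.neutral ballI) (simp only: mult_zero_right)
  then show ?thesis using False by simp
qed

lemma sum_tensor_apply: "(\<Sum>a\<in>A. F a) (u :: nat list) = (\<Sum>a\<in>A. (F a u :: 'k::field))"
  by (induction A rule: infinite_finite_induct) auto

lemma lin_ext_linear: "Vector_Spaces.linear tscale tscale (lin_ext n N F)"
proof -
  interpret vector_space tscale by (rule vector_space_tscale)
  show ?thesis
    by (rule linearI)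
      (auto simp: fun_eq_iff lin_ext_apply tscale_def sum.distrib distrib_right sum_distrib_left mult.assoc)
qed

lemma basis_tensor_in_tensor_power: "w \<in> words n N \<Longrightarrow> basis_tensor w \<in> tensor_power n N"
  by (auto simp: basis_tensor_def tensor_power_def)

lemma tensor_expand:
  assumes "x \<in> tensor_power n N"
  shows "x = (\<Sum>w\<in>words n N. tscale (x w) (basis_tensor w))"
proof
  fix u
  show "x u = (\<Sum>w\<in>words n N. tscale (x w) (basis_tensor w)) u"
    using assms by (simp add: sum_tensor_apply tscale_def basis_tensor_def finite_words
        if_distrib[of "\<lambda>c. _ * c"] tensor_power_def cong: if_cong)
qed

lemma subspace_tensor_power: "module.subspace tscale (tensor_power n N)"
proof -
  interpret vector_space tscale by (rule vector_space_tscale)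
  show ?thesis by (auto simp: subspace_def tensor_power_def tscale_def)
qed

lemma symmetric_rep_tensor_power:
  "symmetric_rep (tscale :: 'k::field_char_0 \<Rightarrow> _) (tensor_power n N) (basis_tensor ` words n N) {1..N}
     (place_act n N)"
proof -
  interpret vector_space "tscale :: 'k \<Rightarrow> _" by (rule vector_space_tscale)
  show ?thesis
  proof (intro symmetric_rep.intro symmetric_rep_axioms.intro)
    show "tensor_power n N \<subseteq> span (basis_tensor ` words n N)"
    proof
      fix x :: "'k tensor" assume "x \<in> tensor_power n N"
      then show "x \<in> span (basis_tensor ` words n N)"
        by (subst tensor_expand) (simp, intro span_sum span_scale span_base imageI)
    qed
    show "place_act n N id x = x" if "x \<in> tensor_power n N" for x :: "'k tensor"
    proof
      fix u
      have "permute_word N id u = u" if "u \<in> words n N"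
        using that by (intro permute_word_eqI[symmetric]) (auto simp: words_def)
      then show "place_act n N id x u = x u"
        using that by (auto simp: place_act_apply' permutes_id tensor_power_def)
    qed
    show "place_act n N (g \<circ> \<tau>) x = place_act n N g (place_act n N \<tau> x)"
      if "g permutes {1..N}" "\<tau> permutes {1..N}" for g \<tau> and x :: "'k tensor"
    proof
      fix u
      have "permute_word N (g \<circ> \<tau>) u = permute_word N \<tau> (permute_word N g u)"
      proof (rule permute_word_eqI)
        fix p assume p: "p \<in> {1..N}"
        then have "\<tau> p \<in> {1..N}" using permutes_in_image[OF that(2)] by blast
        then show "permute_word N (g \<circ> \<tau>) u ! (p - 1) = permute_word N g u ! (\<tau> p - 1)"
          using p by (simp add: permute_word_nth del: atLeastAtMost_iff)
      qed (simp add: permute_word_def)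
      then show "place_act n N (g \<circ> \<tau>) x u = place_act n N g (place_act n N \<tau> x) u"
        using that by (simp add: place_act_apply' permutes_compose permute_word_in_words)
    qed
    show "Vector_Spaces.linear tscale tscale (place_act n N g :: 'k tensor \<Rightarrow> 'k tensor)"
      if "g permutes {1..N}" for g
      unfolding place_act_def by (rule lin_ext_linear)
    show "place_act n N g x \<in> tensor_power n N" if "g permutes {1..N}" for g and x :: "'k tensor"
      using that by (simp add: tensor_power_def place_act_apply')
  qed (auto simp: subspace_tensor_power finite_words vector_space_tscale)
qed

text \<open>The action of an arbitrary square matrix, singular ones included, so that polynomial
  families of matrices can be given entry by entry.\<close>

definition matrix_act :: "nat \<Rightarrow> nat \<Rightarrow> (nat \<Rightarrow> nat \<Rightarrow> 'k::field) \<Rightarrow> 'k tensor \<Rightarrow> 'k tensor" where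
  "matrix_act n N A x u =
     (if u \<in> words n N then \<Sum>w\<in>words n N. x w * (\<Prod>p<N. A (u ! p) (w ! p)) else 0)"

lemma tensor_act_eq_matrix_act:
  "tensor_act scale n e N g = matrix_act n N (\<lambda>i j. coord scale n e (g (e j)) i)"
proof (intro ext)
  fix x u
  show "tensor_act scale n e N g x u = matrix_act n N (\<lambda>i j. coord scale n e (g (e j)) i) x u"
  proof (cases "u \<in> words n N")
    case True
    then show ?thesis
      unfolding tensor_act_def lin_ext_apply matrix_act_def
      by (auto simp: pure_tensor_def words_length intro!: sum.cong prod.cong)
  next
    case False
    then show ?thesis
      unfolding tensor_act_def lin_ext_apply matrix_act_def
      by (auto simp: pure_tensor_def words_length intro!: sum.neutral)
  qed
qed

lemma matrix_act_linear: "Vector_Spaces.linear tscale tscale (matrix_act n N A)"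
proof -
  interpret vector_space tscale by (rule vector_space_tscale)
  show ?thesis
    by (rule linearI)
      (auto simp: fun_eq_iff matrix_act_def tscale_def sum.distrib distrib_right sum_distrib_left mult.assoc)
qed

lemma prod_permute_word:
  fixes A :: "nat \<Rightarrow> nat \<Rightarrow> 'b::comm_monoid_mult"
  assumes "g permutes {1..N}"
  shows "(\<Prod>p<N. A (permute_word N g u ! p) (permute_word N g w ! p)) = (\<Prod>p<N. A (u ! p) (w ! p))"
proof -
  have shift: "(\<Prod>p<N. f p) = (\<Prod>p\<in>{1..N}. f (p - 1))" for f :: "nat \<Rightarrow> 'b"
    by (rule prod.reindex_bij_witness[where j = Suc and i = "\<lambda>p. p - 1"]) auto
  have "(\<Prod>p<N. A (permute_word N g u ! p) (permute_word N g w ! p))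
      = (\<Prod>p\<in>{1..N}. A (u ! (g p - 1)) (w ! (g p - 1)))"
    unfolding shift by (rule prod.cong) (simp_all add: permute_word_nth del: atLeastAtMost_iff)
  also have "\<dots> = (\<Prod>p\<in>{1..N}. A (u ! (p - 1)) (w ! (p - 1)))"
    using prod.permute[OF assms, of "\<lambda>p. A (u ! (p - 1)) (w ! (p - 1))"] by (simp add: comp_def)
  finally show ?thesis by (simp add: shift)
qed

lemma sum_permute_word:
  assumes "g permutes {1..N}"
  shows "(\<Sum>w\<in>words n N. f (permute_word N g w)) = (\<Sum>w\<in>words n N. f w)"
proof (rule sum.reindex_bij_witness[where j = "permute_word N g" and i = "permute_word N (inv g)"])
  show "permute_word N g (permute_word N (inv g) w) = w" if "w \<in> words n N" for w
    using permute_word_inv[OF permutes_inv[OF assms]] that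
    by (simp add: permutes_inv_inv[OF assms] words_length)
qed (use assms in \<open>auto simp: permute_word_inv permute_word_in_words permutes_inv words_length\<close>)

section \<open>Equivariant maps and the general linear group\<close>

locale tensor_space = V: vector_space scl
  for scl :: "'k::field_char_0 \<Rightarrow> 'v::ab_group_add \<Rightarrow> 'v" +
  fixes n :: nat and e :: "nat \<Rightarrow> 'v" and N :: nat
  assumes basis: "ordered_basis scl n e"
begin

sublocale symmetric_rep "tscale :: 'k \<Rightarrow> _" "tensor_power n N"
  "basis_tensor ` words n N" "{1..N}" "place_act n N"
  by (rule symmetric_rep_tensor_power)

lemma equivariant_matrix_act: "equivariant (matrix_act n N A)"
  unfolding equivariant_def
proof (intro conjI allI impI)
  show "matrix_act n N A ` tensor_power n N \<subseteq> tensor_power n N"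
    by (auto simp: tensor_power_def matrix_act_def)
  fix g and x :: "'k tensor" assume g: "g permutes {1..N}"
  show "matrix_act n N A (place_act n N g x) = place_act n N g (matrix_act n N A x)"
  proof
    fix u
    show "matrix_act n N A (place_act n N g x) u = place_act n N g (matrix_act n N A x) u"
    proof (cases "u \<in> words n N")
      case True
      have "(\<Sum>w\<in>words n N. x (permute_word N g w) * (\<Prod>p<N. A (u ! p) (w ! p)))
        = (\<Sum>w\<in>words n N. x (permute_word N g w) *
            (\<Prod>p<N. A (permute_word N g u ! p) (permute_word N g w ! p)))"
        by (simp add: prod_permute_word[OF g])
      also have "\<dots> = (\<Sum>w\<in>words n N. x w * (\<Prod>p<N. A (permute_word N g u ! p) (w ! p)))"
        by (rule sum_permute_word[OF g])
      finally show ?thesis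
        using True by (simp add: matrix_act_def place_act_apply'[OF g] permute_word_in_words[OF g])
    qed (simp add: matrix_act_def place_act_apply'[OF g])
  qed
qed (rule matrix_act_linear)

lemma polynomial_family_in_subspace:
  fixes Q :: "nat list \<Rightarrow> 'k poly"
  assumes W: "subspace W" and Z: "infinite Z"
    and F: "\<And>z. z \<in> Z \<Longrightarrow> (\<lambda>u. if u \<in> words n N then poly (Q u) z else 0) \<in> W"
  shows "(\<lambda>u. if u \<in> words n N then coeff (Q u) k else 0) \<in> W"
proof -
  let ?v = "\<lambda>k u. if u \<in> words n N then coeff (Q u) k else 0"
  \<comment> \<open>The summand \<open>k\<close> only guarantees \<open>k \<le> D\<close>.\<close>
  define D where "D = k + (\<Sum>u\<in>words n N. degree (Q u))"
  have "degree (Q u) \<le> D" if "u \<in> words n N" for u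
    using member_le_sum[of u "words n N" "\<lambda>u. degree (Q u)"] that by (simp add: D_def finite_words)
  then have "(\<Sum>k\<le>D. tscale (z ^ k) (?v k)) = (\<lambda>u. if u \<in> words n N then poly (Q u) z else 0)" for z
    by (auto simp: fun_eq_iff sum_tensor_apply tscale_def poly_altdef coeff_eq_0 mult.commute
        intro!: sum.mono_neutral_right le_degree)
  then show ?thesis
    using F by (intro polynomial_coefficients_in_subspace[OF W Z, where v = ?v and D = D]) (simp_all add: D_def)
qed

text \<open>The map with matrix \<open>A\<close> plus \<open>c\<close> times the identity is
  invertible for infinitely many \<open>c\<close> and acts on \<open>x\<close> polynomially in
  \<open>c\<close>. So all coefficients of this polynomial lie in \<open>W\<close>, and the constant
  one is the action of \<open>A\<close>.\<close>

lemma matrix_act_in_GL_submodule: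
  assumes W: "GL_submodule scl n e N W" and x: "x \<in> W"
  shows "matrix_act n N A x \<in> W"
proof -
  have e: "inj_on e {1..n}" "V.independent (e ` {1..n})" "V.span (e ` {1..n}) = UNIV"
    using basis by (auto simp: ordered_basis_def)
  interpret V: finite_dimensional_vector_space scl "e ` {1..n}"
    by unfold_locales (use e in auto)
  interpret VV: vector_space_pair scl scl by unfold_locales
  obtain X where X: "Vector_Spaces.linear scl scl X"
    "\<forall>b\<in>e ` {1..n}. X b = (\<Sum>i=1..n. scl (A i (inv_into {1..n} e b)) (e i))"
    using VV.linear_independent_extend[OF e(2),
        of "\<lambda>b. \<Sum>i=1..n. scl (A i (inv_into {1..n} e b)) (e i)"] by blast
  have coord_sum: "coord scl n e (\<Sum>i=1..n. scl (a i) (e i)) j = a j" if "j \<in> {1..n}" for a j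
  proof -
    have "coord scl n e (\<Sum>i=1..n. scl (a i) (e i)) j = (\<Sum>i=1..n. a i * coord scl n e (e i) j)"
      using e by (simp add: coord_def V.representation_sum V.representation_scale)
    also have "\<dots> = (\<Sum>i=1..n. if i = j then a i else 0)"
      using that by (intro sum.cong) (auto simp: coord_basis[OF V.vector_space_axioms basis])
    finally show ?thesis using that by simp
  qed
  have shift: "coord scl n e (X (e j) + scl c (e j)) i = A i j + c * (if i = j then 1 else 0)"
    if "i \<in> {1..n}" "j \<in> {1..n}" for i j c
  proof -
    have "X (e j) = (\<Sum>i=1..n. scl (A i j) (e i))" using X(2) that e(1) by simp
    then have "coord scl n e (X (e j)) i = A i j" using coord_sum that by simp
    then show ?thesis
      using e coord_basis[OF V.vector_space_axioms basis, of j i] that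
      by (simp add: coord_def V.representation_add V.representation_scale)
  qed
  define Q where "Q u = (\<Sum>w\<in>words n N. [:x w:] *
    (\<Prod>p<N. [:A (u ! p) (w ! p), if u ! p = w ! p then 1 else 0:]))" for u
  have eq: "tensor_act scl n e N (\<lambda>v. X v + scl c v) x = (\<lambda>u. if u \<in> words n N then poly (Q u) c else 0)" for c
  proof
    fix u
    show "tensor_act scl n e N (\<lambda>v. X v + scl c v) x u = (if u \<in> words n N then poly (Q u) c else 0)"
      unfolding tensor_act_eq_matrix_act matrix_act_def Q_def
      by (auto simp: poly_sum poly_prod shift[OF words_nth words_nth] intro!: sum.cong prod.cong)
  qed
  let ?Z = "{c. bij (\<lambda>v. X v + scl c v)}"
  have Z: "infinite ?Z"
  proof
    assume "finite ?Z"
    then have "finite (?Z \<union> {c. \<not> bij (\<lambda>v. X v + scl c v)})"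
      using V.finite_singular_shifts[OF X(1)] by blast
    moreover have "?Z \<union> {c. \<not> bij (\<lambda>v. X v + scl c v)} = UNIV" by blast
    ultimately show False using infinite_UNIV_char_0 by metis
  qed
  have "tensor_act scl n e N (\<lambda>v. X v + scl c v) x \<in> W" if "c \<in> ?Z" for c
  proof -
    have "Vector_Spaces.linear scl scl (\<lambda>v. X v + scl c v)"
      by (rule V.linearI) (auto simp: V.linear_add[OF X(1)] V.linear_scale[OF X(1)]
          V.scale_right_distrib mult.commute)
    then show ?thesis using W x that by (auto simp: GL_submodule_def GL_def)
  qed
  then have "(\<lambda>u. if u \<in> words n N then coeff (Q u) 0 else 0) \<in> W"
    using W Z unfolding eq
    by (intro polynomial_family_in_subspace[of W ?Z]) (auto simp: GL_submodule_def)
  also have "(\<lambda>u. if u \<in> words n N then coeff (Q u) 0 else 0) = matrix_act n N A x"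
    by (auto simp: fun_eq_iff matrix_act_def Q_def poly_0_coeff_0[symmetric] poly_sum poly_prod)
  finally show ?thesis .
qed

text \<open>A matrix coefficient of an equivariant map depends only on the orbit of the pair of
  words under simultaneous permutation; these orbits are what the Kronecker substitution
  separates.\<close>

lemma equivariant_coefficients:
  assumes f: "equivariant f" and g: "g permutes {1..N}" and "u \<in> words n N" "w \<in> words n N"
  shows "f (basis_tensor (permute_word N g w)) (permute_word N g u) = f (basis_tensor w) u"
proof -
  let ?w = "permute_word N g w"
  have w: "?w \<in> words n N" using assms by (simp add: permute_word_in_words)
  have eq: "place_act n N g (basis_tensor ?w) = basis_tensor w"
  proof
    fix v
    have "permute_word N g v = ?w \<longleftrightarrow> v = w" if "v \<in> words n N"
      using that assms(4) permute_word_inv[OF g] by (metis (mono_tags, lifting) mem_Collect_eq words_def)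
    then show "place_act n N g (basis_tensor ?w) v = basis_tensor w v"
      using assms(4) by (auto simp: place_act_apply'[OF g] basis_tensor_def)
  qed
  have "f (basis_tensor w) = place_act n N g (f (basis_tensor ?w))"
    using equivariantD(3)[OF f g basis_tensor_in_tensor_power[OF w]] unfolding eq .
  then show ?thesis using assms(3) by (simp add: place_act_apply'[OF g])
qed

text \<open>
  The matrix \<open>A\<^sub>z\<close> with entries \<open>z ^ b ^ code (i, j)\<close>, for a base \<open>b > N\<close>, turns matrix
  coefficients of \<open>A\<^sub>z\<close> into distinct powers of \<open>z\<close> for distinct orbits of pairs of words
  (Kronecker substitution).  So the coefficients of the polynomial \<open>z \<mapsto> A\<^sub>z x\<close> span what all
  equivariant maps can reach from \<open>x\<close>.
\<close>

lemma GL_submodule_equivariant: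
  assumes W: "GL_submodule scl n e N W" and f: "equivariant f" and x: "x \<in> W"
  shows "f x \<in> W"
proof -
  have subW: "subspace W" and xT: "x \<in> tensor_power n N"
    using W x by (auto simp: GL_submodule_def)
  \<comment> \<open>Letters are at most \<open>n\<close>, so base \<open>Suc n\<close> makes
    \<open>code\<close> injective on pairs of letters.\<close>
  define code where "code i j = i * Suc n + j" for i j :: nat
  define ex where "ex u w = (\<Sum>p\<in>{1..N}. Suc N ^ code (u ! (p - 1)) (w ! (p - 1)))" for u w
  have code_inj: "i = i' \<and> j = j'" if "code i j = code i' j'" "j \<le> n" "j' \<le> n" for i j i' j'
  proof -
    have "(i * Suc n + j) div Suc n = i" "(i' * Suc n + j') div Suc n = i'"
      "(i * Suc n + j) mod Suc n = j" "(i' * Suc n + j') mod Suc n = j'"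
      using that by (auto simp: div_mult_self3 simp del: mult_Suc_right)
    then show ?thesis using that(1) unfolding code_def by metis
  qed
  have le: "w ! (p - 1) \<le> n" if "w \<in> words n N" "p \<in> {1..N}" for w p
    using words_nth[OF that(1), of "p - 1"] that(2) by auto
  have same: "f (basis_tensor w) u = f (basis_tensor w') u'"
    if words: "u \<in> words n N" "w \<in> words n N" "u' \<in> words n N" "w' \<in> words n N"
      and eq: "ex u w = ex u' w'" for u w u' w'
  proof -
    obtain g where g: "g permutes {1..N}"
      "\<forall>p\<in>{1..N}. code (u ! (p - 1)) (w ! (p - 1)) = code (u' ! (g p - 1)) (w' ! (g p - 1))"
      by (rule power_sum_eq_imp_permutes[of "{1..N}" "\<lambda>p. code (u ! (p - 1)) (w ! (p - 1))"
            "\<lambda>p. code (u' ! (p - 1)) (w' ! (p - 1))"]) (use eq in \<open>auto simp: ex_def\<close>)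
    have "u ! (p - 1) = u' ! (g p - 1) \<and> w ! (p - 1) = w' ! (g p - 1)" if "p \<in> {1..N}" for p
    proof -
      have "g p \<in> {1..N}" using that permutes_in_image[OF g(1)] by blast
      then show ?thesis using code_inj g(2) le words that by blast
    qed
    then have "u = permute_word N g u'" "w = permute_word N g w'"
      using words by (auto intro!: permute_word_eqI simp: words_def)
    then show ?thesis using equivariant_coefficients[OF f g(1) words(3,4)] by simp
  qed
  \<comment> \<open>The common matrix coefficient of \<open>f\<close> on all pairs of words with
    exponent \<open>k\<close>, read off at an arbitrary such pair; \<open>same\<close> makes the
    choice immaterial.\<close>
  define c where "c k = (let uw = (SOME uw. fst uw \<in> words n N \<and> snd uw \<in> words n N \<and> ex (fst uw) (snd uw) = k)
    in f (basis_tensor (snd uw)) (fst uw))" for k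
  have c: "f (basis_tensor w) u = c (ex u w)" if "u \<in> words n N" "w \<in> words n N" for u w
  proof -
    let ?P = "\<lambda>uw. fst uw \<in> words n N \<and> snd uw \<in> words n N \<and> ex (fst uw) (snd uw) = ex u w"
    have "?P (u, w)" using that by simp
    then have "?P (SOME uw. ?P uw)" by (rule someI)
    then show ?thesis unfolding c_def Let_def by (intro same that) simp_all
  qed
  define Q where "Q u = (\<Sum>w\<in>words n N. monom (x w) (ex u w))" for u
  have shift: "(\<Prod>p<N. g p) = (\<Prod>p\<in>{1..N}. g (p - 1))" for g :: "nat \<Rightarrow> 'k"
    by (rule prod.reindex_bij_witness[where j = Suc and i = "\<lambda>p. p - 1"]) auto
  have "(\<lambda>u. if u \<in> words n N then poly (Q u) z else 0)
      = matrix_act n N (\<lambda>i j. z ^ (Suc N ^ code i j)) x" for z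
    by (auto simp: fun_eq_iff matrix_act_def Q_def poly_sum poly_monom ex_def power_sum shift)
  then have fam: "(\<lambda>u. if u \<in> words n N then coeff (Q u) k else 0) \<in> W" for k
    using matrix_act_in_GL_submodule[OF W x] infinite_UNIV_char_0
    by (intro polynomial_family_in_subspace[OF subW, of UNIV]) auto
  let ?K = "(\<lambda>(u, w). ex u w) ` (words n N \<times> words n N)"
  have finK: "finite ?K" by (simp add: finite_words)
  have "f x = (\<Sum>k\<in>?K. tscale (c k) (\<lambda>u. if u \<in> words n N then coeff (Q u) k else 0))"
  proof
    fix u
    have "f x = (\<Sum>w\<in>words n N. tscale (x w) (f (basis_tensor w)))"
      by (subst tensor_expand[OF xT])
        (simp add: linear_sum[OF equivariantD(1)[OF f]] linear_scale[OF equivariantD(1)[OF f]])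
    then have fx: "f x u = (\<Sum>w\<in>words n N. x w * f (basis_tensor w) u)"
      by (simp add: sum_tensor_apply tscale_def)
    show "f x u = (\<Sum>k\<in>?K. tscale (c k) (\<lambda>u. if u \<in> words n N then coeff (Q u) k else 0)) u"
    proof (cases "u \<in> words n N")
      case True
      have "(\<Sum>k\<in>?K. c k * coeff (Q u) k)
          = (\<Sum>k\<in>?K. \<Sum>w\<in>words n N. if ex u w = k then c k * x w else 0)"
        by (simp add: Q_def coeff_sum sum_distrib_left if_distrib[of "\<lambda>a. _ * a"] cong: if_cong)
      also have "\<dots> = (\<Sum>w\<in>words n N. \<Sum>k\<in>?K. if ex u w = k then c k * x w else 0)"
        by (rule sum.swap)
      also have "\<dots> = (\<Sum>w\<in>words n N. x w * f (basis_tensor w) u)"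
      proof (rule sum.cong)
        fix w assume w: "w \<in> words n N"
        then have "ex u w \<in> ?K" using True by force
        then show "(\<Sum>k\<in>?K. if ex u w = k then c k * x w else 0) = x w * f (basis_tensor w) u"
          using c[OF True w] finK by (simp add: sum.delta')
      qed simp
      finally show ?thesis using True fx by (simp add: sum_tensor_apply tscale_def)
    next
      case False
      have "f x \<in> tensor_power n N" using equivariantD(2)[OF f xT] .
      then show ?thesis using False by (simp add: sum_tensor_apply tscale_def tensor_power_def)
    qed
  qed
  then show ?thesis using fam subW by (auto intro: subspace_sum subspace_scale)
qed

lemma stable_iff_GL_submodule:
  "stable W \<longleftrightarrow> GL_submodule scl n e N W"
proof
  assume "stable W"
  then show "GL_submodule scl n e N W"
    using equivariant_matrix_act by (auto simp: stable_def GL_submodule_def tensor_act_eq_matrix_act)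
next
  assume "GL_submodule scl n e N W"
  then show "stable W"
    using GL_submodule_equivariant by (auto simp: stable_def GL_submodule_def)
qed

lemma GL_irreducible_simple:
  assumes W: "simple W"
  shows "GL_irreducible scl n e N W"
  unfolding GL_irreducible_def stable_iff_GL_submodule[symmetric]
proof (intro conjI allI impI)
  show "stable W" "W \<noteq> {0}" using W by (auto simp: simple_def)
  fix W' assume W': "stable W' \<and> W' \<subseteq> W"
  show "W' = {0} \<or> W' = W"
  proof (cases "W' = {0}")
    case False
    have "0 \<in> W'" using W' by (simp add: stable_def subspace_0)
    then obtain x where x: "x \<in> W'" "x \<noteq> 0" using False by blast
    have "y \<in> W'" if "y \<in> W" for y
      using simpleD[OF W _ that x(2)] W' x(1) by (auto simp: stable_def)
    then show ?thesis using W' by blast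
  qed simp
qed

end

declare upt_Suc [simp del]

section \<open>Young symmetrizers\<close>

text \<open>A Young subgroup as the stabilizer of a labelling of the positions. Row groups, column
  groups and the row group of a rearranged tableau are obtained by varying the labels.\<close>

definition fiber_group :: "nat \<Rightarrow> (nat \<Rightarrow> 'c) \<Rightarrow> (nat \<Rightarrow> nat) set" where
  "fiber_group N f = {g. g permutes {1..N} \<and> f \<circ> g = f}"

definition perm_group :: "nat \<Rightarrow> (nat \<Rightarrow> nat) set \<Rightarrow> bool" where
  "perm_group N H \<longleftrightarrow> (\<forall>g\<in>H. g permutes {1..N}) \<and> id \<in> H \<and>
     (\<forall>g\<in>H. inv g \<in> H) \<and> (\<forall>g\<in>H. \<forall>h\<in>H. g \<circ> h \<in> H)"

lemma perm_groupD:
  assumes "perm_group N H"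
  shows "g \<in> H \<Longrightarrow> g permutes {1..N}" "id \<in> H" "g \<in> H \<Longrightarrow> inv g \<in> H"
    "g \<in> H \<Longrightarrow> h \<in> H \<Longrightarrow> g \<circ> h \<in> H"
  using assms by (auto simp: perm_group_def)

lemma fiber_perms: "perm_group N (fiber_group N f)"
proof -
  have "inv g \<in> fiber_group N f" if "g \<in> fiber_group N f" for g
  proof -
    have g: "g permutes {1..N}" "f \<circ> g = f" using that by (auto simp: fiber_group_def)
    have "f \<circ> inv g = f \<circ> g \<circ> inv g" using g(2) by simp
    also have "\<dots> = f" using g(1) by (simp add: comp_assoc permutes_inv_o)
    finally show ?thesis using g(1) by (simp add: fiber_group_def permutes_inv)
  qed
  moreover have "g \<circ> h \<in> fiber_group N f" if "g \<in> fiber_group N f" "h \<in> fiber_group N f" for g h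
    using that by (simp add: fiber_group_def permutes_compose comp_assoc[symmetric])
  ultimately show ?thesis by (auto simp: perm_group_def fiber_group_def permutes_id)
qed

lemma perm_group_finite: "perm_group N H \<Longrightarrow> finite H"
  by (rule finite_subset[of _ "{g. g permutes {1..N}}"])
    (auto simp: perm_group_def finite_permutations)

lemma fiber_groupI:
  assumes "g permutes {1..N}" "\<And>p. p \<in> {1..N} \<Longrightarrow> f (g p) = f p"
  shows "g \<in> fiber_group N f"
proof -
  have "f (g p) = f p" for p
    using assms by (cases "p \<in> {1..N}") (simp_all add: permutes_not_in del: atLeastAtMost_iff)
  then show ?thesis using assms(1) by (auto simp: fiber_group_def)
qed

lemma fiber_groupD: "g \<in> fiber_group N f \<Longrightarrow> g permutes {1..N}" "g \<in> fiber_group N f \<Longrightarrow> f (g p) = f p"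
  by (auto simp: fiber_group_def fun_eq_iff)

lemma transpose_in_fiber_group:
  "p \<in> {1..N} \<Longrightarrow> q \<in> {1..N} \<Longrightarrow> f p = f q \<Longrightarrow> transpose p q \<in> fiber_group N f"
  by (rule fiber_groupI) (auto intro: permutes_swap_id simp: transpose_def)

lemma sum_group_right:
  assumes H: "perm_group N H" and k: "k \<in> H"
  shows "(\<Sum>g\<in>H. f (g \<circ> k)) = (\<Sum>g\<in>H. f g)"
proof (rule sum.reindex_bij_witness[where j = "\<lambda>g. g \<circ> k" and i = "\<lambda>g. g \<circ> inv k"])
  note k' = perm_groupD(1)[OF H k]
  show "g \<circ> k \<circ> inv k = g" "g \<circ> inv k \<circ> k = g" for g
    by (simp_all add: comp_assoc permutes_inv_o[OF k'])
qed (use perm_groupD[OF H] k in auto)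

lemma sum_group_left:
  assumes H: "perm_group N H" and k: "k \<in> H"
  shows "(\<Sum>g\<in>H. f (k \<circ> g)) = (\<Sum>g\<in>H. f g)"
proof (rule sum.reindex_bij_witness[where j = "\<lambda>g. k \<circ> g" and i = "\<lambda>g. inv k \<circ> g"])
  note k' = perm_groupD(1)[OF H k]
  show "inv k \<circ> (k \<circ> g) = g" "k \<circ> (inv k \<circ> g) = g" for g
    by (simp_all add: comp_assoc[symmetric] permutes_inv_o[OF k'])
qed (use perm_groupD[OF H] k in auto)

section \<open>Basis tensors given by a letter at each position\<close>

definition word_tensor :: "nat \<Rightarrow> (nat \<Rightarrow> nat) \<Rightarrow> 'k::field tensor" where
  "word_tensor N f = basis_tensor (map f [1..<Suc N])"

lemma map_letters_in_words: "(\<And>p. p \<in> {1..N} \<Longrightarrow> f p \<in> {1..n}) \<Longrightarrow> map f [1..<Suc N] \<in> words n N"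
  by (auto simp: words_def)

lemma map_letters_nth: "p < N \<Longrightarrow> map f [1..<Suc N] ! p = f (Suc p)"
  by (simp add: plus_1_eq_Suc)

lemma map_letters_eq_iff: "map f [1..<Suc N] = map g [1..<Suc N] \<longleftrightarrow> (\<forall>p\<in>{1..N}. f p = g p)"
  by (auto simp: map_eq_conv)

lemma map_letters_surj:
  assumes "length w = N"
  shows "w = map (\<lambda>p. w ! (p - 1)) [1..<Suc N]"
  using assms by (intro nth_equalityI) (simp_all add: map_letters_nth)

lemma word_tensor_cong: "(\<And>p. p \<in> {1..N} \<Longrightarrow> f p = g p) \<Longrightarrow> word_tensor N f = word_tensor N g"
  unfolding word_tensor_def by (intro arg_cong[where f = basis_tensor]) (simp add: map_letters_eq_iff)

lemma word_tensor_in: "(\<And>p. p \<in> {1..N} \<Longrightarrow> f p \<in> {1..n}) \<Longrightarrow> word_tensor N f \<in> tensor_power n N"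
  unfolding word_tensor_def by (intro basis_tensor_in_tensor_power map_letters_in_words)

lemma place_act_word_tensor:
  assumes "g permutes {1..N}" "\<And>p. p \<in> {1..N} \<Longrightarrow> f p \<in> {1..n}"
  shows "place_act n N g (word_tensor N f) = word_tensor N (f \<circ> inv g)"
proof -
  have "place_act n N g (word_tensor N f)
      = basis_tensor (map (\<lambda>p. map f [1..<Suc N] ! (inv g p - 1)) [1..<Suc N])"
    unfolding place_act_def word_tensor_def
    by (rule lin_ext_basis_tensor) (rule map_letters_in_words[OF assms(2)])
  also have "map (\<lambda>p. map f [1..<Suc N] ! (inv g p - 1)) [1..<Suc N] = map (f \<circ> inv g) [1..<Suc N]"
    unfolding map_letters_eq_iff
  proof
    fix p assume "p \<in> {1..N}"
    then have "inv g p \<in> {1..N}" using permutes_in_image[OF permutes_inv[OF assms(1)]] by blast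
    then show "map f [1..<Suc N] ! (inv g p - 1) = (f \<circ> inv g) p"
      by (subst map_letters_nth) auto
  qed
  finally show ?thesis by (simp add: word_tensor_def)
qed

text \<open>Both nonvanishing proofs read off a coefficient at the word of column indices; by this
  lemma only permutations that preserve columns contribute to it.\<close>

lemma place_act_word_tensor_coeff:
  assumes "g permutes {1..N}" "\<And>p. p \<in> {1..N} \<Longrightarrow> f p \<in> {1..n}"
  shows "place_act n N g (word_tensor N f) (map f [1..<Suc N]) = (if g \<in> fiber_group N f then 1 else 0)"
proof -
  have "(\<forall>p\<in>{1..N}. f p = (f \<circ> inv g) p) \<longleftrightarrow> inv g \<in> fiber_group N f"
    by (metis comp_apply fiber_groupD(2) fiber_groupI[OF permutes_inv[OF assms(1)]])
  also have "\<dots> \<longleftrightarrow> g \<in> fiber_group N f"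
    using perm_groupD(3)[OF fiber_perms]
    by (metis assms(1) permutes_inv_inv)
  finally show ?thesis
    by (subst place_act_word_tensor[where f = f, OF assms])
      (auto simp: word_tensor_def basis_tensor_def atLeastLessThanSuc_atLeastAtMost)
qed

section \<open>Symmetrizers and antisymmetrizers of permutation groups\<close>

context tensor_space
begin

abbreviation "pact \<equiv> place_act n N"
abbreviation "TP \<equiv> tensor_power n N"
abbreviation "signed g \<equiv> tscale (of_int (sign g) :: 'k)"

definition symmetrizer :: "(nat \<Rightarrow> nat) set \<Rightarrow> 'k tensor \<Rightarrow> 'k tensor" where
  "symmetrizer H x = (\<Sum>g\<in>H. pact g x)"

definition antisym :: "(nat \<Rightarrow> nat) set \<Rightarrow> 'k tensor \<Rightarrow> 'k tensor" where
  "antisym H x = (\<Sum>g\<in>H. signed g (pact g x))"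

lemma symmetrizer_galg:
  "(\<And>g. g \<in> H \<Longrightarrow> g permutes {1..N}) \<Longrightarrow> symmetrizer H \<in> galg"
  unfolding symmetrizer_def[abs_def] by (intro galg_sum galg.act)

lemma antisym_galg:
  "(\<And>g. g \<in> H \<Longrightarrow> g permutes {1..N}) \<Longrightarrow> antisym H \<in> galg"
  unfolding antisym_def[abs_def] by (intro galg_sum galg.scale galg.act)

lemma symmetrizer_act:
  assumes H: "perm_group N H" and k: "k \<in> H" and x: "x \<in> TP"
  shows "symmetrizer H (pact k x) = symmetrizer H x"
proof -
  have "symmetrizer H (pact k x) = (\<Sum>g\<in>H. pact (g \<circ> k) x)"
    unfolding symmetrizer_def
    by (rule sum.cong) (simp_all add: act_comp x perm_groupD(1)[OF H] k)
  then show ?thesis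
    unfolding symmetrizer_def using sum_group_right[OF H k, of "\<lambda>g. pact g x"] by simp
qed

lemma sign_comp:
  assumes "g permutes {1..N}" "k permutes {1..N}"
  shows "sign (g \<circ> k) = sign g * sign k"
  using assms by (intro sign_compose) (auto intro: permutation_permutes[THEN iffD2])

lemma sign_cancel:
  assumes "g permutes {1..N}" "k permutes {1..N}"
  shows "of_int (sign k) * of_int (sign (g \<circ> k)) = (of_int (sign g) :: 'k)"
    "of_int (sign k) * of_int (sign (k \<circ> g)) = (of_int (sign g) :: 'k)"
  unfolding sign_comp[OF assms] sign_comp[OF assms(2,1)] of_int_mult[symmetric]
  by (simp_all add: mult.left_commute)

lemma antisym_act:
  assumes H: "perm_group N H" and k: "k \<in> H" and x: "x \<in> TP"
  shows "antisym H (pact k x) = signed k (antisym H x)"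
proof -
  have "antisym H (pact k x) =
      (\<Sum>g\<in>H. signed k (signed (g \<circ> k) (pact (g \<circ> k) x)))"
    unfolding antisym_def
  proof (rule sum.cong)
    fix g assume "g \<in> H"
    then have g: "g permutes {1..N}" "k permutes {1..N}" using perm_groupD(1)[OF H] k by auto
    show "signed g (pact g (pact k x)) =
      signed k (signed (g \<circ> k) (pact (g \<circ> k) x))"
      unfolding scale_scale sign_cancel[OF g] by (simp add: act_comp[OF g x])
  qed simp
  also have "\<dots> = signed k
      (\<Sum>g\<in>H. signed (g \<circ> k) (pact (g \<circ> k) x))"
    by (rule scale_sum_right[symmetric])
  also have "\<dots> = signed k (antisym H x)"
    unfolding antisym_def
    using sum_group_right[OF H k, of "\<lambda>g. signed g (pact g x)"] by simp
  finally show ?thesis .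
qed

lemma act_antisym:
  assumes H: "perm_group N H" and k: "k \<in> H" and x: "x \<in> TP"
  shows "pact k (antisym H x) = signed k (antisym H x)"
proof -
  have k': "k permutes {1..N}" using perm_groupD(1)[OF H k] .
  note lin = linear_sum[OF act_linear[OF k']] linear_scale[OF act_linear[OF k']]
  have "pact k (antisym H x) =
      (\<Sum>g\<in>H. signed k (signed (k \<circ> g) (pact (k \<circ> g) x)))"
    unfolding antisym_def lin
  proof (rule sum.cong)
    fix g assume "g \<in> H"
    then have g: "g permutes {1..N}" using perm_groupD(1)[OF H] by auto
    show "signed g (pact k (pact g x)) =
      signed k (signed (k \<circ> g) (pact (k \<circ> g) x))"
      unfolding scale_scale sign_cancel[OF g k'] by (simp add: act_comp[OF k' g x])
  qed simp
  also have "\<dots> = signed k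
      (\<Sum>g\<in>H. signed (k \<circ> g) (pact (k \<circ> g) x))"
    by (rule scale_sum_right[symmetric])
  also have "\<dots> = signed k (antisym H x)"
    unfolding antisym_def
    using sum_group_left[OF H k, of "\<lambda>g. signed g (pact g x)"] by simp
  finally show ?thesis .
qed

lemma eq_neg_imp_zero:
  fixes x :: "'k tensor"
  assumes "x = tscale (- 1) x"
  shows "x = 0"
proof
  fix w
  have "x w = - x w" using fun_cong[OF assms, of w] by (simp add: tscale_def)
  then have "2 * x w = 0" by (metis add.right_inverse mult_2)
  then show "x w = 0 w" by simp
qed

text \<open>The antisymmetrization equals its own negative. Typical use: a word with a repeated
  letter in some row is fixed by the corresponding transposition.\<close>

lemma antisym_transpose:
  assumes H: "perm_group N H" "transpose p q \<in> H" "p \<noteq> q"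
    and x: "x \<in> TP" "pact (transpose p q) x = x"
  shows "antisym H x = 0"
  using antisym_act[OF H(1,2) x(1)] x(2) H(3) by (intro eq_neg_imp_zero) (simp add: sign_swap_id)

end

section \<open>Combinatorics of bijective tableaux\<close>

lemma extend_to_permutation:
  assumes "finite A" "\<And>x. x \<in> A \<Longrightarrow> t x \<in> A" "\<And>x y. x \<in> A \<Longrightarrow> y \<in> A \<Longrightarrow> t x = t y \<Longrightarrow> x = y"
  obtains h where "h permutes A" "\<And>x. x \<in> A \<Longrightarrow> h x = t x"
proof (rule that)
  have inj: "inj_on t A" by (rule inj_onI) (rule assms(3))
  moreover have "t ` A = A" by (rule endo_inj_surj[OF assms(1) _ inj]) (use assms(2) in blast)
  ultimately have "bij_betw t A A" by (simp add: bij_betw_def)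
  then show "restrict_id t A permutes A" by (rule permutes_restrict_id)
qed simp

text \<open>A bijective tableau recorded through its inverse: each position knows its row and
  column. In this form a rearrangement inside the columns changes only \<open>row\<close>.\<close>

locale young_tableau =
  fixes N :: nat and ga :: "nat list" and row col :: "nat \<Rightarrow> nat"
  assumes box: "bij_betw (\<lambda>p. (row p, col p)) {1..N} (diagram ga)"
begin

lemma box_in: "p \<in> {1..N} \<Longrightarrow> (row p, col p) \<in> diagram ga"
  using box by (auto simp: bij_betw_def)

lemma box_inj: "p \<in> {1..N} \<Longrightarrow> q \<in> {1..N} \<Longrightarrow> row p = row q \<Longrightarrow> col p = col q \<Longrightarrow> p = q"
  using inj_onD[OF bij_betw_imp_inj_on[OF box], of p q] by simp

lemma box_surj: "(i, j) \<in> diagram ga \<Longrightarrow> \<exists>p\<in>{1..N}. row p = i \<and> col p = j"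
  unfolding bij_betw_imp_surj_on[OF box, symmetric] by blast

lemma diagram_iff: "(i, j) \<in> diagram ga \<longleftrightarrow> 1 \<le> i \<and> i \<le> length ga \<and> 1 \<le> j \<and> j \<le> part ga i"
  by (simp add: diagram_def)

lemma row_col_fiber_group:
  assumes "g \<in> fiber_group N row" "g \<in> fiber_group N col"
  shows "g = id"
proof
  fix p
  note g = fiber_groupD[OF assms(1)] fiber_groupD(2)[OF assms(2)]
  show "g p = id p"
  proof (cases "p \<in> {1..N}")
    case True
    then have "g p \<in> {1..N}" using permutes_in_image[OF g(1)] by blast
    then show ?thesis using box_inj[of "g p" p] True g(2,3) by simp
  qed (simp add: permutes_not_in[OF g(1)])
qed

lemma card_row_col_le: "card {p \<in> {1..N}. row p = i \<and> col p \<le> J}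
    = (if i \<in> {1..length ga} then min (part ga i) J else 0)"
proof (cases "i \<in> {1..length ga}")
  case True
  have "bij_betw col {p \<in> {1..N}. row p = i \<and> col p \<le> J} {1..min (part ga i) J}"
    unfolding bij_betw_def
  proof
    show "inj_on col {p \<in> {1..N}. row p = i \<and> col p \<le> J}"
      by (rule inj_onI) (use box_inj in force)
    show "col ` {p \<in> {1..N}. row p = i \<and> col p \<le> J} = {1..min (part ga i) J}"
    proof
      show "col ` {p \<in> {1..N}. row p = i \<and> col p \<le> J} \<subseteq> {1..min (part ga i) J}"
        using box_in by (auto simp: diagram_iff)
      show "{1..min (part ga i) J} \<subseteq> col ` {p \<in> {1..N}. row p = i \<and> col p \<le> J}"
      proof
        fix j assume j: "j \<in> {1..min (part ga i) J}"
        then have "(i, j) \<in> diagram ga" using True by (simp add: diagram_iff)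
        then show "j \<in> col ` {p \<in> {1..N}. row p = i \<and> col p \<le> J}"
          using box_surj j by force
      qed
    qed
  qed
  from bij_betw_same_card[OF this] show ?thesis using True by simp
next
  case False
  then have "{p \<in> {1..N}. row p = i \<and> col p \<le> J} = {}" using box_in by (force simp: diagram_iff)
  then show ?thesis using False by (simp only: card.empty if_False)
qed

text \<open>
  Counting letters \<open>\<le> J\<close> row by row: row \<open>i\<close> contains at most \<open>min \<gamma>\<^sub>i J\<close> of them, and these
  bounds add up to the total number, so all of them are equalities.
\<close>

lemma row_injective_filling_bound:
  assumes s: "s permutes {1..N}"
    and inj: "\<And>p q. p \<in> {1..N} \<Longrightarrow> q \<in> {1..N} \<Longrightarrow> row p = row q \<Longrightarrow> col (s p) = col (s q) \<Longrightarrow> p = q"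
    and p: "p \<in> {1..N}"
  shows "(row p, col (s p)) \<in> diagram ga"
proof -
  let ?R = "{1..length ga}"
  have s_in: "s p \<in> {1..N}" if "p \<in> {1..N}" for p using that permutes_in_image[OF s] by blast
  have row_in: "row p \<in> ?R" if "p \<in> {1..N}" for p using box_in[OF that] by (simp add: diagram_iff)
  have col_pos: "1 \<le> col p" if "p \<in> {1..N}" for p using box_in[OF that] by (simp add: diagram_iff)
  have split: "card {p \<in> {1..N}. P p} = (\<Sum>i\<in>?R. card {p \<in> {1..N}. row p = i \<and> P p})" for P
  proof -
    have "card (\<Union>i\<in>?R. {p \<in> {1..N}. row p = i \<and> P p}) = (\<Sum>i\<in>?R. card {p \<in> {1..N}. row p = i \<and> P p})"
      by (rule card_UN_disjoint) auto
    also have "(\<Union>i\<in>?R. {p \<in> {1..N}. row p = i \<and> P p}) = {p \<in> {1..N}. P p}" using row_in by blast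
    finally show ?thesis .
  qed
  define J where "J = part ga (row p)"
  have row_card: "card {q \<in> {1..N}. row q = i} = part ga i" if "i \<in> ?R" for i
  proof -
    have "{q \<in> {1..N}. row q = i} = {q \<in> {1..N}. row q = i \<and> col q \<le> part ga i}"
      using box_in by (auto simp: diagram_iff)
    then show ?thesis using card_row_col_le[of i "part ga i"] that by simp
  qed
  have le: "card {q \<in> {1..N}. row q = i \<and> col (s q) \<le> J} \<le> card {q \<in> {1..N}. row q = i \<and> col q \<le> J}"
    if i: "i \<in> ?R" for i
  proof -
    let ?A = "{q \<in> {1..N}. row q = i \<and> col (s q) \<le> J}"
    have "inj_on (\<lambda>q. col (s q)) ?A"
    proof (rule inj_onI)
      fix x y assume "x \<in> ?A" "y \<in> ?A" "col (s x) = col (s y)"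
      then show "x = y" using inj[of x y] by simp
    qed
    moreover have "(\<lambda>q. col (s q)) ` ?A \<subseteq> {1..J}"
    proof
      fix j assume "j \<in> (\<lambda>q. col (s q)) ` ?A"
      then obtain q where "q \<in> {1..N}" "j = col (s q)" "col (s q) \<le> J" by blast
      then show "j \<in> {1..J}" using col_pos[OF s_in] by simp
    qed
    ultimately have "card ?A \<le> J" using card_inj_on_le[of _ ?A "{1..J}"] by simp
    moreover have "card ?A \<le> card {q \<in> {1..N}. row q = i}" by (rule card_mono) auto
    ultimately show ?thesis using card_row_col_le[of i J] row_card[OF i] i by simp
  qed
  have "bij_betw s {q \<in> {1..N}. col (s q) \<le> J} {q \<in> {1..N}. col q \<le> J}"
    unfolding bij_betw_def
  proof
    show "inj_on s {q \<in> {1..N}. col (s q) \<le> J}" using permutes_inj[OF s] by (rule inj_on_subset) simp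
    show "s ` {q \<in> {1..N}. col (s q) \<le> J} = {q \<in> {1..N}. col q \<le> J}"
    proof
      show "{q \<in> {1..N}. col q \<le> J} \<subseteq> s ` {q \<in> {1..N}. col (s q) \<le> J}"
      proof
        fix q assume q: "q \<in> {q \<in> {1..N}. col q \<le> J}"
        then have "inv s q \<in> {1..N}" using permutes_in_image[OF permutes_inv[OF s]] by blast
        then show "q \<in> s ` {q \<in> {1..N}. col (s q) \<le> J}"
          using q by (intro image_eqI[of _ _ "inv s q"]) (simp_all add: permutes_inverses[OF s])
      qed
      show "s ` {q \<in> {1..N}. col (s q) \<le> J} \<subseteq> {q \<in> {1..N}. col q \<le> J}"
        using s_in by (intro image_subsetI) simp
    qed
  qed
  then have "card {q \<in> {1..N}. col (s q) \<le> J} = card {q \<in> {1..N}. col q \<le> J}"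
    by (rule bij_betw_same_card)
  then have "(\<Sum>i\<in>?R. card {q \<in> {1..N}. row q = i \<and> col (s q) \<le> J})
      = (\<Sum>i\<in>?R. card {q \<in> {1..N}. row q = i \<and> col q \<le> J})"
    by (simp only: split[of "\<lambda>q. col (s q) \<le> J"] split[of "\<lambda>q. col q \<le> J"])
  then have "card {q \<in> {1..N}. row q = row p \<and> col (s q) \<le> J}
      = card {q \<in> {1..N}. row q = row p \<and> col q \<le> J}"
    by (rule sum_mono_inv) (use le row_in[OF p] in auto)
  also have "\<dots> = card {q \<in> {1..N}. row q = row p}"
    using card_row_col_le[of "row p" J] row_card[OF row_in[OF p]] row_in[OF p] by (simp add: J_def)
  finally have "{q \<in> {1..N}. row q = row p \<and> col (s q) \<le> J} = {q \<in> {1..N}. row q = row p}"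
    by (intro card_subset_eq) auto
  then have "col (s p) \<le> J" using p by blast
  then show ?thesis using row_in[OF p] col_pos[OF s_in[OF p]] by (simp add: diagram_iff J_def)
qed

text \<open>\<open>h\<close> moves \<open>p\<close> inside its row to the column of
  \<open>s p\<close>. That box exists by the counting bound, and \<open>h\<close> is injective
  because \<open>s\<close> has no collisions. The remaining factor \<open>s \<circ> inv h\<close>
  preserves columns.\<close>

lemma permutation_factorization:
  assumes s: "s permutes {1..N}"
    and inj: "\<And>p q. p \<in> {1..N} \<Longrightarrow> q \<in> {1..N} \<Longrightarrow> row p = row q \<Longrightarrow> col (s p) = col (s q) \<Longrightarrow> p = q"
  obtains g h where "g \<in> fiber_group N col" "h \<in> fiber_group N row" "s = g \<circ> h"
proof -
  have "\<forall>p\<in>{1..N}. \<exists>q\<in>{1..N}. row q = row p \<and> col q = col (s p)"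
    using row_injective_filling_bound[OF s inj] box_surj by blast
  then obtain t where t: "\<And>p. p \<in> {1..N} \<Longrightarrow> t p \<in> {1..N} \<and> row (t p) = row p \<and> col (t p) = col (s p)"
    by metis
  have t_inj: "p = q" if "p \<in> {1..N}" "q \<in> {1..N}" "t p = t q" for p q
    using inj[OF that(1,2)] t[OF that(1)] t[OF that(2)] that(3) by metis
  obtain h where perm: "h permutes {1..N}" and h: "\<And>p. p \<in> {1..N} \<Longrightarrow> h p = t p"
    using extend_to_permutation[of "{1..N}" t, OF finite_atLeastAtMost _ t_inj] t by blast
  have "h \<in> fiber_group N row" by (rule fiber_groupI[OF perm]) (simp add: h t)
  moreover have "s \<circ> inv h \<in> fiber_group N col"
  proof (rule fiber_groupI)
    show "s \<circ> inv h permutes {1..N}" using perm s by (simp add: permutes_compose permutes_inv)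
    fix p assume p: "p \<in> {1..N}"
    then have "inv h p \<in> {1..N}" using permutes_in_image[OF permutes_inv[OF perm]] by blast
    then have "col (h (inv h p)) = col (s (inv h p))" using t by (simp only: h)
    then show "col ((s \<circ> inv h) p) = col p" by (simp add: permutes_inverses[OF perm])
  qed
  moreover have "s = (s \<circ> inv h) \<circ> h" by (simp add: comp_assoc permutes_inv_o[OF perm])
  ultimately show thesis using that by blast
qed

text \<open>The alternative behind both scalar properties below: a collision makes the term vanish
  through a transposition, a product contributes only a sign.\<close>

lemma permutation_dichotomy:
  assumes s: "s permutes {1..N}"
  obtains (collision) p q where "p \<in> {1..N}" "q \<in> {1..N}" "p \<noteq> q" "row p = row q" "col (s p) = col (s q)"
  | (product) g h where "g \<in> fiber_group N col" "h \<in> fiber_group N row" "s = g \<circ> h"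
  using permutation_factorization[OF s] by metis

end

section \<open>Simplicity and the highest weight vector for one tableau\<close>

locale tensor_young = tensor_space scl n e N + young_tableau N ga row col
  for scl :: "'k::field_char_0 \<Rightarrow> 'v::ab_group_add \<Rightarrow> 'v" and n e N ga row col +
  assumes col_le: "\<And>p. p \<in> {1..N} \<Longrightarrow> col p \<le> n"
begin

abbreviation "symm \<equiv> symmetrizer (fiber_group N col)"
abbreviation "alt \<equiv> antisym (fiber_group N row)"
text \<open>The letter at each position is its column index. Thus \<open>alt col_tensor\<close> is
  the vector \<open>v\<close> of the overview and \<open>symm (alt col_tensor)\<close> is
  \<open>h\<close>.\<close>

abbreviation col_tensor :: "'k tensor" where "col_tensor \<equiv> word_tensor N col"

lemma col_in: "p \<in> {1..N} \<Longrightarrow> col p \<in> {1..n}"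
  using box_in[of p] col_le[of p] by (simp add: diagram_iff)

lemma col_tensor_in: "col_tensor \<in> TP"
  by (rule word_tensor_in[where f = col, OF col_in])

lemma symm_galg: "symm \<in> galg"
  by (rule symmetrizer_galg) (auto dest: fiber_groupD)

lemma alt_galg: "alt \<in> galg"
  by (rule antisym_galg) (auto dest: fiber_groupD)

lemma act_col_tensor: "g \<in> fiber_group N col \<Longrightarrow> pact g col_tensor = col_tensor"
proof -
  assume g: "g \<in> fiber_group N col"
  have "inv g \<in> fiber_group N col" using perm_groupD(3)[OF fiber_perms g] .
  then have "col \<circ> inv g = col" by (simp add: fiber_group_def)
  then show ?thesis using place_act_word_tensor[where f = col, OF fiber_groupD(1)[OF g] col_in] by simp
qed

lemma transpose_conj:
  assumes "s permutes {1..N}" shows "s \<circ> transpose p q = transpose (s p) (s q) \<circ> s"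
  using permutes_bij[OF assms] by (simp add: transpose_comp_eq bij_is_inj inj_eq fun_eq_iff transpose_def)

text \<open>In a collision, \<open>s\<close> conjugates a transposition within a row into one within
  a column: \<open>alt\<close> contributes a sign, \<open>symm\<close> none, so the value is its own
  negative. For \<open>s = g \<circ> h\<close>, \<open>symm\<close> absorbs \<open>g\<close> and
  \<open>alt\<close> turns \<open>h\<close> into its sign.\<close>

lemma symm_alt_von_neumann:
  assumes s: "s permutes {1..N}"
  shows "\<exists>c. \<forall>x\<in>TP. symm (pact s (alt x)) = tscale c (symm (alt x))"
  using s
proof (cases rule: permutation_dichotomy)
  case (collision p q)
  have s_in: "s p \<in> {1..N}" "s q \<in> {1..N}" using collision permutes_in_image[OF s] by blast+
  let ?t = "transpose p q" and ?t' = "transpose (s p) (s q)"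
  have t: "?t \<in> fiber_group N row" "?t' \<in> fiber_group N col"
    using collision s_in by (auto intro: transpose_in_fiber_group)
  note perm = fiber_groupD(1)[OF t(1)] fiber_groupD(1)[OF t(2)]
  have "symm (pact s (alt x)) = 0" if x: "x \<in> TP" for x
  proof (rule eq_neg_imp_zero)
    have bx: "alt x \<in> TP" using x galg_into[OF alt_galg] by simp
    have "pact ?t (alt x) = tscale (- 1) (alt x)"
      using act_antisym[OF fiber_perms t(1) x] collision(3)
      by (simp add: sign_swap_id)
    then have "tscale (- 1) (symm (pact s (alt x))) = symm (pact s (pact ?t (alt x)))"
      using linear_scale[OF act_linear[OF s]] linear_scale[OF galg_linear[OF symm_galg]]
      by (simp only:)
    also have "pact s (pact ?t (alt x)) = pact ?t' (pact s (alt x))"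
      using act_comp[OF s perm(1) bx] act_comp[OF perm(2) s bx] transpose_conj[OF s, of p q] by simp
    also have "symm \<dots> = symm (pact s (alt x))"
      by (rule symmetrizer_act[OF fiber_perms t(2) act_into[OF s bx]])
    finally show "symm (pact s (alt x)) = tscale (- 1) (symm (pact s (alt x)))" ..
  qed
  then show ?thesis by (intro exI[of _ 0]) (simp add: scale_zero_left)
next
  case (product g h)
  note perm = fiber_groupD(1)[OF product(1)] fiber_groupD(1)[OF product(2)]
  have "symm (pact s (alt x)) = signed h (symm (alt x))"
    if x: "x \<in> TP" for x
  proof -
    have bx: "alt x \<in> TP" using x galg_into[OF alt_galg] by simp
    have "symm (pact s (alt x)) = symm (pact h (alt x))"
      unfolding product(3) act_comp[OF perm bx]
      by (rule symmetrizer_act[OF fiber_perms product(1) act_into[OF perm(2) bx]])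
    then show ?thesis
      unfolding act_antisym[OF fiber_perms product(2) x]
      by (simp only: linear_scale[OF galg_linear[OF symm_galg]])
  qed
  then show ?thesis by blast
qed

lemma alt_col_tensor_james:
  assumes s: "s permutes {1..N}"
  shows "\<exists>c. alt (pact s col_tensor) = tscale c (alt col_tensor)"
  \<comment> \<open>The letter of \<open>pact s col_tensor\<close> at position \<open>p\<close> is
    \<open>col (inv s p)\<close>, so the dichotomy is needed for \<open>inv s\<close>.\<close>
  using permutes_inv[OF s]
proof (cases rule: permutation_dichotomy)
  case (collision p q)
  have s_in: "inv s p \<in> {1..N}" "inv s q \<in> {1..N}"
    using collision permutes_in_image[OF permutes_inv[OF s]] by blast+
  let ?t = "transpose p q" and ?t' = "transpose (inv s p) (inv s q)"
  have t: "?t \<in> fiber_group N row" "?t' \<in> fiber_group N col"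
    using collision s_in by (auto intro: transpose_in_fiber_group)
  note perm = fiber_groupD(1)[OF t(1)] fiber_groupD(1)[OF t(2)]
  have "pact ?t (pact s col_tensor) = pact s (pact ?t' col_tensor)"
    using act_comp[OF s perm(2) col_tensor_in] act_comp[OF perm(1) s col_tensor_in]
      transpose_conj[OF s, of "inv s p" "inv s q"] by (simp add: permutes_inverses[OF s])
  then have "alt (pact s col_tensor) = 0"
    unfolding act_col_tensor[OF t(2)]
    by (intro antisym_transpose[OF fiber_perms t(1) collision(3)]
        act_into[OF s col_tensor_in])
  then show ?thesis by (intro exI[of _ 0]) (simp add: scale_zero_left)
next
  case (product g h)
  have inv: "inv g \<in> fiber_group N col" "inv h \<in> fiber_group N row"
    using product perm_groupD(3)[OF fiber_perms] by auto
  note perm = fiber_groupD(1)[OF product(1)] fiber_groupD(1)[OF product(2)]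
  have "s = inv (g \<circ> h)" using product(3) permutes_inv_inv[OF s] by simp
  then have "s = inv h \<circ> inv g" using perm by (simp add: o_inv_distrib permutes_bij)
  then have "pact s col_tensor = pact (inv h) (pact (inv g) col_tensor)"
    using act_comp[OF permutes_inv[OF perm(2)] permutes_inv[OF perm(1)] col_tensor_in] by simp
  then show ?thesis
    unfolding act_col_tensor[OF inv(1)]
    using antisym_act[OF fiber_perms inv(2) col_tensor_in] by auto
qed

text \<open>At the word of column indices, each \<open>g\<close> of the column group leaves only the
  term \<open>h = id\<close>, because row and column group intersect trivially. The coefficient is
  the order of the column group.\<close>

lemma symm_alt_col_tensor_nonzero: "symm (alt col_tensor) \<noteq> 0"
proof -
  let ?C = "fiber_group N col" and ?R = "fiber_group N row" and ?w = "map col [1..<Suc N]"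
  have fin: "finite ?C" "finite ?R"
    using perm_group_finite[OF fiber_perms] by blast+
  have "symm (alt col_tensor) ?w = (\<Sum>g\<in>?C. \<Sum>h\<in>?R. if h = id then 1 else 0)"
    unfolding symmetrizer_def sum_tensor_apply
  proof (rule sum.cong)
    fix g assume g: "g \<in> ?C"
    note g' = fiber_groupD(1)[OF g]
    have "pact g (alt col_tensor) =
        (\<Sum>h\<in>?R. signed h (pact (g \<circ> h) col_tensor))"
      unfolding antisym_def linear_sum[OF act_linear[OF g']] linear_scale[OF act_linear[OF g']]
      by (rule sum.cong) (auto simp: act_comp[OF g' _ col_tensor_in] dest: fiber_groupD(1))
    moreover have "(\<Sum>h\<in>?R. signed h (pact (g \<circ> h) col_tensor)) ?w
        = (\<Sum>h\<in>?R. if h = id then 1 else 0)"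
      unfolding sum_tensor_apply
    proof (rule sum.cong)
      fix h assume h: "h \<in> ?R"
      note h' = fiber_groupD(1)[OF h]
      have "g \<circ> h \<in> ?C \<longleftrightarrow> h = id"
      proof
        assume "g \<circ> h \<in> ?C"
        then have "inv g \<circ> (g \<circ> h) \<in> ?C"
          using perm_groupD(3,4)[OF fiber_perms] g by blast
        then have "h \<in> ?C" by (simp add: comp_assoc[symmetric] permutes_inv_o[OF g'])
        then show "h = id" using h row_col_fiber_group by blast
      qed (use g in simp)
      then have "pact (g \<circ> h) col_tensor ?w = (if h = id then 1 else 0)"
        using place_act_word_tensor_coeff[where f = col, OF permutes_compose[OF h' g'] col_in] by simp
      then show "signed h (pact (g \<circ> h) col_tensor) ?w = (if h = id then 1 else 0)"
        by (simp add: tscale_def)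
    qed simp
    ultimately show "pact g (alt col_tensor) ?w = (\<Sum>h\<in>?R. if h = id then 1 else 0)" by (simp only:)
  qed simp
  also have "\<dots> = of_nat (card ?C)"
    using fin perm_groupD(2)[OF fiber_perms, of N row] by (simp add: sum.delta)
  also have "\<dots> \<noteq> 0"
    using fin(1) perm_groupD(2)[OF fiber_perms, of N col] by auto
  finally show ?thesis by auto
qed

lemma simple_symm_alt: "simple ((\<lambda>x. symm (alt x)) ` TP)"
  by (rule simple_young[OF symm_galg alt_galg symm_alt_von_neumann
        col_tensor_in symm_alt_col_tensor_nonzero])

lemma alt_col_tensor_return: "\<exists>r\<in>galg. r (symm (alt col_tensor)) = alt col_tensor"
  by (rule orbit_return[OF symm_galg alt_galg col_tensor_in alt_col_tensor_james
        symm_alt_col_tensor_nonzero])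

text \<open>Induction over columns from the left: if \<open>f p < col p\<close>, the box of the same
  row in column \<open>f p\<close> already carries the letter \<open>f p\<close>, a
  repetition.\<close>

lemma lower_filling_eq_col:
  assumes le: "\<And>p. p \<in> {1..N} \<Longrightarrow> f p \<le> col p" and pos: "\<And>p. p \<in> {1..N} \<Longrightarrow> 1 \<le> f p"
    and inj: "\<And>p q. p \<in> {1..N} \<Longrightarrow> q \<in> {1..N} \<Longrightarrow> row p = row q \<Longrightarrow> f p = f q \<Longrightarrow> p = q"
    and p: "p \<in> {1..N}"
  shows "f p = col p"
  using p
proof (induction "col p" arbitrary: p rule: less_induct)
  case less
  show ?case
  proof (rule ccontr)
    assume "f p \<noteq> col p"
    then have lt: "f p < col p" using le[OF less.prems] by simp
    have "(row p, f p) \<in> diagram ga"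
      using box_in[OF less.prems] lt pos[OF less.prems] by (simp add: diagram_iff)
    then obtain q where q: "q \<in> {1..N}" "row q = row p" "col q = f p" using box_surj by blast
    then have "f q = col q" using less.hyps lt by metis
    then have "q = p" using inj q less.prems by metis
    then show False using q lt by simp
  qed
qed

lemma unipotent_coord:
  assumes u: "u \<in> unipotent_group scl n e" and i: "i \<in> {1..n}" and j: "j \<in> {1..n}" "i \<le> j"
  shows "coord scl n e (u (e i)) j = (if i = j then 1 else 0)"
proof -
  have e: "inj_on e {1..n}" "V.independent (e ` {1..n})" "V.span (e ` {1..n}) = UNIV"
    using basis by (auto simp: ordered_basis_def)
  have d: "u (e i) - e i \<in> V.span (e ` {1..<i})" using u i by (auto simp: unipotent_group_def)
  have sub: "e ` {1..<i} \<subseteq> e ` {1..n}" using i by auto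
  have "coord scl n e (u (e i) - e i) j = V.representation (e ` {1..<i}) (u (e i) - e i) (e j)"
    unfolding coord_def V.representation_extend[OF e(2) d sub] ..
  also have "\<dots> = 0"
  proof (rule ccontr)
    assume "V.representation (e ` {1..<i}) (u (e i) - e i) (e j) \<noteq> 0"
    then obtain k where k: "k \<in> {1..<i}" "e j = e k" using V.representation_ne_zero by blast
    then have "j = k" using inj_onD[OF e(1) k(2) j(1)] i by simp
    then show False using k(1) j(2) by simp
  qed
  finally have "coord scl n e (u (e i)) j = coord scl n e (e i) j"
    using e by (simp add: coord_def V.representation_diff)
  then show ?thesis using coord_basis[OF V.vector_space_axioms basis i j(1)] by simp
qed

text \<open>\<open>alt\<close> commutes with \<open>u\<close>, so it suffices to antisymmetrize the
  expansion of the image of \<open>col_tensor\<close>. By triangularity a word with nonzero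
  coefficient has each letter at most its column. Unless it is the original word, it then repeats a
  letter in some row and \<open>alt\<close> kills it.\<close>

lemma alt_col_tensor_unipotent:
  assumes u: "u \<in> unipotent_group scl n e"
  shows "tensor_act scl n e N u (alt col_tensor) = alt col_tensor"
proof -
  define A where "A i j = coord scl n e (u (e j)) i" for i j
  have act: "tensor_act scl n e N u = matrix_act n N A"
    by (simp add: tensor_act_eq_matrix_act A_def[abs_def])
  let ?w = "map col [1..<Suc N]"
  let ?c = "\<lambda>w. \<Prod>p<N. A (w ! p) (?w ! p)"
  have w: "?w \<in> words n N" by (rule map_letters_in_words[where f = col, OF col_in])
  have expand: "matrix_act n N A col_tensor = (\<Sum>w\<in>words n N. tscale (?c w) (basis_tensor w))"
  proof
    fix v
    have "matrix_act n N A col_tensor v = (if v \<in> words n N then ?c v else 0)"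
      unfolding matrix_act_def word_tensor_def basis_tensor_def
      using w by (simp add: finite_words if_distrib[of "\<lambda>x. x * _"] cong: if_cong)
    also have "\<dots> = (\<Sum>w\<in>words n N. tscale (?c w) (basis_tensor w)) v"
      by (simp add: sum_tensor_apply tscale_def basis_tensor_def finite_words
          if_distrib[of "\<lambda>x. _ * x"] cong: if_cong)
    finally show "matrix_act n N A col_tensor v = (\<Sum>w\<in>words n N. tscale (?c w) (basis_tensor w)) v" .
  qed
  have summand: "tscale (?c w) (alt (basis_tensor w)) = (if w = ?w then alt col_tensor else 0)"
    if w': "w \<in> words n N" for w
  proof (cases "w = ?w")
    case True
    have "?c w = 1"
    proof (rule prod.neutral, rule ballI)
      fix p assume "p \<in> {..<N}"
      then have "col (Suc p) \<in> {1..n}" by (intro col_in) simp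
      then show "A (w ! p) (?w ! p) = 1"
        using \<open>p \<in> {..<N}\<close> unipotent_coord[OF u] by (simp add: True A_def map_letters_nth plus_1_eq_Suc)
    qed
    then show ?thesis using True by (simp add: word_tensor_def)
  next
    case False
    define f where "f p = w ! (p - 1)" for p
    have wf: "w = map f [1..<Suc N]"
      unfolding f_def by (rule map_letters_surj[OF words_length[OF w']])
    have f_in: "f p \<in> {1..n}" if "p \<in> {1..N}" for p
      unfolding f_def using that by (intro words_nth[OF w']) auto
    show ?thesis
    proof (cases "?c w = 0")
      case c: False
      have le: "f p \<le> col p" if p: "p \<in> {1..N}" for p
      proof (rule ccontr)
        assume "\<not> f p \<le> col p"
        then have "A (f p) (col p) = 0"
          unfolding A_def using unipotent_coord[OF u col_in[OF p] f_in[OF p]] by simp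
        moreover have "?w ! (p - 1) = col p" by (subst map_letters_nth) (use p in auto)
        ultimately have "A (w ! (p - 1)) (?w ! (p - 1)) = 0" by (simp only: f_def)
        then have "?c w = 0" using p by (intro prod_zero bexI[of _ "p - 1"]) auto
        then show False using c by simp
      qed
      have "\<exists>p\<in>{1..N}. \<exists>q\<in>{1..N}. p \<noteq> q \<and> row p = row q \<and> f p = f q"
      proof (rule ccontr)
        assume "\<not> ?thesis"
        then have inj: "p = q" if "p \<in> {1..N}" "q \<in> {1..N}" "row p = row q" "f p = f q" for p q
          using that by blast
        have pos: "1 \<le> f p" if "p \<in> {1..N}" for p using f_in[OF that] by simp
        have "f p = col p" if "p \<in> {1..N}" for p
          by (rule lower_filling_eq_col[OF le pos inj that])
        then have "w = ?w" unfolding wf map_letters_eq_iff by blast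
        then show False using False by simp
      qed
      then obtain p q where pq: "p \<in> {1..N}" "q \<in> {1..N}" "p \<noteq> q" "row p = row q" "f p = f q" by blast
      have t: "transpose p q \<in> fiber_group N row" using pq by (intro transpose_in_fiber_group)
      have "f \<circ> inv (transpose p q) = f" using pq(5) by (auto simp: fun_eq_iff transpose_def)
      then have "pact (transpose p q) (word_tensor N f) = word_tensor N f"
        using place_act_word_tensor[where f = f, OF fiber_groupD(1)[OF t] f_in] by simp
      then have "alt (word_tensor N f) = 0"
        by (intro antisym_transpose[OF fiber_perms t pq(3)] word_tensor_in[where f = f, OF f_in])
      then show ?thesis using False by (simp add: wf[symmetric] word_tensor_def)
    qed (use False in simp)
  qed
  have "tensor_act scl n e N u (alt col_tensor) = alt (matrix_act n N A col_tensor)"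
    unfolding act
    by (rule galg_equivariant[OF alt_galg equivariant_matrix_act col_tensor_in])
  also have "\<dots> = (\<Sum>w\<in>words n N. tscale (?c w) (alt (basis_tensor w)))"
    unfolding expand
    by (simp only: linear_sum[OF galg_linear[OF alt_galg]]
        linear_scale[OF galg_linear[OF alt_galg]])
  also have "\<dots> = (\<Sum>w\<in>words n N. if w = ?w then alt col_tensor else 0)"
    by (rule sum.cong[OF refl summand])
  also have "\<dots> = alt col_tensor" using w by (simp add: finite_words)
  finally show ?thesis .
qed

end

section \<open>Diagrams and added boxes\<close>

lemma diagram_Sigma: "diagram la = Sigma {1..length la} (\<lambda>i. {1..part la i})"
  by (auto simp: diagram_def)

lemma finite_diagram: "finite (diagram la)"
  by (simp add: diagram_Sigma)

lemma mem_diagram_iff: "(i, j) \<in> diagram la \<longleftrightarrow> 1 \<le> i \<and> 1 \<le> j \<and> j \<le> part la i"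
  by (auto simp: diagram_def part_def)

lemma sum_part: "(\<Sum>i=1..length la. part la i) = sum_list la"
proof -
  have "(\<Sum>i=1..length la. part la i) = (\<Sum>i<length la. la ! i)"
    by (rule sum.reindex_bij_witness[where j = "\<lambda>i. i - 1" and i = Suc]) (auto simp: part_def)
  then show ?thesis by (simp add: sum_list_sum_nth atLeast0LessThan)
qed

lemma card_diagram: "card (diagram la) = sum_list la"
  unfolding diagram_Sigma by (simp add: sum_part)

lemma part_antimono:
  assumes "is_partition la N" "1 \<le> i" "i \<le> i'"
  shows "part la i' \<le> part la i"
proof (cases "i = i' \<or> length la < i'")
  case False
  then show ?thesis
    using assms sorted_wrt_nth_less[of "(\<ge>)" la "i - 1" "i' - 1"]
    by (auto simp: is_partition_def part_def)
qed (auto simp: part_def)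

lemma bij_betw_row_tableau: "bij_betw (row_tableau la) (diagram la) {1..sum_list la}"
proof -
  define S where "S i = (\<Sum>r=1..<i. part la r)" for i
  have S_mono: "S i \<le> S i'" if "i \<le> i'" for i i'
    unfolding S_def using that by (intro sum_mono2) auto
  have S_Suc: "S (Suc i) = S i + part la i" if "1 \<le> i" for i
    using that by (simp add: S_def)
  have S_len: "S (Suc (length la)) = sum_list la"
    unfolding S_def sum_part[symmetric] by (simp add: atLeastLessThanSuc_atLeastAtMost)
  have bound: "S i + j \<le> S (Suc i)" if "(i, j) \<in> diagram la" for i j
    using that by (simp add: mem_diagram_iff S_Suc)
  have less: "S i + j < S i' + j'" if "(i, j) \<in> diagram la" "(i', j') \<in> diagram la" "i < i'" for i j i' j'
    using bound[OF that(1)] S_mono[of "Suc i" i'] that by (simp add: mem_diagram_iff)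
  have rt: "row_tableau la (i, j) = S i + j" for i j by (simp add: row_tableau_def S_def)
  have inj: "inj_on (row_tableau la) (diagram la)"
  proof (rule inj_onI, clarify)
    fix i j i' j' assume a: "(i, j) \<in> diagram la" "(i', j') \<in> diagram la"
      "row_tableau la (i, j) = row_tableau la (i', j')"
    then have "i = i'" using less[OF a(1,2)] less[OF a(2,1)] by (metis rt less_irrefl linorder_neqE_nat)
    then show "i = i' \<and> j = j'" using a(3) by (simp add: rt)
  qed
  have "row_tableau la ` diagram la \<subseteq> {1..sum_list la}"
  proof clarify
    fix i j assume a: "(i, j) \<in> diagram la"
    then have "i \<le> length la" by (simp add: diagram_def)
    then have "S (Suc i) \<le> sum_list la" unfolding S_len[symmetric] by (intro S_mono) simp
    then show "row_tableau la (i, j) \<in> {1..sum_list la}"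
      using bound[OF a] a by (simp add: rt mem_diagram_iff)
  qed
  moreover have "card (row_tableau la ` diagram la) = card {1..sum_list la}"
    by (simp add: card_image[OF inj] card_diagram)
  ultimately have "row_tableau la ` diagram la = {1..sum_list la}" by (intro card_subset_eq) auto
  then show ?thesis using inj by (simp add: bij_betw_def)
qed

context
  fixes la :: "nat list" and N :: nat and L :: "nat \<times> nat \<Rightarrow> nat"
  assumes L: "bij_betw L (diagram la) {1..N}"
begin

lemma young_tableau_inv_into:
  "young_tableau N la (\<lambda>p. fst (inv_into (diagram la) L p)) (\<lambda>p. snd (inv_into (diagram la) L p))"
  by unfold_locales (simp add: bij_betw_inv_into[OF L])

lemma inv_into_tableau: "b \<in> diagram la \<Longrightarrow> inv_into (diagram la) L (L b) = b"
  using L by (simp add: bij_betw_def)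

lemma tableau_in: "b \<in> diagram la \<Longrightarrow> L b \<in> {1..N}"
  using L by (auto simp: bij_betw_def)

lemma inv_into_in_diagram: "p \<in> {1..N} \<Longrightarrow> inv_into (diagram la) L p \<in> diagram la \<and> L (inv_into (diagram la) L p) = p"
  using L by (metis bij_betw_imp_surj_on inv_into_into f_inv_into_f)

text \<open>Connects the row and column groups, defined by setwise stable sets of entries, with
  \<open>fiber_group\<close>; \<open>c\<close> becomes \<open>fst\<close> or
  \<open>snd\<close>.\<close>

lemma stable_fibers_iff:
  fixes c :: "nat \<times> nat \<Rightarrow> 'c"
  assumes g: "g permutes {1..N}"
  shows "(\<forall>v. g ` {L b | b. b \<in> diagram la \<and> c b = v} = {L b | b. b \<in> diagram la \<and> c b = v})
    \<longleftrightarrow> g \<in> fiber_group N (\<lambda>p. c (inv_into (diagram la) L p))" (is "?l \<longleftrightarrow> ?r")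
proof -
  let ?F = "\<lambda>v. {L b | b. b \<in> diagram la \<and> c b = v}"
  have F: "?F v = {p \<in> {1..N}. c (inv_into (diagram la) L p) = v}" for v
  proof
    show "?F v \<subseteq> {p \<in> {1..N}. c (inv_into (diagram la) L p) = v}"
    proof
      fix p assume "p \<in> ?F v"
      then obtain b where b: "p = L b" "b \<in> diagram la" "c b = v" by blast
      then show "p \<in> {p \<in> {1..N}. c (inv_into (diagram la) L p) = v}"
        using tableau_in[OF b(2)] inv_into_tableau[OF b(2)] by simp
    qed
    show "{p \<in> {1..N}. c (inv_into (diagram la) L p) = v} \<subseteq> ?F v"
    proof
      fix p assume p: "p \<in> {p \<in> {1..N}. c (inv_into (diagram la) L p) = v}"
      then have "p \<in> {1..N}" by blast
      from inv_into_in_diagram[OF this] have "inv_into (diagram la) L p \<in> diagram la"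
        "p = L (inv_into (diagram la) L p)" by simp_all
      then show "p \<in> ?F v" using p by blast
    qed
  qed
  show ?thesis
  proof
    assume l: ?l
    show ?r
    proof (rule fiber_groupI[OF g])
      fix p assume "p \<in> {1..N}"
      then have "p \<in> ?F (c (inv_into (diagram la) L p))" unfolding F by blast
      then have "g p \<in> ?F (c (inv_into (diagram la) L p))" using l by blast
      then show "c (inv_into (diagram la) L (g p)) = c (inv_into (diagram la) L p)" unfolding F by blast
    qed
  next
    assume r: ?r
    show ?l
    proof
      fix v
      have "g ` ?F v \<subseteq> ?F v"
        unfolding F using fiber_groupD(2)[OF r] permutes_in_image[OF g] by auto
      moreover have "finite (?F v)" unfolding F by simp
      ultimately show "g ` ?F v = ?F v"
        using permutes_inj_on[OF g] by (intro endo_inj_surj) auto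
    qed
  qed
qed

lemma column_group_eq: "column_group la N L = fiber_group N (\<lambda>p. snd (inv_into (diagram la) L p))"
proof -
  have "{L (i, j) | i. (i, j) \<in> diagram la} = {L b | b. b \<in> diagram la \<and> snd b = j}" for j
    by (auto; metis)
  then have "(\<forall>j. g ` {L (i, j) | i. (i, j) \<in> diagram la} = {L (i, j) | i. (i, j) \<in> diagram la})
    \<longleftrightarrow> g \<in> fiber_group N (\<lambda>p. snd (inv_into (diagram la) L p))" if "g permutes {1..N}" for g
    using stable_fibers_iff[OF that, of snd] by (simp only:)
  then show ?thesis unfolding column_group_def
    by (blast dest: fiber_groupD(1))
qed

lemma row_group_eq: "row_group la N L = fiber_group N (\<lambda>p. fst (inv_into (diagram la) L p))"
proof -
  have "{L (i, j) | j. (i, j) \<in> diagram la} = {L b | b. b \<in> diagram la \<and> fst b = i}" for i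
    by (auto; metis)
  then have "(\<forall>i. g ` {L (i, j) | j. (i, j) \<in> diagram la} = {L (i, j) | j. (i, j) \<in> diagram la})
    \<longleftrightarrow> g \<in> fiber_group N (\<lambda>p. fst (inv_into (diagram la) L p))" if "g permutes {1..N}" for g
    using stable_fibers_iff[OF that, of fst] by (simp only:)
  then show ?thesis unfolding row_group_def
    by (blast dest: fiber_groupD(1))
qed

end

locale added_boxes =
  fixes N t p :: nat and la ga :: "nat list" and i s :: "nat \<Rightarrow> nat" and j :: "nat \<Rightarrow> nat \<Rightarrow> nat"
  assumes t: "t \<ge> 1"
    and la: "is_partition la N"
    and ga: "is_partition ga (N + t)"
    and la_ga: "diagram la \<subseteq> diagram ga"
    and different_columns: "inj_on snd (diagram ga - diagram la)"
    and added: "diagram ga - diagram la = {(i r, j r a) | r a. r \<in> {1..p} \<and> a \<in> {1..s r}}"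
    and s_pos: "\<forall>r\<in>{1..p}. s r \<ge> 1"
    and i_range: "\<forall>r\<in>{1..p}. 1 \<le> i r \<and> i r \<le> length ga"
    and i_mono: "strict_mono_on {1..p} i"
    and j_consecutive: "\<forall>r\<in>{1..p}. \<forall>a\<in>{1..<s r}. j r (a + 1) = j r a + 1"
begin

lemma i_inj: "r \<in> {1..p} \<Longrightarrow> r' \<in> {1..p} \<Longrightarrow> i r = i r' \<Longrightarrow> r = r'"
  using inj_onD[OF strict_mono_on_imp_inj_on[OF i_mono]] by blast

lemma i_less: "r \<in> {1..p} \<Longrightarrow> r' \<in> {1..p} \<Longrightarrow> r < r' \<Longrightarrow> i r < i r'"
  using strict_mono_onD[OF i_mono] by blast

lemma card_added: "card (diagram ga - diagram la) = t"
  using la ga la_ga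
  by (simp add: card_Diff_subset finite_diagram card_diagram is_partition_def)

lemma p_pos: "1 \<le> p"
proof (rule ccontr)
  assume "\<not> 1 \<le> p"
  then have "diagram ga - diagram la = {}" unfolding added by simp
  then show False using card_added t by (simp only: card.empty)
qed

lemma j_arith:
  assumes r: "r \<in> {1..p}"
  shows "1 \<le> a \<Longrightarrow> a \<le> s r \<Longrightarrow> j r a = j r 1 + (a - 1)"
proof (induction a rule: dec_induct)
  case (step a)
  then show ?case using j_consecutive r by (auto simp: Suc_eq_plus1)
qed simp

lemma added_row:
  assumes r: "r \<in> {1..p}"
  shows "j r ` {1..s r} = {part la (i r)<..part ga (i r)}"
proof -
  have "c \<in> j r ` {1..s r} \<longleftrightarrow> (i r, c) \<in> diagram ga - diagram la" for c
    unfolding added using r i_inj by blast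
  moreover have "(i r, c) \<in> diagram ga - diagram la \<longleftrightarrow> c \<in> {part la (i r)<..part ga (i r)}" for c
    using i_range r by (auto simp: mem_diagram_iff)
  ultimately show ?thesis by blast
qed

lemma part_less:
  assumes r: "r \<in> {1..p}"
  shows "part la (i r) < part ga (i r)"
proof -
  have "j r 1 \<in> j r ` {1..s r}" using s_pos r by auto
  then show ?thesis unfolding added_row[OF r] by simp
qed

text \<open>Identifies the thresholds in \<open>shift_tableau\<close> with row lengths of
  \<open>ga\<close>.\<close>

lemma last_added:
  assumes r: "r \<in> {1..p}"
  shows "j r (s r) = part ga (i r)"
proof -
  have s: "1 \<le> s r" using s_pos r by blast
  then have "j r (s r) \<in> j r ` {1..s r}" by simp
  then have le: "j r (s r) \<le> part ga (i r)" unfolding added_row[OF r] by simp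
  have "part ga (i r) \<in> j r ` {1..s r}" unfolding added_row[OF r] using part_less[OF r] by simp
  then obtain a where "a \<in> {1..s r}" "part ga (i r) = j r a" by blast
  then have "part ga (i r) \<le> j r (s r)" using j_arith[OF r, of a] j_arith[OF r s] by auto
  then show ?thesis using le by simp
qed

lemma added_iff: "(i', c) \<in> diagram ga - diagram la \<longleftrightarrow> (\<exists>r\<in>{1..p}. i' = i r \<and> part la i' < c \<and> c \<le> part ga i')"
proof
  assume a: "(i', c) \<in> diagram ga - diagram la"
  then obtain r where "r \<in> {1..p}" "i' = i r" unfolding added by blast
  then show "\<exists>r\<in>{1..p}. i' = i r \<and> part la i' < c \<and> c \<le> part ga i'"
    using a by (auto simp: mem_diagram_iff)
next
  assume "\<exists>r\<in>{1..p}. i' = i r \<and> part la i' < c \<and> c \<le> part ga i'"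
  then show "(i', c) \<in> diagram ga - diagram la" using i_range by (auto simp: mem_diagram_iff)
qed

definition cut :: "nat \<Rightarrow> nat" where
  "cut l = (if l = p then 0 else part ga (i (Suc l)))"

lemma cut_eq:
  assumes "l \<in> {1..p}"
  shows "(if l = p then 0 else j (l + 1) (s (l + 1))) = cut l"
  using assms last_added[of "l + 1"] by (auto simp: cut_def Suc_eq_plus1)

text \<open>Otherwise row \<open>i l\<close> would contain an added box in column
  \<open>part ga (i (Suc l))\<close>, where row \<open>i (Suc l)\<close> has one already. So every
  added box lies beyond the threshold of its row.\<close>

lemma cut_le:
  assumes l: "l \<in> {1..p}"
  shows "cut l \<le> part la (i l)"
proof (rule ccontr)
  assume n: "\<not> ?thesis"
  then have lp: "l \<noteq> p" by (auto simp: cut_def)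
  then have l': "Suc l \<in> {1..p}" using l by simp
  let ?c = "part ga (i (Suc l))"
  have lt: "i l < i (Suc l)" using i_less[OF l l'] by simp
  have "part la (i l) < ?c" using n lp by (simp add: cut_def)
  moreover have "?c \<le> part ga (i l)" using part_antimono[OF ga] i_range l lt by simp
  ultimately have "(i l, ?c) \<in> diagram ga - diagram la" unfolding added_iff using l by blast
  moreover have "(i (Suc l), ?c) \<in> diagram ga - diagram la"
    unfolding added_iff using l' part_less[OF l'] by auto
  ultimately have "(i l, ?c) = (i (Suc l), ?c)" using inj_onD[OF different_columns, of "(i l, ?c)" "(i (Suc l), ?c)"] by simp
  then show False using lt by simp
qed

text \<open>The boxes whose letter is permuted by \<pi>. Added boxes are included, in agreement with
  the permuted last \<open>t\<close> factors of the vector.\<close>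

definition moved :: "nat \<times> nat \<Rightarrow> bool" where
  "moved b \<longleftrightarrow> (\<exists>l\<in>{1..p}. fst b = i l \<and> cut l < snd b)"

lemma shift_tableau_eq: "shift_tableau p i s j \<pi> b = (if moved b then \<pi> (snd b) else snd b)"
proof -
  have "(\<exists>l\<in>{1..p}. fst b = i l \<and> snd b > (if l = p then 0 else j (l + 1) (s (l + 1)))) \<longleftrightarrow> moved b"
    unfolding moved_def using cut_eq by auto
  then show ?thesis by (simp add: shift_tableau_def split_beta)
qed

lemma moved_added: "b \<in> diagram ga - diagram la \<Longrightarrow> moved b"
  using added_iff[of "fst b" "snd b"] cut_le by (fastforce simp: moved_def)

text \<open>The moved boxes of row \<open>i l\<close> fill the columns from \<open>cut l + 1\<close>
  to \<open>part ga (i l)\<close>. These intervals abut, as \<open>cut l\<close> is the length of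
  row \<open>i (Suc l)\<close>, or 0 for \<open>l = p\<close>; so they partition the columns up to
  \<open>part ga (i 1)\<close>.\<close>

lemma moved_unique:
  assumes b: "(x, c) \<in> diagram ga" "moved (x, c)" and b': "(x', c) \<in> diagram ga" "moved (x', c)"
  shows "x = x'"
proof -
  have False if l: "l \<in> {1..p}" "l' \<in> {1..p}" "l < l'" "cut l < c" "(i l', c) \<in> diagram ga" for l l'
  proof -
    have "Suc l \<in> {1..p}" using l by simp
    then have "i (Suc l) \<le> i l'" using i_less l by (cases "Suc l = l'") (simp_all add: less_imp_le)
    then have "part ga (i l') \<le> part ga (i (Suc l))"
      using part_antimono[OF ga] i_range \<open>Suc l \<in> {1..p}\<close> by blast
    then show False using l by (simp add: mem_diagram_iff cut_def)
  qed
  moreover obtain l l' where "l \<in> {1..p}" "x = i l" "cut l < c" "l' \<in> {1..p}" "x' = i l'" "cut l' < c"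
    using b(2) b'(2) by (auto simp: moved_def)
  ultimately show ?thesis using b b' by (metis linorder_neqE_nat)
qed

lemma moved_column_le:
  assumes "b \<in> diagram ga" "moved b"
  shows "snd b \<in> {1..part ga (i 1)}"
proof -
  obtain l where l: "l \<in> {1..p}" "fst b = i l" using assms by (auto simp: moved_def)
  have "i 1 \<le> i l" using i_less[of 1 l] l p_pos by (cases "l = 1") auto
  then have "part ga (i l) \<le> part ga (i 1)" using part_antimono[OF ga] i_range p_pos by simp
  moreover have "(fst b, snd b) \<in> diagram ga" using assms(1) by simp
  ultimately show ?thesis unfolding mem_diagram_iff l by simp
qed

lemma moved_exists:
  assumes c: "c \<in> {1..part ga (i 1)}"
  shows "\<exists>x. (x, c) \<in> diagram ga \<and> moved (x, c)"
proof -
  let ?S = "{l \<in> {1..p}. c \<le> part ga (i l)}"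
  \<comment> \<open>The lowest row with added boxes that still reaches column \<open>c\<close>;
    since the next such row does not, \<open>c\<close> lies beyond the threshold.\<close>
  define l where "l = Max ?S"
  have "1 \<in> ?S" using c p_pos by simp
  then have "l \<in> ?S" unfolding l_def by (intro Max_in) auto
  have "cut l < c"
  proof (cases "l = p")
    case False
    have "Suc l \<notin> ?S"
    proof
      assume "Suc l \<in> ?S"
      then have "Suc l \<le> l" unfolding l_def by (intro Max_ge) simp_all
      then show False by simp
    qed
    then show ?thesis using False \<open>l \<in> ?S\<close> by (simp add: cut_def)
  qed (use c in \<open>simp add: cut_def\<close>)
  then have "(i l, c) \<in> diagram ga \<and> moved (i l, c)"
    using \<open>l \<in> ?S\<close> c i_range by (auto simp: mem_diagram_iff moved_def)
  then show ?thesis by blast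
qed

text \<open>
  Inside its columns, the diagram of \<open>\<gamma>\<close> is rearranged so that the moved boxes form row \<open>i 1\<close>
  and the unmoved boxes of row \<open>i l\<close> form row \<open>i (l + 1)\<close>.
\<close>

definition next_row :: "nat \<Rightarrow> nat" where
  "next_row x = (if x \<in> i ` {1..p} then i (Suc (inv_into {1..p} i x)) else x)"

definition new_row :: "nat \<times> nat \<Rightarrow> nat" where
  "new_row b = (if moved b then i 1 else next_row (fst b))"

text \<open>For \<open>l = p\<close> the value \<open>i (Suc p)\<close> is meaningless but harmless:
  \<open>cut p = 0\<close> leaves no unmoved box in row \<open>i p\<close>.\<close>

lemma next_row_i: "l \<in> {1..p} \<Longrightarrow> next_row (i l) = i (Suc l)"
  using strict_mono_on_imp_inj_on[OF i_mono] by (simp add: next_row_def)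

lemma unmoved_cases:
  assumes "(x, c) \<in> diagram ga" "\<not> moved (x, c)"
  obtains (shifted) l where "l \<in> {1..p}" "Suc l \<in> {1..p}" "x = i l" "next_row x = i (Suc l)" "c \<le> part ga (i (Suc l))"
  | (fixed) "x \<notin> i ` {1..p}" "next_row x = x"
proof (cases "x \<in> i ` {1..p}")
  case True
  then obtain l where l: "l \<in> {1..p}" "x = i l" by blast
  then have "c \<le> cut l" using assms(2) by (auto simp: moved_def)
  moreover have "1 \<le> c" using assms(1) by (simp add: mem_diagram_iff)
  ultimately have "l \<noteq> p" "c \<le> part ga (i (Suc l))" by (auto simp: cut_def split: if_splits)
  then show thesis using shifted l next_row_i by auto
next
  case False
  then show thesis using fixed by (simp add: next_row_def)
qed

lemma unmoved_row_inj:
  assumes "b \<in> diagram ga" "\<not> moved b" "b' \<in> diagram ga" "\<not> moved b'" "next_row (fst b) = next_row (fst b')"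
  shows "fst b = fst b'"
proof -
  have b: "(fst b, snd b) \<in> diagram ga" "\<not> moved (fst b, snd b)"
    "(fst b', snd b') \<in> diagram ga" "\<not> moved (fst b', snd b')" using assms by auto
  show ?thesis
    using b(1,2)
  proof (cases rule: unmoved_cases)
    case l: (shifted l)
    show ?thesis
      using b(3,4)
    proof (cases rule: unmoved_cases)
      case (shifted l')
      then have "Suc l = Suc l'" using l assms(5) i_inj by metis
      then show ?thesis using l shifted by simp
    next
      case fixed
      then show ?thesis using l assms(5) by (metis imageI)
    qed
  next
    case x: fixed
    show ?thesis
      using b(3,4)
    proof (cases rule: unmoved_cases)
      case (shifted l')
      then show ?thesis using x assms(5) by (metis imageI)
    next
      case fixed
      then show ?thesis using x assms(5) by simp
    qed
  qed
qed

lemma unmoved_next_row_neq: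
  assumes "b \<in> diagram ga" "\<not> moved b"
  shows "next_row (fst b) \<noteq> i 1"
proof -
  have b: "(fst b, snd b) \<in> diagram ga" "\<not> moved (fst b, snd b)" using assms by auto
  have one: "1 \<in> {1..p}" using p_pos by simp
  show ?thesis
    using b
  proof (cases rule: unmoved_cases)
    case (shifted l)
    then have "Suc l \<noteq> 1" by simp
    then show ?thesis using shifted i_inj[OF shifted(2) one] by auto
  next
    case fixed
    then show ?thesis using one by auto
  qed
qed

lemma new_row_eq_iff: "b \<in> diagram ga \<Longrightarrow> new_row b = i 1 \<longleftrightarrow> moved b"
  using unmoved_next_row_neq by (auto simp: new_row_def)

text \<open>The rearrangement stays in the diagram: an unmoved box of row \<open>i l\<close> has
  column at most \<open>cut l\<close>, the length of its new row, and the moved boxes fit into row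
  \<open>i 1\<close>. On a finite set injectivity then suffices.\<close>

lemma bij_betw_new_box: "bij_betw (\<lambda>b. (new_row b, snd b)) (diagram ga) (diagram ga)"
proof -
  have inj: "inj_on (\<lambda>b. (new_row b, snd b)) (diagram ga)"
  proof (rule inj_onI)
    fix b b' assume b: "b \<in> diagram ga" "b' \<in> diagram ga" "(new_row b, snd b) = (new_row b', snd b')"
    have same: "moved b \<longleftrightarrow> moved b'" using new_row_eq_iff[OF b(1)] new_row_eq_iff[OF b(2)] b(3) by simp
    have "fst b = fst b'"
    proof (cases "moved b")
      case True
      then show ?thesis using moved_unique[of "fst b" "snd b" "fst b'"] b same by simp
    next
      case False
      then show ?thesis using unmoved_row_inj[OF b(1) _ b(2)] same b(3) by (simp add: new_row_def)
    qed
    then show "b = b'" using b(3) by (simp add: prod_eq_iff)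
  qed
  have "(new_row b, snd b) \<in> diagram ga" if b: "b \<in> diagram ga" for b
  proof (cases "moved b")
    case True
    then show ?thesis
      using moved_column_le[OF b] i_range p_pos by (simp add: new_row_def mem_diagram_iff)
  next
    case False
    have b': "(fst b, snd b) \<in> diagram ga" "\<not> moved (fst b, snd b)" using b False by auto
    then show ?thesis
    proof (cases rule: unmoved_cases)
      case (shifted l)
      then show ?thesis using b' False i_range by (simp add: new_row_def mem_diagram_iff)
    next
      case fixed
      then show ?thesis using b' False by (simp add: new_row_def)
    qed
  qed
  then have "(\<lambda>b. (new_row b, snd b)) ` diagram ga = diagram ga"
    using inj by (intro endo_inj_surj finite_diagram) auto
  then show ?thesis using inj by (simp add: bij_betw_def)
qed

abbreviation "acols \<equiv> added_columns p s j"

lemma set_added_columns: "set acols = snd ` (diagram ga - diagram la)"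
  unfolding added added_columns_def by (force simp: image_iff)

lemma length_added_columns: "length acols = t"
proof -
  have "length acols = (\<Sum>r=1..p. s r)"
  proof -
    have "length acols = sum_list (map s (rev [1..<Suc p]))"
      by (simp add: added_columns_def length_concat comp_def)
    also have "\<dots> = sum_list (map s [1..<Suc p])" by (simp add: rev_map[symmetric] sum_list_rev)
    also have "\<dots> = (\<Sum>r=1..p. s r)"
      by (simp add: sum_set_upt_conv_sum_list_nat[symmetric] atLeastLessThanSuc_atLeastAtMost)
    finally show ?thesis .
  qed
  also have "\<dots> = card (Sigma {1..p} (\<lambda>r. {1..s r}))" by simp
  also have "\<dots> = card ((\<lambda>(r, a). (i r, j r a)) ` Sigma {1..p} (\<lambda>r. {1..s r}))"
  proof (rule card_image[symmetric], rule inj_onI, clarify)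
    fix r a r' a' assume *: "r \<in> {1..p}" "a \<in> {1..s r}" "r' \<in> {1..p}" "a' \<in> {1..s r'}" "i r = i r'" "j r a = j r' a'"
    then have "r = r'" using i_inj by blast
    then show "r = r' \<and> a = a'"
      using * j_arith[OF *(1), of a] j_arith[OF *(1), of a'] by auto
  qed
  also have "(\<lambda>(r, a). (i r, j r a)) ` Sigma {1..p} (\<lambda>r. {1..s r}) = diagram ga - diagram la"
    unfolding added by force
  finally show ?thesis by (simp add: card_added)
qed

lemma distinct_added_columns: "distinct acols"
  by (rule card_distinct)
    (simp add: set_added_columns card_image[OF different_columns] card_added length_added_columns)

end

section \<open>The module generated by the vector\<close>

text \<open>Two bijective tableaux of one shape differ by a permutation \<open>c\<close> of
  positions matching their boxes. It carries one column word to the other and conjugates the row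
  groups, preserving signs. This brings the rearranged tableau back to the one defining the Schur
  module.\<close>

lemma (in tensor_young) antisymmetrized_word_conjugate:
  assumes "young_tableau N ga row' col'"
  obtains c where "c permutes {1..N}"
    "antisym (fiber_group N row') (word_tensor N col') = pact c (alt col_tensor)"
proof -
  interpret Y: young_tableau N ga row' col' by fact
  have "\<forall>p\<in>{1..N}. \<exists>q\<in>{1..N}. row' q = row p \<and> col' q = col p"
    using box_in Y.box_surj by blast
  then obtain r where r: "\<And>p. p \<in> {1..N} \<Longrightarrow> r p \<in> {1..N} \<and> row' (r p) = row p \<and> col' (r p) = col p"
    by metis
  have r_inj: "p = q" if "p \<in> {1..N}" "q \<in> {1..N}" "r p = r q" for p q
    using box_inj[OF that(1,2)] r[OF that(1)] r[OF that(2)] that(3) by metis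
  obtain c where c: "c permutes {1..N}" and c_eq: "\<And>p. p \<in> {1..N} \<Longrightarrow> c p = r p"
    using extend_to_permutation[of "{1..N}" r, OF finite_atLeastAtMost _ r_inj] r by blast
  have c_row: "row' (c p) = row p" "col' (c p) = col p" if "p \<in> {1..N}" for p
    using r[OF that] by (simp_all only: c_eq[OF that])
  have inv_in: "inv c p \<in> {1..N}" if "p \<in> {1..N}" for p
    using that permutes_in_image[OF permutes_inv[OF c]] by blast
  have c_in: "c p \<in> {1..N}" if "p \<in> {1..N}" for p using that permutes_in_image[OF c] by blast
  have inv_row: "row (inv c p) = row' p" "col (inv c p) = col' p" if "p \<in> {1..N}" for p
    using c_row[OF inv_in[OF that]] by (simp_all add: permutes_inverses[OF c])
  have word: "word_tensor N col' = pact c col_tensor"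
    by (subst place_act_word_tensor[where f = col, OF c col_in], assumption, rule word_tensor_cong)
      (simp add: inv_row del: atLeastAtMost_iff)
  let ?R = "fiber_group N row" and ?R' = "fiber_group N row'"
  have perm: "g permutes {1..N}" if "g \<in> ?R" for g using that by (rule fiber_groupD)
  have conj: "c \<circ> \<tau> \<circ> inv c \<in> ?R'" if "\<tau> \<in> ?R" for \<tau>
  proof (rule fiber_groupI)
    show "c \<circ> \<tau> \<circ> inv c permutes {1..N}"
      using c perm[OF that] by (simp add: permutes_compose permutes_inv)
    fix p assume p: "p \<in> {1..N}"
    have "\<tau> (inv c p) \<in> {1..N}" using inv_in[OF p] permutes_in_image[OF perm[OF that]] by blast
    then show "row' ((c \<circ> \<tau> \<circ> inv c) p) = row' p"
      using fiber_groupD(2)[OF that] inv_row[OF p] by (simp add: c_row del: atLeastAtMost_iff)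
  qed
  have conj': "inv c \<circ> \<tau> \<circ> c \<in> ?R" if "\<tau> \<in> ?R'" for \<tau>
  proof (rule fiber_groupI)
    show "inv c \<circ> \<tau> \<circ> c permutes {1..N}"
      using c fiber_groupD(1)[OF that] by (simp add: permutes_compose permutes_inv)
    fix p assume p: "p \<in> {1..N}"
    have "\<tau> (c p) \<in> {1..N}"
      using c_in[OF p] permutes_in_image[OF fiber_groupD(1)[OF that]] by blast
    then show "row ((inv c \<circ> \<tau> \<circ> c) p) = row p"
      using fiber_groupD(2)[OF that] c_row[OF p] by (simp add: inv_row del: atLeastAtMost_iff)
  qed
  have "pact c (alt col_tensor)
      = (\<Sum>\<tau>\<in>?R. signed \<tau> (pact (c \<circ> \<tau>) col_tensor))"
    unfolding antisym_def linear_sum[OF act_linear[OF c]] linear_scale[OF act_linear[OF c]]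
    by (rule sum.cong) (simp_all add: act_comp[OF c perm col_tensor_in])
  also have "\<dots> = (\<Sum>\<tau>\<in>?R'. signed \<tau> (pact (\<tau> \<circ> c) col_tensor))"
  proof (rule sum.reindex_bij_witness[where j = "\<lambda>\<tau>. c \<circ> \<tau> \<circ> inv c" and i = "\<lambda>\<tau>. inv c \<circ> \<tau> \<circ> c"])
    fix \<tau> assume \<tau>: "\<tau> \<in> ?R"
    show "c \<circ> \<tau> \<circ> inv c \<in> ?R'" by (rule conj[OF \<tau>])
    have "c \<circ> \<tau> \<circ> inv c \<circ> c = c \<circ> \<tau>" by (simp add: comp_assoc permutes_inv_o[OF c])
    moreover have "sign (c \<circ> \<tau> \<circ> inv c) = sign \<tau>"
      using c perm[OF \<tau>] sign_idempotent[of c] sign_inverse[OF permutes_imp_permutation[OF finite_atLeastAtMost c]]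
      by (simp add: sign_comp permutes_compose permutes_inv)
    ultimately show "signed (c \<circ> \<tau> \<circ> inv c) (pact (c \<circ> \<tau> \<circ> inv c \<circ> c) col_tensor)
        = signed \<tau> (pact (c \<circ> \<tau>) col_tensor)" by simp
    show "inv c \<circ> (c \<circ> \<tau> \<circ> inv c) \<circ> c = \<tau>"
      by (simp add: fun_eq_iff permutes_inverses[OF c])
  next
    fix \<tau> assume \<tau>: "\<tau> \<in> ?R'"
    show "c \<circ> (inv c \<circ> \<tau> \<circ> c) \<circ> inv c = \<tau>"
      by (simp add: fun_eq_iff permutes_inverses[OF c])
    show "inv c \<circ> \<tau> \<circ> c \<in> ?R" by (rule conj'[OF \<tau>])
  qed
  also have "\<dots> = antisym ?R' (word_tensor N col')"
    unfolding word antisym_def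
    by (rule sum.cong) (simp_all add: act_comp[OF fiber_groupD(1) c col_tensor_in])
  finally show thesis using that[OF c] by simp
qed

section \<open>Tensor products of tensors\<close>

lemma take_permute_word:
  assumes "g permutes {1..N}" "length w = N + t"
  shows "take N (permute_word (N + t) g w) = permute_word N g (take N w)"
proof (rule permute_word_eqI)
  show "length (take N (permute_word (N + t) g w)) = N" by (simp add: permute_word_def)
  fix p assume p: "p \<in> {1..N}"
  then have "g p \<in> {1..N}" using permutes_in_image[OF assms(1)] by blast
  then have "g p - 1 < N" by auto
  moreover have "p \<in> {1..N + t}" "p - 1 < N" using p by auto
  ultimately show "take N (permute_word (N + t) g w) ! (p - 1) = take N w ! (g p - 1)"
    by (simp add: permute_word_nth del: atLeastAtMost_iff)
qed

lemma drop_permute_word: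
  assumes "g permutes {1..N}" "length w = N + t"
  shows "drop N (permute_word (N + t) g w) = drop N w"
proof (rule nth_equalityI)
  show "length (drop N (permute_word (N + t) g w)) = length (drop N w)"
    using assms by (simp add: permute_word_def)
  fix q assume "q < length (drop N (permute_word (N + t) g w))"
  then have q: "q < t" by (simp add: permute_word_def)
  have "permute_word (N + t) g w ! (Suc (N + q) - 1) = w ! (g (Suc (N + q)) - 1)"
    using q by (intro permute_word_nth) simp
  also have "g (Suc (N + q)) = Suc (N + q)" by (rule permutes_not_in[OF assms(1)]) simp
  finally show "drop N (permute_word (N + t) g w) ! q = drop N w ! q"
    using q assms(2) by (simp add: permute_word_def)
qed

lemma words_append_iff:
  "w \<in> words n (N + t) \<longleftrightarrow> take N w \<in> words n N \<and> drop N w \<in> words n t"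
proof
  assume "w \<in> words n (N + t)"
  then show "take N w \<in> words n N \<and> drop N w \<in> words n t"
    unfolding words_def using set_take_subset[of N w] set_drop_subset[of N w] by (auto dest: subsetD)
next
  assume w: "take N w \<in> words n N \<and> drop N w \<in> words n t"
  have "set (take N w @ drop N w) \<subseteq> {1..n}"
    using w unfolding words_def set_append by blast
  moreover have "length (take N w @ drop N w) = N + t"
    unfolding length_append using w words_length by metis
  ultimately show "w \<in> words n (N + t)"
    unfolding append_take_drop_id words_def by blast
qed

lemma tensor_prod_in:
  assumes "x \<in> tensor_power n N" "y \<in> tensor_power n t"
  shows "tensor_prod N x y \<in> tensor_power n (N + t)"
  using assms by (auto simp: tensor_power_def tensor_prod_def words_append_iff)

lemma tensor_prod_place_act:
  assumes g: "g permutes {1..N}" and y: "y \<in> tensor_power n t"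
  shows "tensor_prod N (place_act n N g x) y = place_act n (N + t) g (tensor_prod N x y)"
proof
  fix w
  have g': "g permutes {1..N + t}" by (rule permutes_subset[OF g]) auto
  show "tensor_prod N (place_act n N g x) y w = place_act n (N + t) g (tensor_prod N x y) w"
  proof (cases "w \<in> words n (N + t)")
    case True
    then show ?thesis
      using take_permute_word[OF g, of w t] drop_permute_word[OF g, of w t]
      by (simp add: tensor_prod_def place_act_apply'[OF g] place_act_apply'[OF g'] words_append_iff
          words_length[OF True])
  next
    case False
    have "place_act n N g x (take N w) * y (drop N w) = 0"
      using False y by (auto simp: place_act_apply'[OF g] tensor_power_def words_append_iff)
    then show ?thesis using False by (simp add: tensor_prod_def place_act_apply'[OF g'])
  qed
qed

lemma tscale_apply: "tscale c x w = c * x w"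
  by (simp add: tscale_def)

lemma tensor_prod_sum: "tensor_prod N (\<Sum>a\<in>A. f a) y = (\<Sum>a\<in>A. tensor_prod N (f a) y)"
  by (rule ext) (simp add: tensor_prod_def sum_tensor_apply sum_distrib_right)

lemma tensor_prod_tscale: "tensor_prod N (tscale c x) y = tscale c (tensor_prod N x y)"
  by (rule ext) (simp add: tensor_prod_def tscale_def)

lemma tensor_prod_word_tensor:
  "length v = t \<Longrightarrow> tensor_prod N (word_tensor N f) (basis_tensor v)
    = word_tensor (N + t) (\<lambda>p. if p \<le> N then f p else v ! (p - N - 1))"
proof -
  assume v: "length v = t"
  let ?h = "\<lambda>p. if p \<le> N then f p else v ! (p - N - 1)"
  have "map ?h [1..<Suc (N + t)] = map f [1..<Suc N] @ v"
  proof (rule nth_equalityI)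
    fix q assume "q < length (map ?h [1..<Suc (N + t)])"
    then have q: "q < N + t" by simp
    show "map ?h [1..<Suc (N + t)] ! q = (map f [1..<Suc N] @ v) ! q"
      unfolding map_letters_nth[OF q]
    proof (cases "q < N")
      case True
      then show "?h (Suc q) = (map f [1..<Suc N] @ v) ! q"
        by (simp only: nth_append length_map length_upt map_letters_nth[OF True]) simp
    qed (simp add: nth_append)
  qed (simp add: v)
  then show ?thesis
    unfolding word_tensor_def by (subst tensor_prod_basis_tensor) simp_all
qed

section \<open>The vector of the theorem in terms of the group algebra\<close>

locale pieri_tensor = tensor_space scl n e "N + t" + added_boxes N t p la ga i s j
  for scl :: "'k::field_char_0 \<Rightarrow> 'v::ab_group_add \<Rightarrow> 'v" and n e N t p la ga i s j +
  fixes L :: "nat \<times> nat \<Rightarrow> nat"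
  assumes L: "bij_betw L (diagram la) {1..N}" and ga_n: "part ga 1 \<le> n"
begin

abbreviation "M \<equiv> N + t"

text \<open>A numbering of the boxes of \<open>ga\<close> by all tensor positions: the first
  \<open>N\<close> follow \<open>L\<close>, and the later ones take the added boxes in the order of
  \<open>acols\<close>. An added box is determined by its column.\<close>

definition box :: "nat \<Rightarrow> nat \<times> nat" where
  "box q = (if q \<le> N then inv_into (diagram la) L q
     else inv_into (diagram ga - diagram la) snd (acols ! (q - N - 1)))"

definition col :: "nat \<Rightarrow> nat" where
  "col q = snd (box q)"

definition places :: "nat set" where
  "places = {q \<in> {1..M}. moved (box q)}"

definition col_perms :: "(nat \<Rightarrow> nat) set" where "col_perms = column_group la N L"
definition row_perms :: "(nat \<Rightarrow> nat) set" where "row_perms = row_group la N L"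
definition moved_perms :: "(nat \<Rightarrow> nat) set" where "moved_perms = {h. h permutes places}"

abbreviation col_word :: "'k tensor" where "col_word \<equiv> word_tensor M col"

lemma box_old: "q \<in> {1..N} \<Longrightarrow> box q = inv_into (diagram la) L q"
  by (simp add: box_def)

lemma bij_betw_box: "bij_betw box {1..M} (diagram ga)"
proof -
  have old: "bij_betw box {1..N} (diagram la)"
    using bij_betw_inv_into[OF L] by (rule bij_betw_cong[THEN iffD1, rotated]) (simp add: box_old)
  have "bij_betw (\<lambda>q. q - N - 1) {N + 1..M} {..<t}"
    by (rule bij_betw_byWitness[where f' = "\<lambda>q. q + N + 1"]) auto
  then have "bij_betw ((!) acols \<circ> (\<lambda>q. q - N - 1)) {N + 1..M} (set acols)"
    by (rule bij_betw_trans) (rule bij_betw_nth, simp_all add: distinct_added_columns length_added_columns)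
  moreover have "bij_betw (inv_into (diagram ga - diagram la) snd) (set acols) (diagram ga - diagram la)"
    unfolding set_added_columns
    by (rule bij_betw_inv_into[OF inj_on_imp_bij_betw[OF different_columns]])
  ultimately have "bij_betw (inv_into (diagram ga - diagram la) snd \<circ> ((!) acols \<circ> (\<lambda>q. q - N - 1)))
      {N + 1..M} (diagram ga - diagram la)"
    by (rule bij_betw_trans)
  then have new: "bij_betw box {N + 1..M} (diagram ga - diagram la)"
    by (rule bij_betw_cong[THEN iffD1, rotated]) (simp add: box_def)
  have "bij_betw box ({1..N} \<union> {N + 1..M}) (diagram la \<union> (diagram ga - diagram la))"
    using old new by (rule bij_betw_combine) auto
  moreover have "{1..N} \<union> {N + 1..M} = {1..M}" by auto
  moreover have "diagram la \<union> (diagram ga - diagram la) = diagram ga" using la_ga by blast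
  ultimately show ?thesis by simp
qed

lemma box_in: "q \<in> {1..M} \<Longrightarrow> box q \<in> diagram ga"
  using bij_betw_box by (auto simp: bij_betw_def)

lemma box_inj: "q \<in> {1..M} \<Longrightarrow> q' \<in> {1..M} \<Longrightarrow> box q = box q' \<Longrightarrow> q = q'"
  using bij_betw_imp_inj_on[OF bij_betw_box] by (rule inj_onD)

lemma box_new:
  assumes "q \<in> {1..M}" "q \<notin> {1..N}"
  shows "box q \<in> diagram ga - diagram la" "col q = acols ! (q - N - 1)"
proof -
  have "q - N - 1 < length acols" using assms by (auto simp: length_added_columns)
  then have *: "acols ! (q - N - 1) \<in> snd ` (diagram ga - diagram la)"
    unfolding set_added_columns[symmetric] by (rule nth_mem)
  have eq: "box q = inv_into (diagram ga - diagram la) snd (acols ! (q - N - 1))"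
    using assms by (simp add: box_def)
  show "box q \<in> diagram ga - diagram la" unfolding eq by (rule inv_into_into[OF *])
  show "col q = acols ! (q - N - 1)" unfolding col_def eq by (rule f_inv_into_f[OF *])
qed

lemma col_in: "q \<in> {1..M} \<Longrightarrow> col q \<in> {1..n}"
proof -
  assume q: "q \<in> {1..M}"
  have "(fst (box q), snd (box q)) \<in> diagram ga" using box_in[OF q] by simp
  then have "1 \<le> fst (box q)" "1 \<le> col q" "col q \<le> part ga (fst (box q))"
    unfolding mem_diagram_iff col_def by auto
  moreover have "part ga (fst (box q)) \<le> part ga 1"
    using part_antimono[OF ga, of 1 "fst (box q)"] calculation by simp
  ultimately show ?thesis using ga_n by simp
qed

lemma new_moved: "q \<in> {1..M} \<Longrightarrow> q \<notin> {1..N} \<Longrightarrow> q \<in> places"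
  using box_new(1) moved_added by (simp add: places_def del: atLeastAtMost_iff)

lemma col_inj_moved: "inj_on col places"
proof (rule inj_onI)
  fix q q' assume q: "q \<in> places" "q' \<in> places" "col q = col q'"
  then have q': "q \<in> {1..M}" "q' \<in> {1..M}" "moved (box q)" "moved (box q')" by (simp_all add: places_def)
  have "fst (box q) = fst (box q')"
    using moved_unique[of "fst (box q)" "col q" "fst (box q')"] box_in[OF q'(1)] box_in[OF q'(2)] q'(3,4)
      q(3) by (simp add: col_def)
  then have "box q = box q'" using q(3) by (simp add: prod_eq_iff col_def)
  then show "q = q'" using box_inj q' by blast
qed

lemma bij_betw_col_moved: "bij_betw col places {1..part ga (i 1)}"
  unfolding bij_betw_def
proof
  show "col ` places = {1..part ga (i 1)}"
  proof
    show "col ` places \<subseteq> {1..part ga (i 1)}"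
    proof
      fix c assume "c \<in> col ` places"
      then obtain q where "q \<in> {1..M}" "moved (box q)" "c = snd (box q)"
        by (auto simp: places_def col_def)
      then show "c \<in> {1..part ga (i 1)}" using moved_column_le[OF box_in] by blast
    qed
    show "{1..part ga (i 1)} \<subseteq> col ` places"
    proof
      fix c assume "c \<in> {1..part ga (i 1)}"
      then obtain x where x: "(x, c) \<in> diagram ga" "moved (x, c)" using moved_exists by blast
      then have "(x, c) \<in> box ` {1..M}" using bij_betw_imp_surj_on[OF bij_betw_box] by blast
      then obtain q where "q \<in> {1..M}" "(x, c) = box q" by blast
      then show "c \<in> col ` places" using x(2)
        by (intro image_eqI[of _ _ q]) (simp_all add: places_def col_def flip: \<open>(x, c) = box q\<close>)
    qed
  qed
qed (rule col_inj_moved)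

lemma col_perms_eq: "col_perms = fiber_group N (\<lambda>q. snd (inv_into (diagram la) L q))"
  unfolding col_perms_def by (rule column_group_eq[OF L])

lemma row_perms_eq: "row_perms = fiber_group N (\<lambda>q. fst (inv_into (diagram la) L q))"
  unfolding row_perms_def by (rule row_group_eq[OF L])

lemma perm_group_mono: "perm_group N H \<Longrightarrow> perm_group M H"
  unfolding perm_group_def by (auto intro: permutes_subset[of _ "{1..N}"])

lemma perm_groups:
  "perm_group M col_perms" "perm_group M row_perms" "perm_group M moved_perms"
proof -
  show "perm_group M col_perms" "perm_group M row_perms"
    unfolding col_perms_eq row_perms_eq
    by (rule perm_group_mono[OF fiber_perms])+
  have "places \<subseteq> {1..M}" by (auto simp: places_def)
  then show "perm_group M moved_perms"
    unfolding perm_group_def moved_perms_def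
    by (auto intro: permutes_subset permutes_id permutes_inv permutes_compose)
qed

lemma col_perms_subset: "col_perms \<subseteq> fiber_group M col"
proof
  fix g assume "g \<in> col_perms"
  then have g: "g \<in> fiber_group N (\<lambda>q. snd (inv_into (diagram la) L q))" by (simp only: col_perms_eq)
  note perm = fiber_groupD(1)[OF g]
  show "g \<in> fiber_group M col"
  proof (rule fiber_groupI)
    show "g permutes {1..M}" by (rule permutes_subset[OF perm]) auto
    fix q
    show "col (g q) = col q"
    proof (cases "q \<in> {1..N}")
      case True
      then have "g q \<in> {1..N}" using permutes_in_image[OF perm] by blast
      then show ?thesis using True fiber_groupD(2)[OF g] by (simp add: col_def box_old del: atLeastAtMost_iff)
    qed (simp add: permutes_not_in[OF perm])
  qed
qed

lemma row_perms_iff: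
  "\<tau> \<in> row_perms \<longleftrightarrow> \<tau> permutes {1..N} \<and> (\<forall>q\<in>{1..N}. fst (box (\<tau> q)) = fst (box q))"
proof
  assume "\<tau> \<in> row_perms"
  then have \<tau>: "\<tau> \<in> fiber_group N (\<lambda>q. fst (inv_into (diagram la) L q))" by (simp only: row_perms_eq)
  note perm = fiber_groupD(1)[OF \<tau>]
  have "fst (box (\<tau> q)) = fst (box q)" if "q \<in> {1..N}" for q
  proof -
    have "\<tau> q \<in> {1..N}" using that permutes_in_image[OF perm] by blast
    then show ?thesis using that fiber_groupD(2)[OF \<tau>] by (simp add: box_old del: atLeastAtMost_iff)
  qed
  then show "\<tau> permutes {1..N} \<and> (\<forall>q\<in>{1..N}. fst (box (\<tau> q)) = fst (box q))" using perm by blast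
next
  assume \<tau>: "\<tau> permutes {1..N} \<and> (\<forall>q\<in>{1..N}. fst (box (\<tau> q)) = fst (box q))"
  show "\<tau> \<in> row_perms"
    unfolding row_perms_eq
  proof (rule fiber_groupI)
    fix q assume q: "q \<in> {1..N}"
    then have "\<tau> q \<in> {1..N}" using \<tau> permutes_in_image[of \<tau>] by blast
    then show "fst (inv_into (diagram la) L (\<tau> q)) = fst (inv_into (diagram la) L q)"
      using q \<tau> by (simp add: box_old[symmetric] del: atLeastAtMost_iff)
  qed (use \<tau> in blast)
qed

lemma col_word_in: "col_word \<in> TP"
  by (rule word_tensor_in[where f = col, OF col_in])

lemma symms_galg:
  "symmetrizer col_perms \<in> galg" "antisym row_perms \<in> galg"
  "antisym moved_perms \<in> galg"
  using perm_groups
  by (auto intro!: symmetrizer_galg antisym_galg dest: perm_groupD(1))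

text \<open>The Young symmetrizer on the first \<open>N\<close> factors, as a group algebra element
  for all \<open>M\<close> positions.\<close>

definition young_map :: "'k tensor \<Rightarrow> 'k tensor" where
  "young_map x = symmetrizer col_perms (antisym row_perms x)"

lemma young_map_linear: "Vector_Spaces.linear tscale tscale young_map"
  unfolding young_map_def[abs_def]
  using symms_galg(1,2)[THEN galg_linear]
  by (intro linearI) (simp_all only: linear_add linear_scale)

lemma tensor_prod_young_symmetrizer:
  assumes y: "y \<in> tensor_power n t"
  shows "tensor_prod N (young_symmetrizer n la N L x) y = young_map (tensor_prod N x y)"
proof -
  have perm: "g permutes {1..N}" if "g \<in> col_perms \<or> g \<in> row_perms" for g
    using that fiber_groupD(1) unfolding col_perms_eq row_perms_eq by blast
  have lin: "pact g (\<Sum>a\<in>A. tscale (c a) (f a)) = (\<Sum>a\<in>A. tscale (c a) (pact g (f a)))"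
    if "g \<in> col_perms" for g A and c :: "(nat \<Rightarrow> nat) \<Rightarrow> 'k" and f
    using act_linear[OF perm_groupD(1)[OF perm_groups(1) that]]
    by (simp add: linear_sum linear_scale)
  have "tensor_prod N (young_symmetrizer n la N L x) y = (\<Sum>g\<in>col_perms. \<Sum>\<tau>\<in>row_perms.
      signed \<tau> (pact g (pact \<tau> (tensor_prod N x y))))"
    unfolding young_symmetrizer_def col_perms_def[symmetric] row_perms_def[symmetric] tensor_prod_sum
      tensor_prod_tscale
    by (intro sum.cong refl) (simp add: tensor_prod_place_act[OF perm y])
  also have "\<dots> = young_map (tensor_prod N x y)"
    unfolding young_map_def symmetrizer_def antisym_def
    by (intro sum.cong refl) (simp add: lin)
  finally show ?thesis .
qed

text \<open>Puts the ambient module into the form required by \<open>image_span_simple\<close>: the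
  image of a group algebra element.\<close>

lemma tensor_prod_space_eq:
  "tensor_prod_space N (young_symmetrizer n la N L ` tensor_power n N) (tensor_power n t)
    = young_map ` TP"
proof
  have sub: "subspace (young_map ` TP)"
    by (rule subspace_linear_image[OF young_map_linear subspace_T])
  show "tensor_prod_space N (young_symmetrizer n la N L ` tensor_power n N) (tensor_power n t)
    \<subseteq> young_map ` TP"
    unfolding tensor_prod_space_def
    by (rule span_minimal[OF _ sub]) (auto simp: tensor_prod_young_symmetrizer tensor_prod_in)
  show "young_map ` TP
    \<subseteq> tensor_prod_space N (young_symmetrizer n la N L ` tensor_power n N) (tensor_power n t)"
  proof
    fix z assume "z \<in> young_map ` TP"
    then obtain x where x: "x \<in> TP" "z = young_map x" by blast
    have basis: "young_map (basis_tensor w)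
        \<in> tensor_prod_space N (young_symmetrizer n la N L ` tensor_power n N) (tensor_power n t)"
      if w: "w \<in> words n M" for w
    proof -
      have w': "take N w \<in> words n N" "drop N w \<in> words n t" using w by (simp_all add: words_append_iff)
      have "basis_tensor w = (tensor_prod N (basis_tensor (take N w)) (basis_tensor (drop N w)) :: 'k tensor)"
        using tensor_prod_basis_tensor[OF words_length[OF w'(1)], of "drop N w", where ?'a = 'k] by simp
      then have "young_map (basis_tensor w) = tensor_prod N
          (young_symmetrizer n la N L (basis_tensor (take N w))) (basis_tensor (drop N w))"
        using tensor_prod_young_symmetrizer[OF basis_tensor_in_tensor_power[OF w'(2)]] by simp
      then show ?thesis
        unfolding tensor_prod_space_def
        using basis_tensor_in_tensor_power[OF w'(1)] basis_tensor_in_tensor_power[OF w'(2)]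
        by (intro span_base) blast
    qed
    have "z = (\<Sum>w\<in>words n M. tscale (x w) (young_map (basis_tensor w)))"
      unfolding x(2) by (subst tensor_expand[OF x(1)])
        (simp add: linear_sum[OF young_map_linear] linear_scale[OF young_map_linear])
    then show "z \<in> tensor_prod_space N (young_symmetrizer n la N L ` tensor_power n N) (tensor_power n t)"
      using basis unfolding tensor_prod_space_def by (auto intro!: span_sum span_scale)
  qed
qed

text \<open>The bijection \<open>col\<close> from the moved positions to the permuted columns
  transports \<pi> to a permutation \<open>h\<close> of positions, and the word belonging to \<pi>
  has the letters \<open>col \<circ> h\<close>. The sum over \<pi> becomes the antisymmetrizer of
  the moved positions.\<close>

lemma g_vector_eq: "g_vector n la N L ga p i s j = young_map (antisym moved_perms col_word)"
proof -
  let ?K = "{1..part ga (i 1)}"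
  let ?back = "\<lambda>\<pi>. map_permutation ?K (inv_into places col) \<pi>"
  let ?F = "\<lambda>h. signed h (young_map (pact (inv h) col_word))"
  have bij: "bij_betw (inv_into places col) ?K places"
    by (rule bij_betw_inv_into[OF bij_betw_col_moved])
  have fin: "finite places" by (simp add: places_def)
  have sub: "places \<subseteq> {1..M}" by (auto simp: places_def)
  have summand: "signed \<pi> (tensor_prod N
       (young_symmetrizer n la N L (tableau_tensor la N L (shift_tableau p i s j \<pi>)))
       (basis_tensor (map \<pi> acols))) = ?F (?back \<pi>)" if \<pi>: "\<pi> permutes ?K" for \<pi>
  proof -
    let ?h = "?back \<pi>"
    have h: "?h permutes places" by (rule map_permutation_permutes[OF bij \<pi>])
    then have hM: "?h permutes {1..M}" using sub by (rule permutes_subset)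
    have "part ga (i 1) \<le> n"
      using part_antimono[OF ga, of 1 "i 1"] i_range p_pos ga_n by fastforce
    then have \<pi>_in: "\<pi> c \<in> {1..n}" if "c \<in> {1..n}" for c
      using that permutes_in_image[OF \<pi>, of c] permutes_not_in[OF \<pi>, of c] by (cases "c \<in> ?K") auto
    have colh: "col (?h q) = (if moved (box q) then \<pi> (col q) else col q)" if q: "q \<in> {1..M}" for q
    proof (cases "moved (box q)")
      case True
      then have qm: "q \<in> places" using q by (simp add: places_def)
      have c: "col q \<in> ?K" using bij_betw_apply[OF bij_betw_col_moved qm] .
      then have "\<pi> (col q) \<in> ?K" using permutes_in_image[OF \<pi>] by blast
      moreover have "?h q = inv_into places col (\<pi> (col q))"
        using map_permutation_apply[OF bij_betw_imp_inj_on[OF bij] c, of \<pi>]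
          inv_into_f_f[OF col_inj_moved qm] by simp
      ultimately have "col (?h q) = \<pi> (col q)"
        using bij_betw_inv_into_right[OF bij_betw_col_moved] by simp
      then show ?thesis using True by simp
    next
      case False
      then have "q \<notin> places" by (simp add: places_def)
      then show ?thesis using False permutes_not_in[OF h] by simp
    qed
    have len: "length (map \<pi> acols) = t" by (simp add: length_added_columns)
    have "set acols \<subseteq> {1..n}"
    proof
      fix c assume "c \<in> set acols"
      then obtain b where b: "b \<in> diagram ga - diagram la" "c = snd b" unfolding set_added_columns by blast
      then have "b \<in> box ` {1..M}" using bij_betw_imp_surj_on[OF bij_betw_box] by blast
      then show "c \<in> {1..n}" using col_in b(2) unfolding col_def by blast
    qed
    then have tail: "basis_tensor (map \<pi> acols) \<in> tensor_power n t"
      using len \<pi>_in by (intro basis_tensor_in_tensor_power) (auto simp: words_def simp del: atLeastAtMost_iff)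
    have "tensor_prod N (tableau_tensor la N L (shift_tableau p i s j \<pi>)) (basis_tensor (map \<pi> acols))
        = word_tensor M (\<lambda>q. if q \<le> N then shift_tableau p i s j \<pi> (inv_into (diagram la) L q)
            else map \<pi> acols ! (q - N - 1))"
      unfolding tableau_tensor_def word_tensor_def[symmetric] by (rule tensor_prod_word_tensor[OF len])
    also have "\<dots> = word_tensor M (col \<circ> ?h)"
    proof (rule word_tensor_cong)
      fix q assume q: "q \<in> {1..M}"
      show "(if q \<le> N then shift_tableau p i s j \<pi> (inv_into (diagram la) L q)
            else map \<pi> acols ! (q - N - 1)) = (col \<circ> ?h) q"
      proof (cases "q \<in> {1..N}")
        case True
        then show ?thesis using colh[OF q] by (simp add: shift_tableau_eq box_old[symmetric] col_def)
      next
        case False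
        have "moved (box q)" using new_moved[OF q False] by (simp add: places_def)
        moreover have "map \<pi> acols ! (q - N - 1) = \<pi> (col q)"
          using box_new(2)[OF q False] q False by (subst nth_map) (auto simp: length_added_columns)
        moreover have "\<not> q \<le> N" using q False by simp
        ultimately show ?thesis using colh[OF q] by simp
      qed
    qed
    also have "\<dots> = pact (inv ?h) col_word"
      by (subst place_act_word_tensor[where f = col, OF permutes_inv[OF hM] col_in])
        (simp_all only: permutes_inv_inv[OF hM])
    finally have "tensor_prod N (young_symmetrizer n la N L (tableau_tensor la N L (shift_tableau p i s j \<pi>)))
       (basis_tensor (map \<pi> acols)) = young_map (pact (inv ?h) col_word)"
      by (simp only: tensor_prod_young_symmetrizer[OF tail])
    moreover have "sign ?h = sign \<pi>"
      by (rule sign_map_permutation[OF bij_betw_imp_inj_on[OF bij] \<pi>]) simp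
    ultimately show ?thesis by simp
  qed
  have "g_vector n la N L ga p i s j = (\<Sum>\<pi> | \<pi> permutes ?K. ?F (?back \<pi>))"
    unfolding g_vector_def by (rule sum.cong[OF refl]) (simp add: summand)
  also have "\<dots> = (\<Sum>h | h permutes places. ?F h)"
  proof (rule sum.reindex_bij_witness[where j = ?back and i = "map_permutation places col"])
    fix \<pi> assume "\<pi> \<in> {\<pi>. \<pi> permutes ?K}"
    then have \<pi>: "\<pi> permutes ?K" by simp
    show "map_permutation places col (?back \<pi>) = \<pi>"
      by (rule map_permutation_compose_inv[OF bij \<pi>]) (rule bij_betw_inv_into_right[OF bij_betw_col_moved])
    show "?back \<pi> \<in> {h. h permutes places}" using map_permutation_permutes[OF bij \<pi>] by simp
  next
    fix h assume "h \<in> {h. h permutes places}"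
    then have h: "h permutes places" by simp
    show "?back (map_permutation places col h) = h"
      by (rule map_permutation_compose_inv[OF bij_betw_col_moved h]) (rule inv_into_f_f[OF col_inj_moved])
    show "map_permutation places col h \<in> {\<pi>. \<pi> permutes ?K}"
      using map_permutation_permutes[OF bij_betw_col_moved h] by simp
  qed simp
  \<comment> \<open>Composing letters with \<open>h\<close> means acting on places by
    \<open>inv h\<close>; inversion preserves signs and permutes the summands.\<close>
  also have "\<dots> = (\<Sum>h | h permutes places. ?F (inv h))"
    by (rule sum_permutations_inverse)
  also have "\<dots> = (\<Sum>h | h permutes places. signed h (young_map (pact h col_word)))"
  proof (rule sum.cong[OF refl])
    fix h assume "h \<in> {h. h permutes places}"
    then have "h permutes places" by simp
    then show "?F (inv h) = signed h (young_map (pact h col_word))"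
      using fin by (simp add: permutes_inv_inv sign_inverse permutes_imp_permutation)
  qed
  also have "\<dots> = young_map (antisym moved_perms col_word)"
    unfolding antisym_def moved_perms_def
    by (simp add: linear_sum[OF young_map_linear] linear_scale[OF young_map_linear])
  finally show ?thesis .
qed

text \<open>An unmoved position is fixed by \<open>h\<close>, and \<tau> keeps its row; if the
  column is kept too, it is fixed. Hence moved positions stay among themselves, and there the column
  determines the position.\<close>

lemma row_moved_column_imp_id:
  assumes \<tau>: "\<tau> \<in> row_perms" and h: "h \<in> moved_perms" and col: "\<tau> \<circ> h \<in> fiber_group M col"
  shows "\<tau> \<circ> h = id"
proof -
  have h': "h permutes places" using h by (simp add: moved_perms_def)
  have \<tau>': "\<tau> permutes {1..N}" "\<And>q. q \<in> {1..N} \<Longrightarrow> fst (box (\<tau> q)) = fst (box q)"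
    using \<tau> row_perms_iff by blast+
  note z = fiber_groupD[OF col]
  have off: "(\<tau> \<circ> h) q = q" if q: "q \<notin> places" for q
  proof (cases "q \<in> {1..M}")
    case True
    then have qN: "q \<in> {1..N}" using new_moved q by blast
    then have "\<tau> q \<in> {1..N}" using permutes_in_image[OF \<tau>'(1)] by blast
    then have "\<tau> q \<in> {1..M}" by simp
    have "col (\<tau> q) = col q" using z(2)[of q] permutes_not_in[OF h' q] by simp
    then have "box (\<tau> q) = box q" using \<tau>'(2)[OF qN] by (simp add: prod_eq_iff col_def)
    then show ?thesis using box_inj[OF \<open>\<tau> q \<in> {1..M}\<close> True] permutes_not_in[OF h' q] by simp
  next
    case False
    then show ?thesis by (rule permutes_not_in[OF z(1)])
  qed
  show ?thesis
  proof
    fix q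
    show "(\<tau> \<circ> h) q = id q"
    proof (cases "q \<in> places")
      case True
      have "(\<tau> \<circ> h) q \<in> places"
      proof (rule ccontr)
        assume n: "(\<tau> \<circ> h) q \<notin> places"
        then have "(\<tau> \<circ> h) ((\<tau> \<circ> h) q) = (\<tau> \<circ> h) q" by (rule off)
        then have "(\<tau> \<circ> h) q = q" by (rule injD[OF permutes_inj[OF z(1)]])
        then show False using n True by simp
      qed
      then have "(\<tau> \<circ> h) q = q" by (rule inj_onD[OF col_inj_moved z(2)[of q] _ True])
      then show ?thesis by simp
    qed (simp add: off[unfolded comp_def])
  qed
qed

text \<open>The coefficient at the word of column indices counts the triples
  \<open>(g, \<tau>, h)\<close> with \<open>\<tau> \<circ> h = id\<close>: for these the two signs
  cancel, and the identities form one such triple.\<close>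

lemma g_vector_nonzero: "g_vector n la N L ga p i s j \<noteq> (0 :: 'k tensor)"
proof -
  let ?w = "map col [1..<Suc M]"
  let ?one = "\<lambda>(g, \<tau>, h). if \<tau> \<circ> h = id then 1 else 0 :: nat"
  note lin = linear_sum[OF act_linear] linear_scale[OF act_linear]
  have fin: "finite col_perms" "finite row_perms" "finite moved_perms"
    using perm_groups perm_group_finite by blast+
  have coeff: "of_int (sign \<tau>) * (of_int (sign h) * pact g (pact \<tau> (pact h col_word)) ?w)
      = (of_nat (?one (g, \<tau>, h)) :: 'k)"
    if m: "g \<in> col_perms" "\<tau> \<in> row_perms" "h \<in> moved_perms" for g \<tau> h
  proof -
    have perm: "g permutes {1..M}" "\<tau> permutes {1..M}" "h permutes {1..M}"
      using m perm_groups perm_groupD(1) by blast+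
    have g: "g \<in> fiber_group M col" using m(1) col_perms_subset by blast
    have comp: "pact g (pact \<tau> (pact h col_word)) = pact (g \<circ> (\<tau> \<circ> h)) col_word"
      using act_comp[OF perm(2,3) col_word_in] act_comp[OF perm(1) permutes_compose[OF perm(3,2)] col_word_in]
      by simp
    have iff: "g \<circ> (\<tau> \<circ> h) \<in> fiber_group M col \<longleftrightarrow> \<tau> \<circ> h \<in> fiber_group M col"
    proof
      assume "g \<circ> (\<tau> \<circ> h) \<in> fiber_group M col"
      then have "inv g \<circ> (g \<circ> (\<tau> \<circ> h)) \<in> fiber_group M col"
        using perm_groupD(3,4)[OF fiber_perms] g by blast
      then show "\<tau> \<circ> h \<in> fiber_group M col" by (simp add: comp_assoc[symmetric] permutes_inv_o[OF perm(1)])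
    qed (use g perm_groupD(4)[OF fiber_perms] in blast)
    have id: "\<tau> \<circ> h \<in> fiber_group M col \<longleftrightarrow> \<tau> \<circ> h = id"
      using row_moved_column_imp_id[OF m(2,3)] perm_groupD(2)[OF fiber_perms] by metis
    have val: "pact g (pact \<tau> (pact h col_word)) ?w
        = (if \<tau> \<circ> h = id then 1 else (0 :: 'k))"
      unfolding comp
      by (subst place_act_word_tensor_coeff[where f = col,
            OF permutes_compose[OF permutes_compose[OF perm(3,2)] perm(1)] col_in])
        (simp_all only: iff id)
    have "sign \<tau> * sign h = 1" if "\<tau> \<circ> h = id"
      using sign_comp[OF perm(2,3)] that by simp
    then have "of_int (sign \<tau>) * of_int (sign h) = (1 :: 'k)" if "\<tau> \<circ> h = id"
      using that by (metis of_int_1 of_int_mult)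
    then show ?thesis unfolding val by simp
  qed
  have "g_vector n la N L ga p i s j ?w = (\<Sum>g\<in>col_perms. \<Sum>\<tau>\<in>row_perms. \<Sum>h\<in>moved_perms.
      of_int (sign \<tau>) * (of_int (sign h) * pact g (pact \<tau> (pact h col_word)) ?w))"
    unfolding g_vector_eq young_map_def symmetrizer_def sum_tensor_apply
  proof (rule sum.cong[OF refl])
    fix g assume "g \<in> col_perms"
    then have g: "g permutes {1..M}" using perm_groups perm_groupD(1) by blast
    have "pact \<tau> (antisym moved_perms col_word)
        = (\<Sum>h\<in>moved_perms. signed h (pact \<tau> (pact h col_word)))"
      if "\<tau> \<in> row_perms" for \<tau>
    proof -
      have "\<tau> permutes {1..M}" using that perm_groups perm_groupD(1) by blast
      then show ?thesis unfolding antisym_def by (simp add: lin)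
    qed
    then have "antisym row_perms (antisym moved_perms col_word)
        = (\<Sum>\<tau>\<in>row_perms. signed \<tau>
            (\<Sum>h\<in>moved_perms. signed h (pact \<tau> (pact h col_word))))"
      unfolding antisym_def[of row_perms] by simp
    then show "pact g (antisym row_perms (antisym moved_perms col_word)) ?w
      = (\<Sum>\<tau>\<in>row_perms. \<Sum>h\<in>moved_perms.
      of_int (sign \<tau>) * (of_int (sign h) * pact g (pact \<tau> (pact h col_word)) ?w))"
      using g by (simp add: lin sum_tensor_apply tscale_apply sum_distrib_left)
  qed
  also have "\<dots> = of_nat (\<Sum>x\<in>col_perms \<times> row_perms \<times> moved_perms. ?one x)"
    by (simp add: coeff sum.cartesian_product[symmetric])
  also have "\<dots> \<noteq> 0"
  proof -
    have "(id, id, id) \<in> col_perms \<times> row_perms \<times> moved_perms"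
      using perm_groups perm_groupD(2) by blast
    then have "1 \<le> (\<Sum>x\<in>col_perms \<times> row_perms \<times> moved_perms. ?one x)"
      using member_le_sum[of "(id, id, id)" "col_perms \<times> row_perms \<times> moved_perms" ?one] fin by simp
    then show ?thesis by (metis not_one_le_zero of_nat_eq_0_iff)
  qed
  finally show ?thesis by auto
qed

section \<open>Factoring the row group of the rearranged tableau\<close>

abbreviation "new_row_perms \<equiv> fiber_group M (\<lambda>q. new_row (box q))"

definition unmoved_perms :: "(nat \<Rightarrow> nat) set" where
  "unmoved_perms = {k \<in> new_row_perms. \<forall>q\<in>places. k q = q}"

text \<open>All positions beyond \<open>N\<close> are moved, hence fixed. For an unmoved box the new
  row determines the old one, so old rows are preserved.\<close>

lemma unmoved_perms_subset: "unmoved_perms \<subseteq> row_perms"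
proof
  fix k assume k: "k \<in> unmoved_perms"
  then have k': "k permutes {1..M}" "\<And>q. new_row (box (k q)) = new_row (box q)"
    "\<And>q. q \<in> places \<Longrightarrow> k q = q"
    unfolding unmoved_perms_def using fiber_groupD by fastforce+
  show "k \<in> row_perms"
    unfolding row_perms_iff
  proof
    show "k permutes {1..N}"
      by (rule permutes_superset[OF k'(1)]) (use k'(3) new_moved in blast)
    show "\<forall>q\<in>{1..N}. fst (box (k q)) = fst (box q)"
    proof
      fix q assume "q \<in> {1..N}"
      then have q: "q \<in> {1..M}" by simp
      then have kq: "k q \<in> {1..M}" using permutes_in_image[OF k'(1)] by blast
      show "fst (box (k q)) = fst (box q)"
      proof (cases "q \<in> places")
        case False
        then have nm: "\<not> moved (box q)" using q by (simp add: places_def)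
        then have nm': "\<not> moved (box (k q))"
          using new_row_eq_iff[OF box_in[OF q]] new_row_eq_iff[OF box_in[OF kq]] k'(2)[of q] by simp
        show ?thesis
          using unmoved_row_inj[OF box_in[OF kq] nm' box_in[OF q] nm] k'(2)[of q] nm nm'
          by (simp add: new_row_def)
      qed (simp add: k'(3))
    qed
  qed
qed

text \<open>Row \<open>i 1\<close> of the rearranged tableau consists exactly of the moved
  positions, so its row group splits into the permutations of that row and those of the remaining
  rows.\<close>

lemma bij_betw_new_row_perms:
  "bij_betw (\<lambda>(k, h). k \<circ> h) (unmoved_perms \<times> moved_perms) new_row_perms"
  unfolding bij_betw_def
proof
  have sub: "places \<subseteq> {1..M}" by (auto simp: places_def)
  have fix_off: "h q = q" if "h \<in> moved_perms" "q \<notin> places" for h q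
    using that permutes_not_in by (auto simp: moved_perms_def)
  have into: "h q \<in> places" if "h \<in> moved_perms" "q \<in> places" for h q
    using that permutes_in_image[of h places q] by (simp add: moved_perms_def)
  show "inj_on (\<lambda>(k, h). k \<circ> h) (unmoved_perms \<times> moved_perms)"
  proof (rule inj_onI, clarify)
    fix k h k' h' assume m: "k \<in> unmoved_perms" "h \<in> moved_perms" "k' \<in> unmoved_perms" "h' \<in> moved_perms"
      and eq: "k \<circ> h = k' \<circ> h'"
    have "h q = h' q" for q
    proof (cases "q \<in> places")
      case True
      then show ?thesis
        using fun_cong[OF eq, of q] into[OF m(2) True] into[OF m(4) True] m(1,3)
        by (simp add: unmoved_perms_def)
    qed (simp add: fix_off m)
    then have "h = h'" by blast
    moreover have "h permutes {1..M}" using m(2) sub by (auto simp: moved_perms_def intro: permutes_subset)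
    then have "k \<circ> h \<circ> inv h = k" "k' \<circ> h \<circ> inv h = k'"
      by (simp_all add: comp_assoc permutes_inv_o)
    ultimately show "k = k' \<and> h = h'" using eq by metis
  qed
  have moved_row: "new_row (box q) = i 1 \<longleftrightarrow> q \<in> places" if "q \<in> {1..M}" for q
    using new_row_eq_iff[OF box_in[OF that]] that by (simp add: places_def)
  have moved_in: "h \<in> new_row_perms" if "h \<in> moved_perms" for h
  proof (rule fiber_groupI)
    show "h permutes {1..M}" using that sub by (auto simp: moved_perms_def intro: permutes_subset)
    fix q assume q: "q \<in> {1..M}"
    show "new_row (box (h q)) = new_row (box q)"
    proof (cases "q \<in> places")
      case True
      then have "new_row (box (h q)) = i 1" using into[OF that True] moved_row sub by blast
      moreover have "new_row (box q) = i 1" using True moved_row q by blast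
      ultimately show ?thesis by simp
    qed (simp add: fix_off that)
  qed
  show "(\<lambda>(k, h). k \<circ> h) ` (unmoved_perms \<times> moved_perms) = new_row_perms"
  proof
    show "(\<lambda>(k, h). k \<circ> h) ` (unmoved_perms \<times> moved_perms) \<subseteq> new_row_perms"
    proof clarify
      fix k h assume "k \<in> unmoved_perms" "h \<in> moved_perms"
      then show "k \<circ> h \<in> new_row_perms"
        using moved_in by (intro perm_groupD(4)[OF fiber_perms])
          (simp_all add: unmoved_perms_def)
    qed
    show "new_row_perms \<subseteq> (\<lambda>(k, h). k \<circ> h) ` (unmoved_perms \<times> moved_perms)"
    proof
      fix y assume y: "y \<in> new_row_perms"
      note y' = fiber_groupD[OF y]
      have y_in: "y q \<in> places" if "q \<in> places" for q
      proof -
        have "q \<in> {1..M}" using that sub by blast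
        moreover from this have "y q \<in> {1..M}" using permutes_in_image[OF y'(1)] by blast
        ultimately show ?thesis using that moved_row y'(2) by metis
      qed
      have "finite places" by (simp add: places_def)
      then obtain h where perm: "h permutes places" and h_eq: "\<And>q. q \<in> places \<Longrightarrow> h q = y q"
        using extend_to_permutation[of places y, OF _ y_in injD[OF permutes_inj[OF y'(1)]]] by blast
      then have h: "h \<in> moved_perms" by (simp add: moved_perms_def)
      have "y \<circ> inv h \<in> unmoved_perms"
        unfolding unmoved_perms_def
      proof (intro CollectI conjI ballI)
        show "y \<circ> inv h \<in> new_row_perms"
          by (intro perm_groupD(3,4)[OF fiber_perms] y moved_in[OF h])
        fix q assume q: "q \<in> places"
        then have "inv h q \<in> places" using permutes_in_image[OF permutes_inv[OF perm]] by blast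
        then have "y (inv h q) = h (inv h q)" by (simp add: h_eq)
        then show "(y \<circ> inv h) q = q" by (simp add: permutes_inverses[OF perm])
      qed
      moreover have "y = (y \<circ> inv h) \<circ> h" by (simp add: comp_assoc permutes_inv_o[OF perm])
      ultimately show "y \<in> (\<lambda>(k, h). k \<circ> h) ` (unmoved_perms \<times> moved_perms)"
        using h by (intro image_eqI[of _ _ "(y \<circ> inv h, h)"]) simp_all
    qed
  qed
qed

lemma young_tableau_new_row: "young_tableau M ga (\<lambda>q. new_row (box q)) col"
  using bij_betw_trans[OF bij_betw_box bij_betw_new_box] by unfold_locales (simp add: comp_def col_def)

text \<open>
  Row antisymmetrization over \<open>\<Lambda>\<close> absorbs \<open>unmoved_perms\<close>, so up to the factor
  \<open>card unmoved_perms\<close> the alternating sum over \<open>\<pi>\<close> may be replaced by one over a full row group.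
\<close>

lemma young_map_new_row:
  "young_map (antisym new_row_perms col_word)
    = tscale (of_nat (card unmoved_perms)) (g_vector n la N L ga p i s j)"
proof -
  let ?R = "antisym row_perms"
  note Rlin = linear_sum[OF galg_linear[OF symms_galg(2)]]
    linear_scale[OF galg_linear[OF symms_galg(2)]]
  have "antisym new_row_perms col_word
      = (\<Sum>(k, h)\<in>unmoved_perms \<times> moved_perms. signed (k \<circ> h) (pact (k \<circ> h) col_word))"
    unfolding antisym_def
    by (subst sum.reindex_bij_betw[OF bij_betw_new_row_perms, symmetric]) (simp add: case_prod_beta')
  then have "?R (antisym new_row_perms col_word)
      = (\<Sum>(k, h)\<in>unmoved_perms \<times> moved_perms. signed (k \<circ> h) (?R (pact (k \<circ> h) col_word)))"
    by (simp add: Rlin case_prod_beta')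
  also have "\<dots> = (\<Sum>(k, h)\<in>unmoved_perms \<times> moved_perms. signed h (?R (pact h col_word)))"
  proof (rule sum.cong[OF refl], clarify)
    fix k h assume m: "k \<in> unmoved_perms" "h \<in> moved_perms"
    have k: "k \<in> row_perms" using m unmoved_perms_subset by blast
    have perm: "k permutes {1..M}" "h permutes {1..M}"
      using k m perm_groups perm_groupD(1) by blast+
    show "signed (k \<circ> h) (?R (pact (k \<circ> h) col_word))
        = signed h (?R (pact h col_word))"
      using act_comp[OF perm col_word_in]
        antisym_act[OF perm_groups(2) k act_into[OF perm(2) col_word_in]]
      by (simp add: mult.commute sign_cancel(2)[OF perm(2,1), symmetric])
  qed
  also have "\<dots> = (\<Sum>k\<in>unmoved_perms. \<Sum>h\<in>moved_perms. signed h (?R (pact h col_word)))"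
    by (rule sum.cartesian_product[symmetric])
  also have "\<dots> = (\<Sum>k\<in>unmoved_perms. ?R (antisym moved_perms col_word))"
    unfolding antisym_def[of moved_perms] by (simp add: Rlin)
  also have "\<dots> = tscale (of_nat (card unmoved_perms)) (?R (antisym moved_perms col_word))"
    by (rule sum_constant_scale)
  finally show ?thesis
    unfolding young_map_def g_vector_eq
    by (simp add: linear_scale[OF galg_linear[OF symms_galg(1)]])
qed

lemma card_unmoved_perms: "card unmoved_perms \<noteq> 0"
proof -
  have "id \<in> unmoved_perms"
    using perm_groupD(2)[OF fiber_perms] by (simp add: unmoved_perms_def)
  moreover have "finite unmoved_perms"
    using unmoved_perms_subset perm_group_finite[OF perm_groups(2)] finite_subset by blast
  ultimately show ?thesis by auto
qed

section \<open>The copy of the Schur module that contains the vector\<close>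

lemma sum_list_ga: "sum_list ga = M"
  using ga by (simp add: is_partition_def)

theorem highest_weight_decomposition:
  "\<exists>\<D>. irreducible_decomposition scl n e M
     (tensor_prod_space N (young_symmetrizer n la N L ` tensor_power n N) (tensor_power n t)) \<D> \<and>
     (\<exists>W\<in>\<D>. GL_isomorphic scl n e M W (schur_module n ga) \<and>
        highest_weight_vector scl n e M W (g_vector n la N L ga p i s j))"
proof -
  let ?g = "g_vector n la N L ga p i s j :: 'k tensor"
  let ?row = "\<lambda>q. fst (inv_into (diagram ga) (row_tableau ga) q)"
  let ?col = "\<lambda>q. snd (inv_into (diagram ga) (row_tableau ga) q)"
  have bij: "bij_betw (row_tableau ga) (diagram ga) {1..M}"
    using bij_betw_row_tableau[of ga] by (simp only: sum_list_ga)
  interpret Y: young_tableau M ga ?row ?col by (rule young_tableau_inv_into[OF bij])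
  interpret S: tensor_young scl n e M ga ?row ?col
  proof unfold_locales
    fix q assume "q \<in> {1..M}"
    then have "(?row q, ?col q) \<in> diagram ga" by (rule Y.box_in)
    then have "1 \<le> ?row q" "?col q \<le> part ga (?row q)" unfolding mem_diagram_iff by auto
    then show "?col q \<le> n" using part_antimono[OF ga, of 1 "?row q"] ga_n by simp
  qed
  let ?a = "symmetrizer (fiber_group M ?col)" and ?b = "antisym (fiber_group M ?row)"
  let ?h = "?a (?b S.col_tensor)"
  let ?S = "(\<lambda>x. ?a (?b x)) ` TP"
  have schur: "schur_module n ga = ?S"
  proof -
    have "young_symmetrizer n ga M (row_tableau ga) x = ?a (?b x)" for x :: "'k tensor"
      unfolding young_symmetrizer_def column_group_eq[OF bij] row_group_eq[OF bij]
        symmetrizer_def antisym_def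
      by (intro sum.cong refl)
        (simp add: linear_sum[OF act_linear[OF fiber_groupD(1)]] linear_scale[OF act_linear[OF fiber_groupD(1)]])
    then show ?thesis unfolding schur_module_def sum_list_ga by simp
  qed
  obtain r where r: "r \<in> galg" "r ?h = ?b S.col_tensor" using S.alt_col_tensor_return by blast
  obtain c where c: "c permutes {1..M}"
    "antisym new_row_perms col_word = pact c (?b S.col_tensor)"
    by (rule S.antisymmetrized_word_conjugate[OF young_tableau_new_row])
  have hT: "?h \<in> TP"
    using galg_into S.symm_galg S.alt_galg S.col_tensor_in by blast
  obtain y where y: "y \<in> galg" "\<forall>x\<in>TP. young_map x = y x"
    unfolding young_map_def using galg_comp[OF symms_galg(1,2)] by metis
  obtain y1 where y1: "y1 \<in> galg" "\<forall>x\<in>TP. y (pact c x) = y1 x"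
    using galg_comp[OF y(1) galg.act[OF c(1)]] by blast
  obtain y2 where y2: "y2 \<in> galg" "\<forall>x\<in>TP. y1 (r x) = y2 x"
    using galg_comp[OF y1(1) r(1)] by blast
  \<comment> \<open>\<open>R\<close> composes \<open>r\<close> from \<open>h\<close> back to
    \<open>v\<close>, \<open>c\<close> from \<open>v\<close> to the rearranged tableau, and
    \<open>young_map\<close>, and then removes the factor \<open>card unmoved_perms\<close>; so it
    takes \<open>h\<close> to the vector of the theorem.\<close>
  define R where "R x = tscale (inverse (of_nat (card unmoved_perms))) (y2 x)" for x
  have R: "R \<in> galg" unfolding R_def[abs_def] by (rule galg.scale[OF y2(1)])
  have vT: "?b S.col_tensor \<in> TP"
    using galg_into S.alt_galg S.col_tensor_in by blast
  have "y2 ?h = young_map (antisym new_row_perms col_word)"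
    unfolding c(2) bspec[OF y(2) act_into[OF c(1) vT]] bspec[OF y1(2) vT]
      bspec[OF y2(2) hT, symmetric] r(2) ..
  then have Rh: "R ?h = ?g"
    unfolding R_def young_map_new_row using card_unmoved_perms by simp
  have simpleS: "simple ?S" by (rule S.simple_symm_alt)
  have hS: "?h \<in> ?S" using S.col_tensor_in by blast
  let ?W = "R ` ?S"
  have gW: "?g \<in> ?W" using hS Rh by force
  have W: "simple ?W" "inj_on R ?S"
    by (rule simple_image[OF R simpleS]; use gW g_vector_nonzero in blast)+
  let ?M = "young_map ` TP"
  have M: "?M = y ` TP" using y(2) by auto
  have stM: "stable ?M" unfolding M by (rule stable_image[OF y(1) stable_T])
  have gM: "?g \<in> ?M"
    unfolding g_vector_eq
    using galg_into[OF symms_galg(3) col_word_in] by blast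
  \<comment> \<open>By simplicity each vector of the copy is an equivariant image of the vector of
    the theorem, which lies in the stable ambient module.\<close>
  have WM: "?W \<subseteq> ?M"
  proof
    fix x assume "x \<in> ?W"
    then obtain f where "equivariant f" "f ?g = x"
      using simpleD[OF W(1) gW _ g_vector_nonzero] by blast
    then show "x \<in> ?M" using stM gM by (auto simp: stable_def)
  qed
  have MT: "?M \<subseteq> TP" and subM: "subspace ?M" using stM unfolding stable_def by blast+
  have spanM: "?M \<subseteq> span (\<Union>{W. simple W \<and> W \<subseteq> ?M})"
    using image_span_simple[OF y(1)] unfolding M .
  \<comment> \<open>The greedy decomposition starts from this copy, so the copy is one of its
    summands.\<close>
  obtain D where D: "finite D" "?W \<in> D" "\<forall>W\<in>D. simple W" "?M = span (\<Union>D)"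
    "\<forall>f. (\<forall>W\<in>D. f W \<in> W) \<and> (\<Sum>W\<in>D. f W) = 0 \<longrightarrow> (\<forall>W\<in>D. f W = 0)"
    by (rule direct_decomposition[OF MT subM spanM W(1) WM]) blast
  have decomp: "irreducible_decomposition scl n e M
      (tensor_prod_space N (young_symmetrizer n la N L ` tensor_power n N) (tensor_power n t)) D"
    unfolding irreducible_decomposition_def tensor_prod_space_eq
    using D GL_irreducible_simple by blast
  have iso: "GL_isomorphic scl n e M ?W (schur_module n ga)"
    unfolding GL_isomorphic_def schur
  proof (intro exI conjI ballI allI)
    have ST: "?S \<subseteq> TP" using simpleS by (simp add: simple_def stable_def)
    have subS: "subspace ?S" using simpleS by (simp add: simple_def stable_def)
    note Rlin = galg_linear[OF R]
    let ?\<phi> = "inv_into ?S R"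
    have inv: "?\<phi> (R x) = x" if "x \<in> ?S" for x using inv_into_f_f[OF W(2) that] .
    show "bij_betw ?\<phi> ?W ?S" by (rule bij_betw_inv_into[OF inj_on_imp_bij_betw[OF W(2)]])
    show "?\<phi> (x + y) = ?\<phi> x + ?\<phi> y" if xW: "x \<in> ?W" and yW: "y \<in> ?W" for x y
    proof -
      obtain u where u: "x = R u" "u \<in> ?S" using xW by (rule imageE)
      obtain v where v: "y = R v" "v \<in> ?S" using yW by (rule imageE)
      have "x + y = R (u + v)" unfolding u v by (simp only: linear_add[OF Rlin])
      then show ?thesis
        by (simp only: u(1) v(1) inv[OF u(2)] inv[OF v(2)] inv[OF subspace_add[OF subS u(2) v(2)]])
    qed
    show "?\<phi> (tscale c x) = tscale c (?\<phi> x)" if xW: "x \<in> ?W" for c x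
    proof -
      obtain u where u: "x = R u" "u \<in> ?S" using xW by (rule imageE)
      have "tscale c x = R (tscale c u)" unfolding u by (simp only: linear_scale[OF Rlin])
      then show ?thesis
        by (simp only: u(1) inv[OF u(2)] inv[OF subspace_scale[OF subS u(2)]])
    qed
    show "?\<phi> (tensor_act scl n e M g x) = tensor_act scl n e M g (?\<phi> x)" if xW: "x \<in> ?W" for g x
    proof -
      obtain u where u: "x = R u" "u \<in> ?S" using xW by (rule imageE)
      have eq: "equivariant (tensor_act scl n e M g)"
        unfolding tensor_act_eq_matrix_act by (rule equivariant_matrix_act)
      have gu: "tensor_act scl n e M g u \<in> ?S"
        using simpleS eq u(2) unfolding simple_def stable_def by blast
      have "tensor_act scl n e M g x = R (tensor_act scl n e M g u)"
        unfolding u(1) by (rule galg_equivariant[OF R eq subsetD[OF ST u(2)]])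
      then show ?thesis by (simp only: u(1) inv[OF u(2)] inv[OF gu])
    qed
  qed
  have hwv: "highest_weight_vector scl n e M ?W ?g"
    unfolding highest_weight_vector_def
  proof (intro conjI ballI)
    fix u assume u: "u \<in> unipotent_group scl n e"
    have eq: "equivariant (tensor_act scl n e M u)"
      unfolding tensor_act_eq_matrix_act by (rule equivariant_matrix_act)
    \<comment> \<open>Unipotent invariance passes from \<open>v\<close> to \<open>h\<close>, and
      then along \<open>R\<close>, because the group algebra commutes with
      \<open>tensor_act\<close>.\<close>
    have h: "tensor_act scl n e M u ?h = ?h"
      using galg_equivariant[OF S.symm_galg eq vT] S.alt_col_tensor_unipotent[OF u]
      by (simp only:)
    show "tensor_act scl n e M u ?g = ?g"
      using galg_equivariant[OF R eq hT] by (simp only: Rh h)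
  qed (use gW g_vector_nonzero in auto)
  show ?thesis using decomp iso hwv D(2) by blast
qed

end

theorem lemma1p11:
  fixes scale :: "'k::field_char_0 \<Rightarrow> 'v::ab_group_add \<Rightarrow> 'v"
    and e :: "nat \<Rightarrow> 'v"
    and n N t p :: nat
    and la ga :: "nat list"
    and L :: "nat \<times> nat \<Rightarrow> nat"
    and i s :: "nat \<Rightarrow> nat"
    and j :: "nat \<Rightarrow> nat \<Rightarrow> nat"
  assumes V: "vector_space scale" "ordered_basis scale n e"
    and t: "t \<ge> 1"
    and la: "is_partition la N"
    and ga: "is_partition ga (N + t)"
    and la_ga: "diagram la \<subseteq> diagram ga"
    and different_columns: "inj_on snd (diagram ga - diagram la)"
    and ga_n: "part ga 1 \<le> n"
    and added: "diagram ga - diagram la = {(i r, j r a) | r a. r \<in> {1..p} \<and> a \<in> {1..s r}}"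
    and s_pos: "\<forall>r\<in>{1..p}. s r \<ge> 1"
    and i_range: "\<forall>r\<in>{1..p}. 1 \<le> i r \<and> i r \<le> length ga"
    and i_mono: "strict_mono_on {1..p} i"
    and j_consecutive: "\<forall>r\<in>{1..p}. \<forall>a\<in>{1..<s r}. j r (a + 1) = j r a + 1"
    and L: "is_tableau la N L" "\<forall>c\<in>{1..N}. content la L c = 1"
  shows "\<exists>\<D>. irreducible_decomposition scale n e (N + t)
               (tensor_prod_space N (young_symmetrizer n la N L ` tensor_power n N) (tensor_power n t)) \<D> \<and>
             (\<exists>W\<in>\<D>. GL_isomorphic scale n e (N + t) W (schur_module n ga) \<and>
                    highest_weight_vector scale n e (N + t) W (g_vector n la N L ga p i s j))"
proof -
  interpret vector_space scale by fact
  interpret P: pieri_tensor scale n e N t p la ga i s j L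
    by unfold_locales (use assms content_1_iff_bij_betw[OF L(1)] in auto)
  show ?thesis by (rule P.highest_weight_decomposition)
qed

end
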